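(* Let $S=\{c_1,\dots,c_n\}$ with $0\le c_1<c_2<\dots<c_n=\bar c$ and set $V^{c_i}(x):=V^S(x,c_i)$. For each $1\le i<n$, $V^{c_i}$ is the unique viscosity solution $u:[0,\infty)\to\mathbb R$ of $$\max\{\mathcal L^{c_i}(u)(x),\ V^{c_{i+1}}(x)-u(x)\}=0,\quad x>0,$$ with $u(0)=0$ and $\lim_{x\to\infty}u(x)=\bar c/q$.
   Context: Fix constants $\mu>0$, $\sigma>0$, $q>0$. Let $W$ be a standard Brownian motion and $X_t=x+\mu t+\sigma W_t$, with $(\mathcal F_t)_{t\ge0}$ the completed filtration generated by $X$. For a set $S\subset[0,\infty)$ with $\bar c=\max S<\infty$, $x\ge0$ and $c\in S$, let $\Pi^S_{x,c}$ be the set of processes $C=(C_t)_{t\ge0}$ that are non-decreasing, right-continuous, $(\mathcal F_t)$-adapted, with $C_t\in S$ and $C_t\ge c$ for all $t$. The controlled surplus is $X^C_t=X_t-\int_0^tC_s\,ds$, the ruin time is $\tau=\inf\{t\ge0:X^C_t<0\}$, $J(x;C)=\mathbb E[\int_0^\tau e^{-qs}C_s\,ds]$, and $V^S(x,c)=\sup_{C\in\Pi^S_{x,c}}J(x;C)$. For $c\ge0$, $\mathcal L^c(W)=\frac{\sigma^2}{2}W''+(\mu-c)W'-qW+c$. One-dimensional viscosity notions for the equation $\max\{\mathcal L^{c_i}(u)(x),V^{c_{i+1}}(x)-u(x)\}=0$: a locally Lipschitz $\bar u:[0,\infty)\to\mathbb R$ is a viscosity supersolution at $x>0$ if every $C^2$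 function $\varphi$ with $\varphi(x)=\bar u(x)$ such that $\bar u-\varphi$ attains its minimum at $x$ satisfies $\max\{\mathcal L^{c_i}(\varphi)(x),V^{c_{i+1}}(x)-\varphi(x)\}\le0$; a function $\underline u$ is a viscosity subsolution at $x$ if every $C^2$ function $\psi$ with $\psi(x)=\underline u(x)$ such that $\underline u-\psi$ attains its maximum at $x$ satisfies $\max\{\mathcal L^{c_i}(\psi)(x),V^{c_{i+1}}(x)-\psi(x)\}\ge0$; a viscosity solution is both. *)

theory Defs
  imports "HOL-Probability.Probability"
begin

definition std_BM :: "'a measure \<Rightarrow> (real \<Rightarrow> 'a \<Rightarrow> real) \<Rightarrow> bool" where
  "std_BM M W \<longleftrightarrow> prob_space M
     \<and> (\<forall>t\<ge>0. W t \<in> borel_measurable M)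
     \<and> (AE \<omega> in M. W 0 \<omega> = 0 \<and> continuous_on {0..} (\<lambda>t. W t \<omega>))
     \<and> (\<forall>s t. 0 \<le> s \<and> s < t \<longrightarrow>
          distributed M lborel (\<lambda>\<omega>. W t \<omega> - W s \<omega>)
            (\<lambda>y. ennreal (normal_density 0 (sqrt (t - s)) y)))
     \<and> (\<forall>(ts :: nat \<Rightarrow> real) k. 0 \<le> ts 0 \<and> (\<forall>j<k. ts j < ts (Suc j)) \<longrightarrow>
          prob_space.indep_vars M (\<lambda>_. borel) (\<lambda>j \<omega>. W (ts (Suc j)) \<omega> - W (ts j) \<omega>) {..<k})"

definition Xproc :: "real \<Rightarrow> real \<Rightarrow> (real \<Rightarrow> 'a \<Rightarrow> real) \<Rightarrow> real \<Rightarrow> real \<Rightarrow> 'a \<Rightarrow> real" where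
  "Xproc \<mu> \<sigma> W x t \<omega> = x + \<mu> * t + \<sigma> * W t \<omega>"

definition gen_filtration :: "'a measure \<Rightarrow> (real \<Rightarrow> 'a \<Rightarrow> real) \<Rightarrow> real \<Rightarrow> 'a set set" where
  "gen_filtration M X t = sigma_sets (space M)
      ({X s -` B \<inter> space M | s B. 0 \<le> s \<and> s \<le> t \<and> B \<in> sets borel} \<union> null_sets M)"

definition controls :: "'a measure \<Rightarrow> (real \<Rightarrow> 'a \<Rightarrow> real) \<Rightarrow> real set \<Rightarrow> real \<Rightarrow>
     (real \<Rightarrow> 'a \<Rightarrow> real) set" where
  "controls M X S c = {C. (\<forall>\<omega>\<in>space M. mono_on {0..} (\<lambda>t. C t \<omega>)
          \<and> (\<forall>t\<ge>0. continuous (at_right t) (\<lambda>s. C s \<omega>))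
          \<and> (\<forall>t\<ge>0. C t \<omega> \<in> S \<and> c \<le> C t \<omega>))
       \<and> (\<forall>t\<ge>0. C t \<in> measurable (sigma (space M) (gen_filtration M X t)) borel)}"

definition Xctrl :: "(real \<Rightarrow> 'a \<Rightarrow> real) \<Rightarrow> (real \<Rightarrow> 'a \<Rightarrow> real) \<Rightarrow> real \<Rightarrow> 'a \<Rightarrow> real" where
  "Xctrl X C t \<omega> = X t \<omega> - (LBINT s:{0..t}. C s \<omega>)"

text \<open>Ruin time tau = inf{t>=0. X^C_t < 0} (= infinity if the set is empty).\<close>
definition ruin_time :: "(real \<Rightarrow> 'a \<Rightarrow> real) \<Rightarrow> 'a \<Rightarrow> ereal" where
  "ruin_time Y \<omega> = Inf ((\<lambda>t. ereal t) ` {t. 0 \<le> t \<and> Y t \<omega> < 0})"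

definition Jfun :: "'a measure \<Rightarrow> real \<Rightarrow> (real \<Rightarrow> 'a \<Rightarrow> real) \<Rightarrow> (real \<Rightarrow> 'a \<Rightarrow> real) \<Rightarrow> ennreal" where
  "Jfun M q X C = (\<integral>\<^sup>+ \<omega>. (\<integral>\<^sup>+ s. ennreal (exp (- q * s) * C s \<omega>
        * indicator {s. 0 \<le> s \<and> ereal s < ruin_time (Xctrl X C) \<omega>} s) \<partial>lborel) \<partial>M)"

definition VS :: "'a measure \<Rightarrow> (real \<Rightarrow> 'a \<Rightarrow> real) \<Rightarrow> real \<Rightarrow> real \<Rightarrow> real \<Rightarrow> real set
     \<Rightarrow> real \<Rightarrow> real \<Rightarrow> real" where
  "VS M W \<mu> \<sigma> q S x c =
     (let X = Xproc \<mu> \<sigma> W x in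
      enn2real (SUP C \<in> controls M X S c. Jfun M q X C))"

definition C2 :: "(real \<Rightarrow> real) \<Rightarrow> bool" where
  "C2 f \<longleftrightarrow> (\<exists>f' f''. (\<forall>y. (f has_real_derivative f' y) (at y))
       \<and> (\<forall>y. (f' has_real_derivative f'' y) (at y)) \<and> continuous_on UNIV f'')"

definition Lop :: "real \<Rightarrow> real \<Rightarrow> real \<Rightarrow> real \<Rightarrow> (real \<Rightarrow> real) \<Rightarrow> real \<Rightarrow> real" where
  "Lop \<mu> \<sigma> q c f x = \<sigma>\<^sup>2 / 2 * deriv (deriv f) x + (\<mu> - c) * deriv f x - q * f x + c"

definition loc_lipschitz0 :: "(real \<Rightarrow> real) \<Rightarrow> bool" where
  "loc_lipschitz0 u \<longleftrightarrow> (\<forall>b\<ge>0. \<exists>L. lipschitz_on L {0..b} u)"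

definition visc_super :: "real \<Rightarrow> real \<Rightarrow> real \<Rightarrow> real \<Rightarrow> (real \<Rightarrow> real) \<Rightarrow> (real \<Rightarrow> real) \<Rightarrow> real \<Rightarrow> bool" where
  "visc_super \<mu> \<sigma> q c g u x \<longleftrightarrow> loc_lipschitz0 u \<and>
     (\<forall>\<phi>. C2 \<phi> \<and> \<phi> x = u x \<and> (\<forall>y\<ge>0. u y - \<phi> y \<ge> u x - \<phi> x) \<longrightarrow>
        max (Lop \<mu> \<sigma> q c \<phi> x) (g x - \<phi> x) \<le> 0)"

definition visc_sub :: "real \<Rightarrow> real \<Rightarrow> real \<Rightarrow> real \<Rightarrow> (real \<Rightarrow> real) \<Rightarrow> (real \<Rightarrow> real) \<Rightarrow> real \<Rightarrow> bool" where
  "visc_sub \<mu> \<sigma> q c g u x \<longleftrightarrow>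
     (\<forall>\<psi>. C2 \<psi> \<and> \<psi> x = u x \<and> (\<forall>y\<ge>0. u y - \<psi> y \<le> u x - \<psi> x) \<longrightarrow>
        max (Lop \<mu> \<sigma> q c \<psi> x) (g x - \<psi> x) \<ge> 0)"

definition visc_solution :: "real \<Rightarrow> real \<Rightarrow> real \<Rightarrow> real \<Rightarrow> (real \<Rightarrow> real) \<Rightarrow> (real \<Rightarrow> real) \<Rightarrow> bool" where
  "visc_solution \<mu> \<sigma> q c g u \<longleftrightarrow>
     (\<forall>x>0. visc_super \<mu> \<sigma> q c g u x \<and> visc_sub \<mu> \<sigma> q c g u x)"

end

theory Submission
  imports Defs
begin

text \<open>
  The value function is approximated from below by $v_l$, the value when the dividend rate may be
  raised only at times in $2^{-l}\mathbb{N}$: rounding an arbitrary control down to this grid only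
  delays ruin, so Fatou's lemma gives $v_l \uparrow V$. On the grid the problem is a finite dynamic
  programme for the killed one-step operator $P_l$, which is the limit of iterated Gaussian kernels
  $K$ with ruin monitored on finer and finer grids. Hence neither measurable selection nor a strong
  Markov property is needed; independence of $\mathcal F_t$ and $W_{t+e} - W_t$ suffices.

  The supersolution property follows from $V \ge P_l V$ and a small-time expansion of $P_l$, the
  subsolution property from $v_l^{c_i} \le \max (K v_l^{c_i}, v_l^{c_{i+1}})$ evaluated at
  near-maximisers of $v_l - \psi$. The value at 0 is controlled by a parabolic barrier, and the
  Lipschitz bound by comparing $V$ with exponentials from below.

  For uniqueness, consider a positive maximum of $u - v$. Near it $u$ exceeds the obstacle, so $u$ lies
  below and $v$ above the solutions of the linear equation with their own boundary values on a small
  interval; the difference of these two solutions violates the classical maximum principle.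
\<close>

section \<open>Viscosity tests by quadratic jets and uniqueness\<close>

text \<open>Two quantitative demands shape the analytic half. The points where a test function
  touches move with the step length e, and in the barrier argument the errors of 2^m steps add up.
  So every small-time estimate carries an error of order e^2 whose constant depends only on the
  contact radius and on bounds for the function and its jet, never on the point. A parabola with a
  quartic correction serves this end: the quartic turns local contact into global contact for a
  bounded function, and its Gaussian integral is an exact polynomial. Upper estimates may use
  \<open>K\<close>, which overlooks ruin inside a step; lower estimates concern \<open>P\<close> and
  need an O(e^2) bound for the probability that the path leaves a small ball.

  Regularity does not come from coupling strategies: the supersolution inequality is available
  before continuity, and with linear growth at 0 it yields the Lipschitz bound.

  In the comparison neither function is smooth enough to test the other. The two solutions of the
  linear equation stand between them and take the place of a doubling of variables.\<close>

lemma isCont_ball: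
  fixes f :: "real \<Rightarrow> real"
  assumes "isCont f x" "0 < e"
  obtains r where "r > 0" "\<And>y. \<bar>y - x\<bar> < r \<Longrightarrow> \<bar>f y - f x\<bar> < e"
  using assms unfolding continuous_at_eps_delta dist_real_def by (metis)

lemma Lop_eq:
  assumes "\<And>y. (f has_real_derivative f' y) (at y)" and "(f' has_real_derivative f2) (at x)"
  shows "Lop \<mu> \<sigma> q c f x = \<sigma>\<^sup>2 / 2 * f2 + (\<mu> - c) * f' x - q * f x + c"
proof -
  have "deriv f = f'" using assms(1) by (auto simp: fun_eq_iff intro: DERIV_imp_deriv)
  then show ?thesis using DERIV_imp_deriv[OF assms(2)] by (simp add: Lop_def)
qed

text \<open>The viscosity definitions ask for contact on the whole half line, while contact is
  usually known only near \<open>x\<close>. A fourth-order term leaves the first two derivatives at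
  \<open>x\<close> alone and can be made as large as needed away from it.\<close>

lemma quartic_test:
  fixes x a p A k :: real
  defines "f \<equiv> \<lambda>y. a + p * (y - x) + A / 2 * (y - x)\<^sup>2 + k * (y - x)^4"
  shows "C2 f" and "Lop \<mu> \<sigma> q c f x = \<sigma>\<^sup>2 / 2 * A + (\<mu> - c) * p - q * a + c"
proof -
  define f' where "f' y = p + A * (y - x) + 4 * k * (y - x)^3" for y
  define f2 where "f2 y = A + 12 * k * (y - x)\<^sup>2" for y
  have 1: "(f has_real_derivative f' y) (at y)" for y
    unfolding f_def f'_def by (auto intro!: derivative_eq_intros simp: field_simps)
  have 2: "(f' has_real_derivative f2 y) (at y)" for y
    unfolding f'_def f2_def by (auto intro!: derivative_eq_intros simp: algebra_simps)
  have "continuous_on UNIV f2" unfolding f2_def by (intro continuous_intros)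
  then show "C2 f" unfolding C2_def using 1 2 by blast
  show "Lop \<mu> \<sigma> q c f x = \<sigma>\<^sup>2 / 2 * A + (\<mu> - c) * p - q * a + c"
    using Lop_eq[OF 1 2] by (simp add: f'_def f2_def f_def)
qed

text \<open>Since |d| \<ge> r, multiplying a term of degree j by (|d|/r)^(4-j) only enlarges it and
  turns it into a multiple of d^4.\<close>

lemma quartic_dominates:
  fixes r d a p A B :: real
  assumes "0 < r" "r \<le> \<bar>d\<bar>" "0 \<le> B"
  shows "B + \<bar>a\<bar> + \<bar>p * d\<bar> + \<bar>A / 2 * d\<^sup>2\<bar> \<le> ((B + \<bar>a\<bar>) / r^4 + \<bar>p\<bar> / r^3 + \<bar>A\<bar> / (2 * r\<^sup>2)) * d^4"
proof -
  have e: "d^4 = \<bar>d\<bar>^4" by simp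
  have "r^4 \<le> \<bar>d\<bar>^4" "r^3 \<le> \<bar>d\<bar>^3" "r\<^sup>2 \<le> \<bar>d\<bar>\<^sup>2" using assms by (simp_all only: power_mono less_imp_le)
  then have 1: "1 \<le> \<bar>d\<bar>^4 / r^4" "1 \<le> \<bar>d\<bar>^3 / r^3" "1 \<le> \<bar>d\<bar>\<^sup>2 / r\<^sup>2" using assms by auto
  have "(B + \<bar>a\<bar>) * 1 \<le> (B + \<bar>a\<bar>) * (\<bar>d\<bar>^4 / r^4)" using 1 assms by (intro mult_left_mono) auto
  moreover have "\<bar>p\<bar> * \<bar>d\<bar> * 1 \<le> \<bar>p\<bar> * \<bar>d\<bar> * (\<bar>d\<bar>^3 / r^3)" using 1 by (intro mult_left_mono) auto
  moreover have "\<bar>A\<bar> / 2 * \<bar>d\<bar>\<^sup>2 * 1 \<le> \<bar>A\<bar> / 2 * \<bar>d\<bar>\<^sup>2 * (\<bar>d\<bar>\<^sup>2 / r\<^sup>2)" using 1 by (intro mult_left_mono) auto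
  moreover have "\<bar>p\<bar> * \<bar>d\<bar> * (\<bar>d\<bar>^3 / r^3) = \<bar>p\<bar> / r^3 * d^4" unfolding e
    by (simp add: power4_eq_xxxx power3_eq_cube)
  moreover have "\<bar>A\<bar> / 2 * \<bar>d\<bar>\<^sup>2 * (\<bar>d\<bar>\<^sup>2 / r\<^sup>2) = \<bar>A\<bar> / (2 * r\<^sup>2) * d^4" unfolding e
    by (simp add: power4_eq_xxxx power2_eq_square)
  moreover have "\<bar>p * d\<bar> = \<bar>p\<bar> * \<bar>d\<bar>" "\<bar>A / 2 * d\<^sup>2\<bar> = \<bar>A\<bar> / 2 * \<bar>d\<bar>\<^sup>2" by (simp_all add: abs_mult)
  moreover have "(B + \<bar>a\<bar>) * (\<bar>d\<bar>^4 / r^4) = (B + \<bar>a\<bar>) / r^4 * d^4" unfolding e by simp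
  ultimately show ?thesis unfolding distrib_right by linarith
qed

text \<open>A global bound on \<open>u\<close> lets any parabola that touches locally from above
  serve as a test: \<open>quartic_dominates\<close> supplies the correction outside the radius
  \<open>r\<close>.\<close>

lemma visc_sub_jet:
  assumes sub: "visc_sub \<mu> \<sigma> q c g u x" and B: "\<And>y. 0 \<le> y \<Longrightarrow> \<bar>u y\<bar> \<le> B" and "0 < r"
    and jet: "\<And>y. 0 \<le> y \<Longrightarrow> \<bar>y - x\<bar> < r \<Longrightarrow> u y \<le> u x + p * (y - x) + A / 2 * (y - x)\<^sup>2"
  shows "0 \<le> max (\<sigma>\<^sup>2 / 2 * A + (\<mu> - c) * p - q * u x + c) (g x - u x)"
proof -
  define k where "k = (B + \<bar>u x\<bar>) / r^4 + \<bar>p\<bar> / r^3 + \<bar>A\<bar> / (2 * r\<^sup>2)"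
  have B0: "0 \<le> B" using B[of 0] by auto
  have k0: "0 \<le> k" unfolding k_def using B0 \<open>0 < r\<close> by auto
  define f where "f = (\<lambda>y. u x + p * (y - x) + A / 2 * (y - x)\<^sup>2 + k * (y - x)^4)"
  have le: "u y \<le> f y" if "0 \<le> y" for y
  proof (cases "\<bar>y - x\<bar> < r")
    case True
    then show ?thesis using jet[OF that True] k0 by (simp add: f_def add_increasing2)
  next
    case False
    then have "B + \<bar>u x\<bar> + \<bar>p * (y - x)\<bar> + \<bar>A / 2 * (y - x)\<^sup>2\<bar> \<le> k * (y - x)^4"
      unfolding k_def by (intro quartic_dominates) (use \<open>0 < r\<close> B0 in auto)
    then show ?thesis using B[OF that] unfolding f_def by linarith
  qed
  have fx: "f x = u x" by (simp add: f_def)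
  have "max (Lop \<mu> \<sigma> q c f x) (g x - f x) \<ge> 0"
    using sub quartic_test(1)[of "u x" p x A k] le unfolding visc_sub_def f_def[symmetric]
    by (auto simp: fx)
  then show ?thesis unfolding f_def quartic_test(2) by simp
qed

lemma visc_super_jet:
  assumes super: "visc_super \<mu> \<sigma> q c g u x" and B: "\<And>y. 0 \<le> y \<Longrightarrow> \<bar>u y\<bar> \<le> B" and "0 < r"
    and jet: "\<And>y. 0 \<le> y \<Longrightarrow> \<bar>y - x\<bar> < r \<Longrightarrow> u y \<ge> u x + p * (y - x) + A / 2 * (y - x)\<^sup>2"
  shows "max (\<sigma>\<^sup>2 / 2 * A + (\<mu> - c) * p - q * u x + c) (g x - u x) \<le> 0"
proof -
  define k where "k = (B + \<bar>u x\<bar>) / r^4 + \<bar>p\<bar> / r^3 + \<bar>A\<bar> / (2 * r\<^sup>2)"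
  have B0: "0 \<le> B" using B[of 0] by auto
  have k0: "0 \<le> k" unfolding k_def using B0 \<open>0 < r\<close> by auto
  define f where "f = (\<lambda>y. u x + p * (y - x) + A / 2 * (y - x)\<^sup>2 + (- k) * (y - x)^4)"
  have le: "f y \<le> u y" if "0 \<le> y" for y
  proof (cases "\<bar>y - x\<bar> < r")
    case True
    have "0 \<le> k * (y - x)^4" using k0 by simp
    then show ?thesis using jet[OF that True] by (simp add: f_def)
  next
    case False
    then have "B + \<bar>u x\<bar> + \<bar>p * (y - x)\<bar> + \<bar>A / 2 * (y - x)\<^sup>2\<bar> \<le> k * (y - x)^4"
      unfolding k_def by (intro quartic_dominates) (use \<open>0 < r\<close> B0 in auto)
    then show ?thesis using B[OF that] unfolding f_def by (simp add: abs_le_iff) linarith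
  qed
  have fx: "f x = u x" by (simp add: f_def)
  have "max (Lop \<mu> \<sigma> q c f x) (g x - f x) \<le> 0"
    using super quartic_test(1)[of "u x" p x A "- k"] le unfolding visc_super_def f_def[symmetric]
    by (auto simp: fx)
  then show ?thesis unfolding f_def quartic_test(2) by simp
qed

section \<open>Comparison with the linear boundary value problem\<close>

lemma taylor2:
  fixes h h' h2 :: "real \<Rightarrow> real"
  assumes 1: "\<And>y. (h has_real_derivative h' y) (at y)" and 2: "\<And>y. (h' has_real_derivative h2 y) (at y)"
    and c: "isCont h2 z" and e: "0 < e"
  shows "\<exists>r>0. \<forall>y. \<bar>y - z\<bar> < r \<longrightarrow> \<bar>h y - (h z + h' z * (y - z) + h2 z / 2 * (y - z)\<^sup>2)\<bar> \<le> e / 2 * (y - z)\<^sup>2"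
proof -
  obtain r where r: "r > 0" "\<And>y. \<bar>y - z\<bar> < r \<Longrightarrow> \<bar>h2 y - h2 z\<bar> < e"
    using isCont_ball[OF c e] by blast
  show ?thesis
  proof (intro exI conjI allI impI, rule r(1))
    fix y assume y: "\<bar>y - z\<bar> < r"
    show "\<bar>h y - (h z + h' z * (y - z) + h2 z / 2 * (y - z)\<^sup>2)\<bar> \<le> e / 2 * (y - z)\<^sup>2"
    proof (cases "y = z")
      case False
      define df where "df = (\<lambda>m::nat. if m = 0 then h else if m = 1 then h' else h2)"
      have "\<exists>t. (if y < z then y < t \<and> t < z else z < t \<and> t < y) \<and>
         h y = (\<Sum>m<2. df m z / fact m * (y - z) ^ m) + df 2 t / fact 2 * (y - z)^2"
        by (rule Taylor[where a = "min y z" and b = "max y z"])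
          (use False 1 2 in \<open>auto simp: df_def less_Suc_eq numeral_2_eq_2\<close>)
      then obtain t where t': "if y < z then y < t \<and> t < z else z < t \<and> t < y" 
        and eq': "h y = (\<Sum>m<2. df m z / fact m * (y - z) ^ m) + df 2 t / fact 2 * (y - z)^2" by blast
      have t: "\<bar>t - z\<bar> < r" using t' y by (auto split: if_splits)
      have eq: "h y = h z + h' z * (y - z) + h2 t / 2 * (y - z)^2"
        using eq' by (simp add: df_def numeral_2_eq_2)
      have "\<bar>h y - (h z + h' z * (y - z) + h2 z / 2 * (y - z)\<^sup>2)\<bar> = \<bar>h2 t - h2 z\<bar> / 2 * (y - z)\<^sup>2"
      proof -
        have eq2: "h y - (h z + h' z * (y - z) + h2 z / 2 * (y - z)\<^sup>2) = (h2 t - h2 z) / 2 * (y - z)\<^sup>2"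
          unfolding eq by (simp add: field_simps)
        show ?thesis unfolding eq2 by (simp add: abs_mult)
      qed
      also have "\<dots> \<le> e / 2 * (y - z)\<^sup>2" using r(2)[OF t] by (intro mult_right_mono) auto
      finally show ?thesis .
    qed (use e in simp)
  qed
qed

text \<open>The characteristic roots are real and distinct because q > 0. Centring the exponentials
  at \<open>a\<close> makes the condition there read C + D = \<alpha> - c/q; the condition at
  \<open>b\<close> is then solvable because the two exponentials differ at \<open>b\<close>.\<close>

lemma ode_bvp:
  fixes \<sigma> q m c a b \<alpha> \<beta> :: real
  assumes "\<sigma> > 0" "q > 0" "a < b"
  shows "\<exists>h h' h2. (\<forall>y. (h has_real_derivative h' y) (at y)) \<and> (\<forall>y. (h' has_real_derivative h2 y) (at y))
     \<and> (\<forall>y. isCont h2 y) \<and> (\<forall>y. \<sigma>\<^sup>2 / 2 * h2 y + m * h' y - q * h y + c = 0) \<and> h a = \<alpha> \<and> h b = \<beta>"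
proof -
  define s where "s = sqrt (m\<^sup>2 + 2 * \<sigma>\<^sup>2 * q)"
  have s2: "s\<^sup>2 = m\<^sup>2 + 2 * \<sigma>\<^sup>2 * q" unfolding s_def using assms by (intro real_sqrt_pow2) auto
  have s0: "s > 0" unfolding s_def using assms by (intro real_sqrt_gt_zero add_nonneg_pos) auto
  define l1 where "l1 = (- m - s) / \<sigma>\<^sup>2"
  define l2 where "l2 = (- m + s) / \<sigma>\<^sup>2"
  have r1: "\<sigma>\<^sup>2 / 2 * l1\<^sup>2 + m * l1 - q = 0" and r2: "\<sigma>\<^sup>2 / 2 * l2\<^sup>2 + m * l2 - q = 0"
  proof -
    have "(\<sigma>\<^sup>2 / 2 * l\<^sup>2 + m * l - q) = 0" if "\<sigma>\<^sup>2 * l = - m + t" "t\<^sup>2 = s\<^sup>2" for l t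
    proof -
      have "2 * \<sigma>\<^sup>2 * (\<sigma>\<^sup>2 / 2 * l\<^sup>2 + m * l - q) = (\<sigma>\<^sup>2 * l)\<^sup>2 + 2 * m * (\<sigma>\<^sup>2 * l) - 2 * \<sigma>\<^sup>2 * q"
        by (simp add: power2_eq_square algebra_simps)
      also have "\<dots> = 0" unfolding that(1) using that(2) s2 by (simp add: power2_eq_square algebra_simps)
      finally show ?thesis using assms by simp
    qed
    from this[of l1 "-s"] this[of l2 s] show "\<sigma>\<^sup>2 / 2 * l1\<^sup>2 + m * l1 - q = 0" "\<sigma>\<^sup>2 / 2 * l2\<^sup>2 + m * l2 - q = 0"
      using assms unfolding l1_def l2_def by auto
  qed
  have "l1 < l2" unfolding l1_def l2_def using s0 assms by (simp add: divide_strict_right_mono)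
  define e1 where "e1 = exp (l1 * (b - a))"
  define e2 where "e2 = exp (l2 * (b - a))"
  have ne: "e2 - e1 \<noteq> 0" unfolding e1_def e2_def using \<open>l1 < l2\<close> assms by simp
  define D where "D = ((\<beta> - c / q) - (\<alpha> - c / q) * e1) / (e2 - e1)"
  define C where "C = (\<alpha> - c / q) - D"
  define h where "h y = c / q + C * exp (l1 * (y - a)) + D * exp (l2 * (y - a))" for y
  define h' where "h' y = C * l1 * exp (l1 * (y - a)) + D * l2 * exp (l2 * (y - a))" for y
  define h2 where "h2 y = C * l1\<^sup>2 * exp (l1 * (y - a)) + D * l2\<^sup>2 * exp (l2 * (y - a))" for y
  have 1: "(h has_real_derivative h' y) (at y)" for y
    unfolding h_def h'_def by (auto intro!: derivative_eq_intros simp: algebra_simps)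
  have 2: "(h' has_real_derivative h2 y) (at y)" for y
    unfolding h2_def h'_def by (auto intro!: derivative_eq_intros simp: algebra_simps power2_eq_square)
  have 3: "isCont h2 y" for y unfolding h2_def by (intro continuous_intros)
  have 4: "\<sigma>\<^sup>2 / 2 * h2 y + m * h' y - q * h y + c = 0" for y
  proof -
    have "\<sigma>\<^sup>2 / 2 * h2 y + m * h' y - q * h y + c = C * exp (l1 * (y - a)) * (\<sigma>\<^sup>2 / 2 * l1\<^sup>2 + m * l1 - q)
      + D * exp (l2 * (y - a)) * (\<sigma>\<^sup>2 / 2 * l2\<^sup>2 + m * l2 - q)"
      unfolding h_def h'_def h2_def using assms by (simp add: algebra_simps)
    then show ?thesis using r1 r2 by simp
  qed
  have 5: "h a = \<alpha>" by (simp add: h_def C_def)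
  have "h b = c / q + (\<alpha> - c / q) * e1 + D * (e2 - e1)"
    unfolding h_def C_def e1_def e2_def by (simp add: algebra_simps)
  also have "\<dots> = \<beta>" unfolding D_def using ne by simp
  finally have 6: "h b = \<beta>" .
  show ?thesis using 1 2 3 4 5 6 by blast
qed

text \<open>At an interior maximum of u - h of height k > 0 the 2-jet of \<open>h\<close>, with
  slightly larger curvature, touches \<open>u\<close> from above. Subtracting the equation solved by
  \<open>h\<close> leaves the curvature error minus q*k, which would have to be nonnegative; the
  obstacle cannot help because \<open>u\<close> lies strictly above it.\<close>

lemma visc_sub_le_ode:
  assumes sig: "\<sigma> > 0" "q > 0" and a: "0 \<le> a" "a < b" and cont: "continuous_on {a..b} u"
    and sub: "\<And>x. a < x \<Longrightarrow> x < b \<Longrightarrow> visc_sub \<mu> \<sigma> q c g u x \<and> g x < u x"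
    and B: "\<And>y. 0 \<le> y \<Longrightarrow> \<bar>u y\<bar> \<le> B"
    and 1: "\<And>y. (h has_real_derivative h' y) (at y)" and 2: "\<And>y. (h' has_real_derivative h2 y) (at y)"
    and 3: "\<And>y. isCont h2 y" and ode: "\<And>y. \<sigma>\<^sup>2 / 2 * h2 y + (\<mu> - c) * h' y - q * h y + c = 0"
    and bd: "h a = u a" "h b = u b" and y: "y \<in> {a..b}"
  shows "u y \<le> h y"
proof (rule ccontr)
  assume "\<not> u y \<le> h y"
  have ch: "continuous_on {a..b} h" using 1 by (meson DERIV_continuous_on has_field_derivative_at_within)
  obtain z where z: "z \<in> {a..b}" "\<And>w. w \<in> {a..b} \<Longrightarrow> u w - h w \<le> u z - h z"
    using continuous_attains_sup[of "{a..b}" "\<lambda>w. u w - h w", OF _ _ continuous_on_diff[OF cont ch]] a by force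
  define k where "k = u z - h z"
  have k: "k > 0" using z(2)[OF y] \<open>\<not> u y \<le> h y\<close> by (simp add: k_def)
  have zab: "a < z" "z < b" using k z(1) bd unfolding k_def by (auto simp: less_le)
  \<comment> \<open>With this value the curvature error \<sigma>^2/2 * e uses up exactly half of
    q*k.\<close>
  define e where "e = q * k / \<sigma>\<^sup>2"
  have e: "e > 0" using sig k by (simp add: e_def)
  obtain r where r: "r > 0" "\<And>w. \<bar>w - z\<bar> < r \<Longrightarrow> \<bar>h w - (h z + h' z * (w - z) + h2 z / 2 * (w - z)\<^sup>2)\<bar> \<le> e / 2 * (w - z)\<^sup>2"
    using taylor2[OF 1 2 3 e, of z] by blast
  define r' where "r' = min r (min (z - a) (b - z))"
  have "0 \<le> max (\<sigma>\<^sup>2 / 2 * (h2 z + e) + (\<mu> - c) * h' z - q * u z + c) (g z - u z)"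
  proof (rule visc_sub_jet[OF _ B, where r = r'])
    show "visc_sub \<mu> \<sigma> q c g u z" using sub zab by blast
    show "0 < r'" using r zab by (simp add: r'_def)
    fix w assume "0 \<le> w" and w: "\<bar>w - z\<bar> < r'"
    then have "w \<in> {a..b}" and wr: "\<bar>w - z\<bar> < r" by (auto simp: r'_def)
    then have "u w \<le> h w + k" using z(2)[of w] by (simp add: k_def)
    then show "u w \<le> u z + h' z * (w - z) + (h2 z + e) / 2 * (w - z)\<^sup>2"
    proof -
      have "(h2 z + e) / 2 * (w - z)\<^sup>2 = h2 z / 2 * (w - z)\<^sup>2 + e / 2 * (w - z)\<^sup>2"
        by (simp add: field_simps)
      then show ?thesis using r(2)[OF wr] \<open>u w \<le> h w + k\<close> unfolding k_def abs_le_iff by linarith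
    qed
  qed
  moreover have "g z - u z < 0" using sub zab by force
  ultimately have "0 \<le> \<sigma>\<^sup>2 / 2 * (h2 z + e) + (\<mu> - c) * h' z - q * u z + c" by auto
  also have "\<dots> = \<sigma>\<^sup>2 / 2 * e - q * k" using ode[of z] by (simp add: k_def algebra_simps add_divide_distrib diff_divide_distrib)
  also have "\<dots> = - (q * k / 2)" using sig by (simp add: e_def)
  finally show False using sig k by (simp add: mult_pos_pos) (metis less_numeral_extra(3) mult_pos_pos not_less)
qed

text \<open>Mirror image of \<open>visc_sub_le_ode\<close>. For a supersolution both terms of the
  maximum are nonpositive, so the operator term can be used wherever \<open>u\<close> lies.\<close>

lemma visc_super_ge_ode:
  assumes sig: "\<sigma> > 0" "q > 0" and a: "0 \<le> a" "a < b" and cont: "continuous_on {a..b} u"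
    and super: "\<And>x. a < x \<Longrightarrow> x < b \<Longrightarrow> visc_super \<mu> \<sigma> q c g u x"
    and B: "\<And>y. 0 \<le> y \<Longrightarrow> \<bar>u y\<bar> \<le> B"
    and 1: "\<And>y. (h has_real_derivative h' y) (at y)" and 2: "\<And>y. (h' has_real_derivative h2 y) (at y)"
    and 3: "\<And>y. isCont h2 y" and ode: "\<And>y. \<sigma>\<^sup>2 / 2 * h2 y + (\<mu> - c) * h' y - q * h y + c = 0"
    and bd: "h a = u a" "h b = u b" and y: "y \<in> {a..b}"
  shows "h y \<le> u y"
proof (rule ccontr)
  assume "\<not> h y \<le> u y"
  have ch: "continuous_on {a..b} h" using 1 by (meson DERIV_continuous_on has_field_derivative_at_within)
  obtain z where z: "z \<in> {a..b}" "\<And>w. w \<in> {a..b} \<Longrightarrow> h w - u w \<le> h z - u z"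
    using continuous_attains_sup[of "{a..b}" "\<lambda>w. h w - u w", OF _ _ continuous_on_diff[OF ch cont]] a by force
  define k where "k = h z - u z"
  have k: "k > 0" using z(2)[OF y] \<open>\<not> h y \<le> u y\<close> by (simp add: k_def)
  have zab: "a < z" "z < b" using k z(1) bd unfolding k_def by (auto simp: less_le)
  define e where "e = q * k / \<sigma>\<^sup>2"
  have e: "e > 0" using sig k by (simp add: e_def)
  obtain r where r: "r > 0" "\<And>w. \<bar>w - z\<bar> < r \<Longrightarrow> \<bar>h w - (h z + h' z * (w - z) + h2 z / 2 * (w - z)\<^sup>2)\<bar> \<le> e / 2 * (w - z)\<^sup>2"
    using taylor2[OF 1 2 3 e, of z] by blast
  define r' where "r' = min r (min (z - a) (b - z))"
  have "max (\<sigma>\<^sup>2 / 2 * (h2 z - e) + (\<mu> - c) * h' z - q * u z + c) (g z - u z) \<le> 0"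
  proof (rule visc_super_jet[OF _ B, where r = r'])
    show "visc_super \<mu> \<sigma> q c g u z" using super zab by blast
    show "0 < r'" using r zab by (simp add: r'_def)
    fix w assume "0 \<le> w" and w: "\<bar>w - z\<bar> < r'"
    then have "w \<in> {a..b}" and wr: "\<bar>w - z\<bar> < r" by (auto simp: r'_def)
    then have "h w - k \<le> u w" using z(2)[of w] by (simp add: k_def)
    then show "u w \<ge> u z + h' z * (w - z) + (h2 z - e) / 2 * (w - z)\<^sup>2"
    proof -
      have "(h2 z - e) / 2 * (w - z)\<^sup>2 = h2 z / 2 * (w - z)\<^sup>2 - e / 2 * (w - z)\<^sup>2"
        by (simp add: field_simps)
      then show ?thesis using r(2)[OF wr] \<open>h w - k \<le> u w\<close> unfolding k_def abs_le_iff by linarith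
    qed
  qed
  then have "0 \<ge> \<sigma>\<^sup>2 / 2 * (h2 z - e) + (\<mu> - c) * h' z - q * u z + c" by auto
  also have "\<sigma>\<^sup>2 / 2 * (h2 z - e) + (\<mu> - c) * h' z - q * u z + c = q * k - \<sigma>\<^sup>2 / 2 * e"
    using ode[of z] by (simp add: k_def algebra_simps add_divide_distrib diff_divide_distrib)
  also have "\<dots> = q * k / 2" using sig by (simp add: e_def)
  finally show False using sig k by (simp add: mult_le_0_iff)
qed

text \<open>At \<open>x\<close> itself there may be no test function touching from below, and then
  the definition says nothing there. Penalising with a steep parabola gives a contact point
  \<open>z\<close> close to \<open>x\<close> where it does apply, and continuity of g - u brings the
  contradiction to \<open>z\<close>.\<close>

lemma visc_super_ge_obstacle:
  assumes super: "\<And>x. 0 < x \<Longrightarrow> visc_super \<mu> \<sigma> q c g u x"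
    and B: "\<And>y. 0 \<le> y \<Longrightarrow> \<bar>u y\<bar> \<le> B"
    and cu: "continuous_on {0..} u" and cg: "continuous_on {0..} g" and x: "0 < x"
  shows "g x \<le> u x"
proof (rule ccontr)
  assume n: "\<not> g x \<le> u x"
  have "isCont (\<lambda>y. g y - u y) x"
    using x cu cg by (intro continuous_on_interior[of "{0..}"]) (auto intro!: continuous_intros)
  then obtain r0 where r0: "r0 > 0" "\<And>y. \<bar>y - x\<bar> < r0 \<Longrightarrow> \<bar>(g y - u y) - (g x - u x)\<bar> < g x - u x"
    by (rule isCont_ball[where e = "g x - u x"]) (use n in auto)
  define r where "r = min r0 x / 2"
  have r: "0 < r" "r < r0" "r < x" using r0 x by (auto simp: r_def)
  have B0: "0 \<le> B" using B[of 0] by auto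
  \<comment> \<open>The penalty at distance \<open>r\<close> exceeds the oscillation 2*B of
    \<open>u\<close>, which keeps the minimiser in the interior.\<close>
  define k where "k = (2 * B + 1) / r\<^sup>2"
  have k: "k * r\<^sup>2 = 2 * B + 1" "k > 0" using r B0 by (auto simp: k_def)
  obtain z where z: "z \<in> {x-r..x+r}" "\<And>w. w \<in> {x-r..x+r} \<Longrightarrow> u z + k * (z - x)\<^sup>2 \<le> u w + k * (w - x)\<^sup>2"
  proof -
    have "continuous_on {x-r..x+r} (\<lambda>w. u w + k * (w - x)\<^sup>2)"
      using r by (intro continuous_intros continuous_on_subset[OF cu]) auto
    from continuous_attains_inf[OF _ _ this] that r show ?thesis by force
  qed
  have "k * (z - x)\<^sup>2 < k * r\<^sup>2"
    using z(2)[of x] r B[of x] B[of z] z(1) x k by (simp add: abs_le_iff)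
  then have "(z - x)\<^sup>2 < r\<^sup>2" using k(2) mult_less_cancel_left_pos by blast
  then have zr: "\<bar>z - x\<bar> < r" using r by (metis abs_of_pos power2_less_imp_less power2_abs less_imp_le)
  have "max (\<sigma>\<^sup>2 / 2 * (- 2 * k) + (\<mu> - c) * (- 2 * k * (z - x)) - q * u z + c) (g z - u z) \<le> 0"
  proof (rule visc_super_jet[OF _ B, where r = "r - \<bar>z - x\<bar>"])
    show "visc_super \<mu> \<sigma> q c g u z" using zr r by (intro super) auto
    show "0 < r - \<bar>z - x\<bar>" using zr by simp
    fix w assume "0 \<le> w" "\<bar>w - z\<bar> < r - \<bar>z - x\<bar>"
    then have "w \<in> {x-r..x+r}" by auto
    from z(2)[OF this] show "u z + - 2 * k * (z - x) * (w - z) + - 2 * k / 2 * (w - z)\<^sup>2 \<le> u w"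
      by (simp add: algebra_simps power2_eq_square)
  qed
  then show False using r0(2)[of z] zr r by auto
qed

section \<open>The maximum principle, comparison and uniqueness\<close>

lemma ode_max_principle:
  fixes w w' w2 :: "real \<Rightarrow> real"
  assumes sig: "\<sigma> > 0" "q > 0" and x: "a < x" "x < b"
    and 1: "\<And>y. (w has_real_derivative w' y) (at y)" and 2: "\<And>y. (w' has_real_derivative w2 y) (at y)"
    and 3: "\<And>y. isCont w2 y" and ode: "\<And>y. \<sigma>\<^sup>2 / 2 * w2 y + m * w' y - q * w y = 0"
    and bd: "w a \<le> k" "w b \<le> k" and k: "0 < k"
  shows "w x < k"
proof (rule ccontr)
  assume n: "\<not> w x < k"
  have cw: "continuous_on {a..b} w" using 1 by (meson DERIV_continuous_on has_field_derivative_at_within)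
  obtain z0 where z0: "z0 \<in> {a..b}" "\<And>y. y \<in> {a..b} \<Longrightarrow> w y \<le> w z0"
    using continuous_attains_sup[of "{a..b}" w] x cw by auto
  \<comment> \<open>If the maximum sits at an end point, its value is at most \<open>k\<close> and
    hence at most \<open>w x\<close>, so \<open>x\<close> itself is an interior maximiser.\<close>
  define z where "z = (if z0 = a \<or> z0 = b then x else z0)"
  have z: "a < z" "z < b" "w z \<ge> k" "\<And>y. y \<in> {a..b} \<Longrightarrow> w y \<le> w z"
  proof -
    have zx: "w x \<le> w z0" using z0(2)[of x] x by simp
    show "a < z" "z < b" using z0(1) x unfolding z_def by auto
    show "w z \<ge> k" using zx n unfolding z_def by auto
    show "w y \<le> w z" if "y \<in> {a..b}" for y
      using z0(2)[OF that] zx n bd unfolding z_def by auto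
  qed
  define d where "d = min (z - a) (b - z)"
  have d: "d > 0" using z by (simp add: d_def)
  have dz: "w y \<le> w z" if "\<bar>z - y\<bar> < d" for y using that by (intro z(4)) (auto simp: d_def)
  have w'z: "w' z = 0" by (rule DERIV_local_max[OF 1 d]) (use dz in auto)
  have w2z: "w2 z > 0"
  proof -
    have "\<sigma>\<^sup>2 / 2 * w2 z = q * w z" using ode[of z] w'z by simp
    moreover have "q * w z > 0" using sig z(3) k by simp
    ultimately show ?thesis using sig by (metis half_gt_zero mult_less_0_iff not_less_iff_gr_or_eq zero_less_mult_pos zero_less_power)
  qed
  obtain r where r: "r > 0" "\<And>y. \<bar>y - z\<bar> < r \<Longrightarrow> \<bar>w y - (w z + w' z * (y - z) + w2 z / 2 * (y - z)\<^sup>2)\<bar> \<le> w2 z / 2 / 2 * (y - z)\<^sup>2"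
    using taylor2[OF 1 2 3, of "w2 z / 2" z] w2z by auto
  define y where "y = z + min r d / 2"
  have y: "\<bar>y - z\<bar> < r" "\<bar>z - y\<bar> < d" "y \<noteq> z" using r d by (auto simp: y_def)
  have "w2 z / 2 / 2 * (y - z)\<^sup>2 > 0" using w2z y by simp
  then show False using r(2)[OF y(1)] dz[OF y(2)] w'z by (simp add: abs_le_iff)
qed

text \<open>The difference \<open>f\<close> vanishes at infinity and is nonpositive at 0, so a
  positive value forces an interior maximum. The interval around it is short enough for
  \<open>f\<close> to stay positive, so that u > v \<ge> g there, as \<open>visc_sub_le_ode\<close>
  demands. The boundary values of h - k are at most \<open>f x0\<close>, and the strict bound inside
  contradicts h - k \<ge> f at \<open>x0\<close>.\<close>

lemma visc_comparison:
  assumes sig: "\<sigma> > 0" "q > 0"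
    and sub: "\<And>x. 0 < x \<Longrightarrow> visc_sub \<mu> \<sigma> q c g u x" and super: "\<And>x. 0 < x \<Longrightarrow> visc_super \<mu> \<sigma> q c g v x"
    and Bu: "\<And>y. 0 \<le> y \<Longrightarrow> \<bar>u y\<bar> \<le> B" and Bv: "\<And>y. 0 \<le> y \<Longrightarrow> \<bar>v y\<bar> \<le> B"
    and cu: "continuous_on {0..} u" and cv: "continuous_on {0..} v" and cg: "continuous_on {0..} g"
    and 0: "u 0 \<le> v 0" and lim: "((\<lambda>x. u x - v x) \<longlongrightarrow> 0) at_top" and x: "0 \<le> x"
  shows "u x \<le> v x"
proof (rule ccontr)
  assume n: "\<not> u x \<le> v x"
  define f where "f y = u y - v y" for y
  have fx: "f x > 0" using n by (simp add: f_def)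
  have cf: "continuous_on {0..} f" unfolding f_def using cu cv by (intro continuous_intros)
  have "eventually (\<lambda>y. f y < f x) at_top" using lim fx unfolding f_def by (rule order_tendstoD)
  then obtain R where R: "\<And>y. y \<ge> R \<Longrightarrow> f y < f x" by (auto simp: eventually_at_top_linorder)
  define R' where "R' = max R x"
  obtain x0 where x0: "x0 \<in> {0..R'}" "\<And>y. y \<in> {0..R'} \<Longrightarrow> f y \<le> f x0"
    using continuous_attains_sup[of "{0..R'}" f, OF _ _ continuous_on_subset[OF cf]] x by (force simp: R'_def)
  have fx0: "f x0 \<ge> f x" using x0(2)[of x] x by (simp add: R'_def)
  have max: "f y \<le> f x0" if "0 \<le> y" for y
    using that x0(2)[of y] R[of y] fx0 unfolding R'_def by (cases "y \<le> max R x") force+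
  have x0p: "0 < x0" using x0(1) fx0 fx 0 by (cases "x0 = 0") (auto simp: f_def)
  have "isCont f x0" using x0p cf by (intro continuous_on_interior[of "{0..}"]) auto
  then obtain r0 where r0: "r0 > 0" "\<And>y. \<bar>y - x0\<bar> < r0 \<Longrightarrow> \<bar>f y - f x0\<bar> < f x0"
    by (rule isCont_ball[where e = "f x0"]) (use fx0 fx in auto)
  define r where "r = min r0 x0 / 2"
  have r: "0 < r" "r < r0" "r < x0" using r0 x0p by (auto simp: r_def)
  let ?a = "x0 - r" and ?b = "x0 + r"
  have ab: "0 \<le> ?a" "?a < ?b" using r by auto
  have gu: "g y < u y" if "?a < y" "y < ?b" for y
  proof -
    have "f y > 0" using r0(2)[of y] that r by (auto simp: abs_less_iff)
    moreover have "g y \<le> v y" using that r by (intro visc_super_ge_obstacle[OF super Bv cv cg]) auto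
    ultimately show ?thesis by (simp add: f_def)
  qed
  have sub': "continuous_on {?a..?b} u" "continuous_on {?a..?b} v"
    using r by (auto intro: continuous_on_subset[OF cu] continuous_on_subset[OF cv])
  obtain h h' h2 where h: "\<And>y. (h has_real_derivative h' y) (at y)" "\<And>y. (h' has_real_derivative h2 y) (at y)"
    "\<And>y. isCont h2 y" "\<And>y. \<sigma>\<^sup>2 / 2 * h2 y + (\<mu> - c) * h' y - q * h y + c = 0" "h ?a = u ?a" "h ?b = u ?b"
    using ode_bvp[OF sig ab(2), of "\<mu> - c" c "u ?a" "u ?b"] by blast
  obtain k k' k2 where k: "\<And>y. (k has_real_derivative k' y) (at y)" "\<And>y. (k' has_real_derivative k2 y) (at y)"
    "\<And>y. isCont k2 y" "\<And>y. \<sigma>\<^sup>2 / 2 * k2 y + (\<mu> - c) * k' y - q * k y + c = 0" "k ?a = v ?a" "k ?b = v ?b"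
    using ode_bvp[OF sig ab(2), of "\<mu> - c" c "v ?a" "v ?b"] by blast
  have "u x0 \<le> h x0"
    by (rule visc_sub_le_ode[OF sig ab sub'(1) _ Bu h]) (use sub gu r in auto)
  moreover have "k x0 \<le> v x0"
    by (rule visc_super_ge_ode[where g = g, OF sig ab sub'(2) _ Bv k]) (use super r in auto)
  moreover have "h x0 - k x0 < f x0"
  proof (rule ode_max_principle[where w = "\<lambda>y. h y - k y" and a = ?a and b = ?b and w' = "\<lambda>y. h' y - k' y" and ?w2.0 = "\<lambda>y. h2 y - k2 y", OF sig])
    show "((\<lambda>y. h y - k y) has_real_derivative h' y - k' y) (at y)" for y using h k by (intro derivative_intros)
    show "((\<lambda>y. h' y - k' y) has_real_derivative h2 y - k2 y) (at y)" for y using h k by (intro derivative_intros)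
    show "isCont (\<lambda>y. h2 y - k2 y) y" for y using h k by (intro continuous_intros)
    show "\<sigma>\<^sup>2 / 2 * (h2 y - k2 y) + (\<mu> - c) * (h' y - k' y) - q * (h y - k y) = 0" for y
      using h(4)[of y] k(4)[of y] by (simp add: algebra_simps diff_divide_distrib)
    show "h ?a - k ?a \<le> f x0" "h ?b - k ?b \<le> f x0" using max[of ?a] max[of ?b] r h k by (auto simp: f_def)
  qed (use r fx fx0 in auto)
  ultimately show False by (simp add: f_def)
qed

lemma bounded_of_limit:
  fixes u :: "real \<Rightarrow> real"
  assumes cu: "continuous_on {0..} u" and lim: "(u \<longlongrightarrow> l) at_top"
  shows "\<exists>B. \<forall>y\<ge>0. \<bar>u y\<bar> \<le> B"
proof -
  have "eventually (\<lambda>y. \<bar>u y - l\<bar> < 1) at_top" using tendstoD[OF lim, of 1] by (simp add: dist_real_def)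
  then obtain R where R: "\<And>y. y \<ge> R \<Longrightarrow> \<bar>u y - l\<bar> < 1" by (auto simp: eventually_at_top_linorder)
  have "compact (u ` {0..max R 0})"
    by (intro compact_continuous_image continuous_on_subset[OF cu]) auto
  then obtain B where B: "\<And>y. y \<in> {0..max R 0} \<Longrightarrow> \<bar>u y\<bar> \<le> B"
    using compact_imp_bounded bounded_iff by (metis image_eqI real_norm_def)
  have "\<bar>u y\<bar> \<le> max B (\<bar>l\<bar> + 1)" if "y \<ge> 0" for y
    using that B[of y] R[of y] by (cases "y \<le> R") auto
  then show ?thesis by blast
qed

lemma loc_lipschitz0_continuous: assumes "loc_lipschitz0 u" shows "continuous_on {0..} u"
proof (rule continuous_on_eq_continuous_within[THEN iffD2, rule_format])
  fix x :: real assume x: "x \<in> {0..}"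
  obtain L where "lipschitz_on L {0..x+1} u" using assms x unfolding loc_lipschitz0_def by fastforce
  then have "continuous_on {0..x+1} u" by (rule lipschitz_on_continuous_on)
  then have "continuous (at x within {0..x+1}) u" using x by (simp add: continuous_on_eq_continuous_within)
  moreover have "at x within {0..x+1} = at x within {0..}"
    by (rule at_within_nhd[of _ "{..<x+1}"]) auto
  ultimately show "continuous (at x within {0..}) u" by simp
qed

lemma visc_solution_unique:
  assumes sig: "\<sigma> > 0" "q > 0"
    and u: "visc_solution \<mu> \<sigma> q c g u" and v: "visc_solution \<mu> \<sigma> q c g v"
    and cg: "continuous_on {0..} g" and 0: "u 0 = v 0"
    and lu: "(u \<longlongrightarrow> l) at_top" and lv: "(v \<longlongrightarrow> l) at_top" and x: "0 \<le> x"
  shows "u x = v x"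
proof -
  have "loc_lipschitz0 u" "loc_lipschitz0 v" using u v zero_less_one unfolding visc_solution_def visc_super_def by blast+
  then have cu: "continuous_on {0..} u" and cv: "continuous_on {0..} v" by (auto intro: loc_lipschitz0_continuous)
  obtain B1 where B1: "\<forall>y\<ge>0. \<bar>u y\<bar> \<le> B1" using bounded_of_limit[OF cu lu] by blast
  obtain B2 where B2: "\<forall>y\<ge>0. \<bar>v y\<bar> \<le> B2" using bounded_of_limit[OF cv lv] by blast
  define B where "B = max B1 B2"
  have Bu: "\<bar>u y\<bar> \<le> B" "\<bar>v y\<bar> \<le> B" if "0 \<le> y" for y using B1 B2 that by (auto simp: B_def le_max_iff_disj)
  have lim: "((\<lambda>x. u x - v x) \<longlongrightarrow> 0) at_top" "((\<lambda>x. v x - u x) \<longlongrightarrow> 0) at_top"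
    using tendsto_diff[OF lu lv] tendsto_diff[OF lv lu] by auto
  have s: "visc_sub \<mu> \<sigma> q c g u x" "visc_super \<mu> \<sigma> q c g u x" "visc_sub \<mu> \<sigma> q c g v x" "visc_super \<mu> \<sigma> q c g v x"
    if "0 < x" for x using u v that unfolding visc_solution_def by auto
  show ?thesis
  proof (rule antisym)
    show "u x \<le> v x" by (rule visc_comparison[OF sig s(1) s(4) Bu cu cv cg _ lim(1) x]) (use 0 in auto)
    show "v x \<le> u x" by (rule visc_comparison[OF sig s(3) s(2) Bu(2) Bu(1) cv cu cg _ lim(2) x]) (use 0 in auto)
  qed
qed

section \<open>Independence of the completed filtration and future increments\<close>

locale bm_model =
  fixes M :: "'a measure" and W :: "real \<Rightarrow> 'a \<Rightarrow> real" and \<mu> \<sigma> q x :: real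
  assumes BM: "std_BM M W" and sigma_pos: "\<sigma> > 0" and q_pos: "q > 0"
begin

sublocale prob_space M using BM by (simp add: std_BM_def)

abbreviation X :: "real \<Rightarrow> 'a \<Rightarrow> real" where "X \<equiv> Xproc \<mu> \<sigma> W x"

definition F :: "real \<Rightarrow> 'a measure" where "F t = sigma (space M) (gen_filtration M X t)"

lemma W_measurable: "0 \<le> t \<Longrightarrow> W t \<in> borel_measurable M"
  using BM by (simp add: std_BM_def)

lemma W_cont: "AE \<omega> in M. W 0 \<omega> = 0 \<and> continuous_on {0..} (\<lambda>t. W t \<omega>)"
  using BM by (simp add: std_BM_def)

lemma X_measurable: "0 \<le> t \<Longrightarrow> X t \<in> borel_measurable M"
  using W_measurable unfolding Xproc_def[abs_def] by measurable

lemma gen_subset: "gen_filtration M X t \<subseteq> sets M"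
proof -
  have "{X s -` B \<inter> space M | s B. 0 \<le> s \<and> s \<le> t \<and> B \<in> sets borel} \<union> null_sets M \<subseteq> sets M"
    using X_measurable by (auto intro: measurable_sets)
  then show ?thesis unfolding gen_filtration_def by (rule sets.sigma_sets_subset)
qed

lemma space_F [simp]: "space (F t) = space M"
  unfolding F_def by (rule space_measure_of) (use gen_subset sets.space_closed in blast)

lemma sets_F: "sets (F t) = gen_filtration M X t"
proof -
  have "sets (F t) = sigma_sets (space M) (gen_filtration M X t)"
    unfolding F_def by (rule sets_measure_of) (use gen_subset sets.space_closed in blast)
  also have "\<dots> = gen_filtration M X t"
    unfolding gen_filtration_def
    by (rule sigma_sets_sigma_sets_eq) (use X_measurable sets.sets_into_space in \<open>auto\<close>)
  finally show ?thesis .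
qed

lemma subalgebra_F: "subalgebra M (F t)"
  unfolding subalgebra_def using gen_subset by (simp add: sets_F)

lemma F_mono: assumes "s \<le> t" shows "subalgebra (F t) (F s)"
  unfolding subalgebra_def sets_F gen_filtration_def
proof (intro conjI sigma_sets_mono' Un_mono subset_refl)
  show "{X sa -` B \<inter> space M |sa B. 0 \<le> sa \<and> sa \<le> s \<and> B \<in> sets borel}
     \<subseteq> {X s -` B \<inter> space M |s B. 0 \<le> s \<and> s \<le> t \<and> B \<in> sets borel}"
  proof safe
    fix s' and B :: "real set" assume "0 \<le> s'" "s' \<le> s" "B \<in> sets borel"
    then show "\<exists>s'' B'. X s' -` B \<inter> space M = X s'' -` B' \<inter> space M \<and> 0 \<le> s'' \<and> s'' \<le> t \<and> B' \<in> sets borel"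
      using assms by (intro exI[of _ s'] exI[of _ B]) auto
  qed
qed simp

lemma F_measurable_M: "f \<in> measurable (F t) N \<Longrightarrow> f \<in> measurable M N"
  by (rule measurable_from_subalg[OF subalgebra_F])

lemma F_measurable_mono: "f \<in> measurable (F s) N \<Longrightarrow> s \<le> t \<Longrightarrow> f \<in> measurable (F t) N"
  by (rule measurable_from_subalg[OF F_mono])

lemma X_F_measurable: assumes "0 \<le> s" "s \<le> t" shows "X s \<in> borel_measurable (F t)"
proof (rule measurableI)
  fix B :: "real set" assume "B \<in> sets borel"
  then show "X s -` B \<inter> space (F t) \<in> sets (F t)"
    unfolding sets_F space_F gen_filtration_def using assms by (intro sigma_sets.Basic) auto
qed auto

lemma W_F_measurable: assumes "0 \<le> s" "s \<le> t" shows "W s \<in> borel_measurable (F t)"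
proof -
  have [measurable]: "X s \<in> borel_measurable (F t)" by (rule X_F_measurable[OF assms])
  have "W s = (\<lambda>\<omega>. (X s \<omega> - x - \<mu> * s) / \<sigma>)"
    using sigma_pos by (auto simp: Xproc_def fun_eq_iff field_simps)
  then show ?thesis by simp
qed

text \<open>Finite-dimensional events, with one Borel set per time so that merging the time sets
  handles intersections. Together with the null sets they form an intersection-stable generator of
  \<open>F t\<close>.\<close>

definition cyl :: "real \<Rightarrow> 'a set set" where
  "cyl t = {{\<omega> \<in> space M. \<forall>s\<in>T. X s \<omega> \<in> B s} | T B. finite T \<and> T \<subseteq> {0..t} \<and> (\<forall>s. B s \<in> sets borel)}"

lemma cyl_sets: assumes "A \<in> cyl t" shows "A \<in> sets M"
proof -
  obtain T B where A: "A = {\<omega> \<in> space M. \<forall>s\<in>T. X s \<omega> \<in> B s}" and T: "finite T" "T \<subseteq> {0..t}"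
    and B: "\<And>s. B s \<in> sets borel" using assms unfolding cyl_def by auto
  have "{\<omega> \<in> space M. X s \<omega> \<in> B s} \<in> sets M" if "s \<in> T" for s
  proof -
    have "X s \<in> borel_measurable M" using that T by (intro X_measurable) auto
    from measurable_sets[OF this B] show ?thesis by (simp add: vimage_def Int_def conj_commute)
  qed
  then show ?thesis unfolding A using T(1) by (intro sets.sets_Collect_finite_All) (auto)
qed

lemma cyl_Int: assumes "A \<in> cyl t" "A' \<in> cyl t" shows "A \<inter> A' \<in> cyl t"
proof -
  obtain T B where A: "A = {\<omega> \<in> space M. \<forall>s\<in>T. X s \<omega> \<in> B s}" and T: "finite T" "T \<subseteq> {0..t}"
    and B: "\<And>s. B s \<in> sets borel" using assms(1) unfolding cyl_def by auto
  obtain T' B' where A': "A' = {\<omega> \<in> space M. \<forall>s\<in>T'. X s \<omega> \<in> B' s}" and T': "finite T'" "T' \<subseteq> {0..t}"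
    and B': "\<And>s. B' s \<in> sets borel" using assms(2) unfolding cyl_def by auto
  define B2 where "B2 s = (if s \<in> T then B s else UNIV) \<inter> (if s \<in> T' then B' s else UNIV)" for s
  have "A \<inter> A' = {\<omega> \<in> space M. \<forall>s\<in>T \<union> T'. X s \<omega> \<in> B2 s}"
    unfolding A A' B2_def by auto
  moreover have "B2 s \<in> sets borel" for s unfolding B2_def using B B' by auto
  ultimately show ?thesis unfolding cyl_def using T T'
    by (intro CollectI exI[of _ "T \<union> T'"] exI[of _ B2]) auto
qed

text \<open>Along the sorted times of the event the surplus is a function of the preceding
  increments wherever W 0 = 0, that is almost surely. Independence of the increments, grouped into
  those before \<open>t\<close> and the last one, then gives the product formula.\<close>

lemma cyl_indep:
  assumes t: "0 \<le> t" and e: "0 < e" and A: "A \<in> cyl t" and B: "B \<in> sets borel"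
  shows "prob (A \<inter> {\<omega> \<in> space M. W (t + e) \<omega> - W t \<omega> \<in> B})
    = prob A * prob {\<omega> \<in> space M. W (t + e) \<omega> - W t \<omega> \<in> B}"
proof -
  obtain T Bf where A_eq: "A = {\<omega> \<in> space M. \<forall>s\<in>T. X s \<omega> \<in> Bf s}" and T: "finite T" "T \<subseteq> {0..t}"
    and Bf: "\<And>s. Bf s \<in> sets borel" using A unfolding cyl_def by auto
  \<comment> \<open>Adding 0 lets partial sums of increments recover \<open>W\<close>; adding
    \<open>t\<close> makes the last increment the one over [t, t + e].\<close>
  define T' where "T' = T \<union> {0, t}"
  have T': "finite T'" "T' \<subseteq> {0..t}" "0 \<in> T'" "t \<in> T'" unfolding T'_def using T t by auto
  define L where "L = sorted_list_of_set T'"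
  have L: "set L = T'" "sorted L" "distinct L" unfolding L_def using T' by auto
  define k where "k = length L"
  have k0: "0 < k" unfolding k_def using L T' by (cases L) auto
  \<comment> \<open>Index k - 1 carries \<open>t\<close> and index k the extra time t + e, so
    increment number k - 1 is the future one.\<close>
  define ts where "ts j = (if j < k then L ! j else t + e)" for j
  have ts_in: "ts j \<in> T'" if "j < k" for j unfolding ts_def using that L k_def by auto
  have strict: "\<forall>j<k. ts j < ts (Suc j)"
  proof (intro allI impI)
    fix j assume j: "j < k"
    show "ts j < ts (Suc j)"
    proof (cases "Suc j < k")
      case True
      then have "L ! j \<le> L ! Suc j" using L k_def by (intro sorted_nth_mono) auto
      moreover have "L ! j \<noteq> L ! Suc j" using True L j k_def by (simp add: nth_eq_iff_index_eq)
      ultimately show ?thesis using True j by (simp add: ts_def)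
    next
      case False
      have "ts j \<le> t" using ts_in[OF j] T' by auto
      then show ?thesis using False e by (simp add: ts_def)
    qed
  qed
  have L0: "ts 0 = 0"
  proof -
    obtain j where j: "j < k" "L ! j = 0" using L T' k_def by (metis in_set_conv_nth)
    have "L ! 0 \<le> L ! j" using L j k_def by (intro sorted_nth_mono) auto
    moreover have "0 \<le> ts 0" using ts_in[OF k0] T' by auto
    ultimately show ?thesis using j k0 by (simp add: ts_def)
  qed
  have Lt: "ts (k - 1) = t"
  proof -
    obtain j where j: "j < k" "L ! j = t" using L T' k_def by (metis in_set_conv_nth)
    have "L ! j \<le> L ! (k - 1)" using L j k_def by (intro sorted_nth_mono) auto
    moreover have "ts (k - 1) \<le> t" using ts_in[of "k-1"] k0 T' by auto
    ultimately show ?thesis using j k0 by (simp add: ts_def)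
  qed
  have Lk: "ts k = t + e" by (simp add: ts_def)
  define D where "D j \<omega> = W (ts (Suc j)) \<omega> - W (ts j) \<omega>" for j \<omega>
  have "indep_vars (\<lambda>_. borel) D {..<k}"
    using BM strict L0 unfolding std_BM_def D_def[abs_def] by auto
  then have iv: "indep_var (PiM {..<k-1} (\<lambda>_. borel)) (\<lambda>\<omega>. restrict (\<lambda>i. D i \<omega>) {..<k-1})
     (PiM {k-1} (\<lambda>_. borel)) (\<lambda>\<omega>. restrict (\<lambda>i. D i \<omega>) {k-1})"
    by (rule indep_var_restrict) (use k0 in auto)
  define A1 where "A1 = {f \<in> space (PiM {..<k-1} (\<lambda>_. borel :: real measure)).
      \<forall>i\<in>{i. i < k \<and> ts i \<in> T}. x + \<mu> * ts i + \<sigma> * (\<Sum>j<i. f j) \<in> Bf (ts i)}"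
  have A1: "A1 \<in> sets (PiM {..<k-1} (\<lambda>_. borel :: real measure))"
    unfolding A1_def
  proof (intro sets.sets_Collect_finite_All)
    show "finite {i. i < k \<and> ts i \<in> T}" by auto
    fix i assume i: "i \<in> {i. i < k \<and> ts i \<in> T}"
    have "(\<lambda>f. x + \<mu> * ts i + \<sigma> * (\<Sum>j<i. f j)) \<in> borel_measurable (PiM {..<k-1} (\<lambda>_. borel :: real measure))"
      using i by (intro borel_measurable_add borel_measurable_const borel_measurable_times borel_measurable_sum
          measurable_component_singleton) auto
    from measurable_sets[OF this Bf[of "ts i"]]
    show "{f \<in> space (PiM {..<k-1} (\<lambda>_. borel :: real measure)). x + \<mu> * ts i + \<sigma> * (\<Sum>j<i. f j) \<in> Bf (ts i)}
       \<in> sets (PiM {..<k-1} (\<lambda>_. borel :: real measure))"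
      by (simp add: vimage_def Int_def conj_commute)
  qed 
  define B1 where "B1 = {f \<in> space (PiM {k-1} (\<lambda>_. borel :: real measure)). f (k-1) \<in> B}"
  have B1: "B1 \<in> sets (PiM {k-1} (\<lambda>_. borel :: real measure))"
  proof -
    have "(\<lambda>f. f (k-1)) \<in> borel_measurable (PiM {k-1} (\<lambda>_. borel :: real measure))"
      by (intro measurable_component_singleton) auto
    from measurable_sets[OF this B] show ?thesis by (simp add: B1_def vimage_def Int_def conj_commute)
  qed
  let ?RA = "\<lambda>\<omega>. restrict (\<lambda>i. D i \<omega>) {..<k-1}" and ?RB = "\<lambda>\<omega>. restrict (\<lambda>i. D i \<omega>) {k-1}"
  have eqB: "?RB -` B1 \<inter> space M = {\<omega> \<in> space M. W (t + e) \<omega> - W t \<omega> \<in> B}"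
    unfolding B1_def D_def using k0 Lk Lt by (auto simp: space_PiM)
  have Dsum: "(\<Sum>j<i. D j \<omega>) = W (ts i) \<omega> - W 0 \<omega>" for i \<omega>
    unfolding D_def by (subst sum_lessThan_telescope) (simp add: L0)
  have Tidx: "\<exists>i<k. ts i = s" if "s \<in> T" for s
  proof -
    have "s \<in> set L" using that L T'_def by auto
    then obtain i where "i < k" "L ! i = s" unfolding k_def by (metis in_set_conv_nth)
    then show ?thesis by (auto simp: ts_def)
  qed
  have RA_iff: "\<omega> \<in> ?RA -` A1 \<inter> space M \<longleftrightarrow> \<omega> \<in> A" if "\<omega> \<in> space M" "W 0 \<omega> = 0" for \<omega>
  proof -
    have "?RA \<omega> \<in> A1 \<longleftrightarrow> (\<forall>i\<in>{i. i < k \<and> ts i \<in> T}. X (ts i) \<omega> \<in> Bf (ts i))"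
    proof -
      have "x + \<mu> * ts i + \<sigma> * (\<Sum>j<i. ?RA \<omega> j) = X (ts i) \<omega>" if "i < k" for i
      proof -
        have "(\<Sum>j<i. ?RA \<omega> j) = (\<Sum>j<i. D j \<omega>)" using that by (intro sum.cong) auto
        then show ?thesis using Dsum \<open>W 0 \<omega> = 0\<close> by (simp add: Xproc_def)
      qed
      then show ?thesis unfolding A1_def by (auto simp: space_PiM)
    qed
    also have "\<dots> \<longleftrightarrow> \<omega> \<in> A" unfolding A_eq using that(1) Tidx by auto
    finally show ?thesis using that by auto
  qed
  have RAm: "?RA -` A1 \<inter> space M \<in> sets M"
    using indep_var_rv1[OF iv] A1 by (rule measurable_sets)
  have RBm: "?RB -` B1 \<inter> space M \<in> sets M"
    using indep_var_rv2[OF iv] B1 by (rule measurable_sets)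
  have "prob (A \<inter> {\<omega> \<in> space M. W (t + e) \<omega> - W t \<omega> \<in> B})
     = prob ((?RA -` A1 \<inter> space M) \<inter> (?RB -` B1 \<inter> space M))"
    unfolding eqB[symmetric]
    by (rule measure_eq_AE) (use W_cont RA_iff RAm RBm cyl_sets[OF A] in auto)
  also have "\<dots> = prob (?RA -` A1 \<inter> space M) * prob (?RB -` B1 \<inter> space M)"
  proof -
    have "(?RA -` A1 \<inter> space M) \<inter> (?RB -` B1 \<inter> space M) = (\<lambda>\<omega>. (?RA \<omega>, ?RB \<omega>)) -` (A1 \<times> B1) \<inter> space M" by auto
    then show ?thesis using indep_varD[OF iv A1 B1] by simp
  qed
  also have "prob (?RA -` A1 \<inter> space M) = prob A"
    by (rule measure_eq_AE) (use W_cont RA_iff RAm cyl_sets[OF A] in auto)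
  finally show ?thesis unfolding eqB .
qed

lemma increment_measurable [measurable]: "0 \<le> t \<Longrightarrow> 0 \<le> s \<Longrightarrow> (\<lambda>\<omega>. W t \<omega> - W s \<omega>) \<in> borel_measurable M"
  using W_measurable by measurable

text \<open>Dynkin's argument: the events satisfying the product formula contain the generator and
  are closed under complements and disjoint countable unions. For null sets both sides are 0, so
  completing the filtration does no harm.\<close>

lemma F_indep:
  assumes t: "0 \<le> t" and e: "0 < e" and A: "A \<in> sets (F t)" and B: "B \<in> sets borel"
  shows "prob (A \<inter> {\<omega> \<in> space M. W (t + e) \<omega> - W t \<omega> \<in> B})
    = prob A * prob {\<omega> \<in> space M. W (t + e) \<omega> - W t \<omega> \<in> B}"
proof -
  let ?B = "{\<omega> \<in> space M. W (t + e) \<omega> - W t \<omega> \<in> B}"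
  let ?G = "cyl t \<union> null_sets M"
  have Bm: "?B \<in> sets M"
    using measurable_sets[OF increment_measurable B, of "t + e" t] t e
    by (simp add: vimage_def Int_def conj_commute)
  have GM: "?G \<subseteq> sets M" using cyl_sets by auto
  then have GP: "?G \<subseteq> Pow (space M)" using sets.space_closed by blast
  have "gen_filtration M X t \<subseteq> sigma_sets (space M) ?G"
    unfolding gen_filtration_def
  proof (rule sigma_sets_mono, rule Un_least)
    show "{X s -` B \<inter> space M | s B. 0 \<le> s \<and> s \<le> t \<and> B \<in> sets borel} \<subseteq> sigma_sets (space M) ?G"
    proof
      fix a assume "a \<in> {X s -` B \<inter> space M | s B. 0 \<le> s \<and> s \<le> t \<and> B \<in> sets borel}"
      then obtain s B where a: "a = X s -` B \<inter> space M" "0 \<le> s" "s \<le> t" "B \<in> sets borel" by auto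
      have "a \<in> cyl t" unfolding cyl_def
        by (rule CollectI, rule exI[of _ "{s}"], rule exI[of _ "\<lambda>_. B"]) (use a in auto)
      then show "a \<in> sigma_sets (space M) ?G" by auto
    qed
  qed auto
  then have "A \<in> sigma_sets (space M) ?G" using A unfolding sets_F by auto
  moreover have "Int_stable ?G"
    unfolding Int_stable_def
  proof (intro ballI)
    fix a b assume "a \<in> ?G" "b \<in> ?G"
    then have ab: "a \<in> cyl t \<or> a \<in> null_sets M" "b \<in> cyl t \<or> b \<in> null_sets M" "a \<in> sets M" "b \<in> sets M"
      using GM by auto
    then consider "a \<in> cyl t" "b \<in> cyl t" | "a \<in> null_sets M" | "b \<in> null_sets M" by blast
    then show "a \<inter> b \<in> ?G"
    proof cases
      case 1 then show ?thesis using cyl_Int by blast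
    next
      case 2 then have "a \<inter> b \<in> null_sets M" using ab by (simp add: null_set_Int2)
      then show ?thesis by blast
    next
      case 3 then have "a \<inter> b \<in> null_sets M" using ab by (simp add: null_set_Int1)
      then show ?thesis by blast
    qed
  qed
  moreover note GP
  ultimately have "?G \<subseteq> Pow (space M)" "Int_stable ?G" "A \<in> sigma_sets (space M) ?G" by auto
  from this(2,1,3) show ?thesis
  proof (induction rule: sigma_sets_induct_disjoint[consumes 3, case_names b em co un])
    case (b A)
    then show ?case
    proof
      assume "A \<in> cyl t" then show ?thesis using cyl_indep[OF t e _ B] by blast
    next
      assume N: "A \<in> null_sets M"
      then have "A \<inter> ?B \<in> null_sets M" using Bm by (intro null_set_Int2)
      then show ?thesis using N by (simp add: measure_eq_0_null_sets)
    qed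
  next
    case em show ?case by simp
  next
    case (co A)
    then have Am: "A \<in> sets M" using GM sets.sigma_sets_subset by blast
    have "prob ((space M - A) \<inter> ?B) = prob ?B - prob (A \<inter> ?B)"
    proof -
      have "(space M - A) \<inter> ?B = ?B - (A \<inter> ?B)" by auto
      then show ?thesis using Bm Am by (simp add: finite_measure_Diff)
    qed
    also have "\<dots> = prob (space M - A) * prob ?B"
      using co Am by (simp add: prob_compl algebra_simps)
    finally show ?case .
  next
    case (un A)
    then have Am: "A i \<in> sets M" for i using GM sets.sigma_sets_subset by blast
    have "(\<lambda>i. prob (A i \<inter> ?B)) sums prob (\<Union>i. A i \<inter> ?B)"
      by (rule finite_measure_UNION) (use Am Bm un(1) in \<open>auto simp: disjoint_family_on_def\<close>)
    moreover have "(\<lambda>i. prob (A i) * prob ?B) sums (prob (\<Union>i. A i) * prob ?B)"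
      by (intro sums_mult2 finite_measure_UNION) (use Am un(1) in auto)
    ultimately have "prob (\<Union>i. A i \<inter> ?B) = prob (\<Union>i. A i) * prob ?B"
      using un(3) by (simp add: sums_iff)
    then show ?case by simp
  qed
qed

section \<open>The law of an increment and freezing of the past\<close>

definition gauss :: "real \<Rightarrow> real measure" where
  "gauss e = density lborel (\<lambda>y. ennreal (normal_density 0 (sqrt e) y))"

lemma distr_increment:
  assumes "0 \<le> t" "0 < e"
  shows "distr M borel (\<lambda>\<omega>. W (t + e) \<omega> - W t \<omega>) = gauss e"
proof -
  have "distributed M lborel (\<lambda>\<omega>. W (t + e) \<omega> - W t \<omega>) (\<lambda>y. ennreal (normal_density 0 (sqrt (t + e - t)) y))"
    using BM assms unfolding std_BM_def by (metis less_add_same_cancel1)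
  then have "distr M lborel (\<lambda>\<omega>. W (t + e) \<omega> - W t \<omega>) = gauss e"
    unfolding distributed_def gauss_def by simp
  then show ?thesis by (metis distr_cong sets_lborel)
qed

text \<open>By independence the pair formed by the outcome, seen through \<open>F t\<close>, and the
  increment has a product law; Tonelli integrates the increment out for a frozen outcome. This takes
  the place of conditioning on \<open>F t\<close> throughout.\<close>

lemma nn_integral_freeze:
  assumes t: "0 \<le> t" and e: "0 < e" and g: "g \<in> borel_measurable (F t \<Otimes>\<^sub>M borel)"
  shows "(\<integral>\<^sup>+\<omega>. g (\<omega>, W (t + e) \<omega> - W t \<omega>) \<partial>M) = (\<integral>\<^sup>+\<omega>. (\<integral>\<^sup>+z. g (\<omega>, z) \<partial>gauss e) \<partial>M)"
proof -
  let ?D = "\<lambda>\<omega>. W (t + e) \<omega> - W t \<omega>"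
  \<comment> \<open>Restricting \<open>M\<close> to \<open>F t\<close> gives the first factor of the
    product exactly the sigma-algebra for which \<open>g\<close> is measurable.\<close>
  let ?M1 = "restr_to_subalg M (F t)" and ?M2 = "distr M borel ?D"
  have Dm[measurable]: "?D \<in> borel_measurable M" using t e by (intro increment_measurable) auto
  have s1: "sets ?M1 = sets (F t)" by (rule sets_restr_to_subalg[OF subalgebra_F])
  interpret M1: prob_space ?M1 by (rule prob_space_restr_to_subalg[OF subalgebra_F]) (rule prob_space_axioms)
  interpret M2: prob_space ?M2 by (rule prob_space_distr) (rule Dm)
  have id: "(\<lambda>\<omega>. \<omega>) \<in> measurable M (F t)"
    using measurable_from_subalg[OF subalgebra_F measurable_ident[of "F t"]] by (simp add: id_def)
  have pm: "(\<lambda>\<omega>. (\<omega>, ?D \<omega>)) \<in> measurable M (F t \<Otimes>\<^sub>M borel)"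
    using id Dm by (rule measurable_Pair)
  have sp: "sets (?M1 \<Otimes>\<^sub>M ?M2) = sets (F t \<Otimes>\<^sub>M borel)"
    by (rule sets_pair_measure_cong[OF s1]) simp
  have eq: "?M1 \<Otimes>\<^sub>M ?M2 = distr M (F t \<Otimes>\<^sub>M borel) (\<lambda>\<omega>. (\<omega>, ?D \<omega>))"
  proof (rule pair_measure_eqI)
    show "sets (?M1 \<Otimes>\<^sub>M ?M2) = sets (distr M (F t \<Otimes>\<^sub>M borel) (\<lambda>\<omega>. (\<omega>, ?D \<omega>)))"
      unfolding sets_distr by (rule sp)
    fix A B assume "A \<in> sets ?M1" "B \<in> sets ?M2"
    then have A: "A \<in> sets (F t)" and B: "B \<in> sets borel" by (auto simp: s1)
    have Asub: "A \<subseteq> space M" using sets.sets_into_space[OF A] by simp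
    have AM: "A \<in> sets M" using A subalgebra_F unfolding subalgebra_def by auto
    have DB: "?D -` B \<inter> space M = {\<omega> \<in> space M. ?D \<omega> \<in> B}" by auto
    have DBm: "{\<omega> \<in> space M. ?D \<omega> \<in> B} \<in> sets M" using measurable_sets[OF Dm B] DB by simp
    have "emeasure (distr M (F t \<Otimes>\<^sub>M borel) (\<lambda>\<omega>. (\<omega>, ?D \<omega>))) (A \<times> B)
       = emeasure M ((\<lambda>\<omega>. (\<omega>, ?D \<omega>)) -` (A \<times> B) \<inter> space M)"
      by (rule emeasure_distr[OF pm]) (use A B in auto)
    also have "(\<lambda>\<omega>. (\<omega>, ?D \<omega>)) -` (A \<times> B) \<inter> space M = A \<inter> {\<omega> \<in> space M. ?D \<omega> \<in> B}"
      using Asub by auto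
    also have "emeasure M \<dots> = ennreal (prob A * prob {\<omega> \<in> space M. ?D \<omega> \<in> B})"
      by (simp add: emeasure_eq_measure F_indep[OF t e A B])
    also have "\<dots> = emeasure ?M1 A * emeasure ?M2 B"
      using A B by (simp add: emeasure_restr_to_subalg[OF subalgebra_F] emeasure_distr DB
         emeasure_eq_measure ennreal_mult)
    finally show "emeasure ?M1 A * emeasure ?M2 B
       = emeasure (distr M (F t \<Otimes>\<^sub>M borel) (\<lambda>\<omega>. (\<omega>, ?D \<omega>))) (A \<times> B)" by simp
  qed unfold_locales
  have g': "g \<in> borel_measurable (?M1 \<Otimes>\<^sub>M ?M2)" using g sp measurable_cong_sets by blast
  have "(\<integral>\<^sup>+\<omega>. g (\<omega>, ?D \<omega>) \<partial>M) = integral\<^sup>N (?M1 \<Otimes>\<^sub>M ?M2) g"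
    unfolding eq by (rule nn_integral_distr[symmetric, OF pm]) (use g in simp)
  also have "\<dots> = (\<integral>\<^sup>+\<omega>. (\<integral>\<^sup>+z. g (\<omega>, z) \<partial>?M2) \<partial>?M1)"
    by (rule M2.nn_integral_fst[symmetric, OF g'])
  also have "\<dots> = (\<integral>\<^sup>+\<omega>. (\<integral>\<^sup>+z. g (\<omega>, z) \<partial>?M2) \<partial>M)"
  proof (rule nn_integral_subalgebra2[OF subalgebra_F])
    have "(\<lambda>\<omega>. \<integral>\<^sup>+z. g (\<omega>, z) \<partial>?M2) \<in> borel_measurable ?M1"
      by (rule M2.borel_measurable_nn_integral_fst[OF g'])
    then show "(\<lambda>\<omega>. \<integral>\<^sup>+z. g (\<omega>, z) \<partial>?M2) \<in> borel_measurable (F t)"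
      using s1 measurable_cong_sets by blast
  qed
  also have "?M2 = gauss e" by (rule distr_increment[OF t e])
  finally show ?thesis .
qed

end

section \<open>Gaussian kernels with ruin monitored on a grid\<close>

definition dyadics :: "real set" where "dyadics = {real i / 2^m | i m. True}"

lemma countable_dyadics: "countable dyadics"
proof -
  have "dyadics = (\<lambda>(i, m). real i / 2^m) ` (UNIV :: (nat \<times> nat) set)" by (auto simp: dyadics_def)
  then show ?thesis by (metis countableI_type countable_image)
qed

lemma dyadics_nonneg: "r \<in> dyadics \<Longrightarrow> 0 \<le> r" by (auto simp: dyadics_def)

lemma dyadics_grid: "real i * (1 / 2^l / 2^m) \<in> dyadics"
  unfolding dyadics_def by (rule CollectI, rule exI[of _ i], rule exI[of _ "l + m"]) (simp add: power_add)

lemma dyadics_grid_eq: assumes "r \<in> dyadics" obtains i m where "r = real i * (1 / 2^l / 2^m)"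
proof -
  obtain j m where r: "r = real j / 2^m" using assms by (auto simp: dyadics_def)
  have "r = real (j * 2^l) * (1 / 2^l / 2^m)" by (simp add: r)
  then show ?thesis using that by blast
qed

lemma dyadics_add: assumes "r \<in> dyadics" "s \<in> dyadics" shows "r + s \<in> dyadics"
proof -
  obtain i m where r: "r = real i / 2^m" using assms by (auto simp: dyadics_def)
  obtain j n where s: "s = real j / 2^n" using assms by (auto simp: dyadics_def)
  have "r + s = real (i * 2^n + j * 2^m) / 2^(m+n)" unfolding r s by (simp add: field_simps power_add)
  then show ?thesis unfolding dyadics_def by blast
qed

lemma dyadics_diff: assumes "r \<in> dyadics" "s \<in> dyadics" "s \<le> r" shows "r - s \<in> dyadics"
proof -
  obtain i m where r: "r = real i / 2^m" using assms by (auto simp: dyadics_def)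
  obtain j n where s: "s = real j / 2^n" using assms by (auto simp: dyadics_def)
  have "real (j * 2^m) \<le> real (i * 2^n)" using assms(3) unfolding r s by (simp add: field_simps)
  then have le: "j * 2^m \<le> i * 2^n" by (simp only: of_nat_le_iff)
  have "r - s = real (i * 2^n - j * 2^m) / 2^(m+n)" unfolding r s of_nat_diff[OF le] by (simp add: field_simps power_add)
  then show ?thesis unfolding dyadics_def by blast
qed

text \<open>Ruin is tested at dyadic times only, which keeps survival measurable; by path continuity this
  agrees with the ruin time for almost every \<open>s\<close>, see \<open>ruin_time_iff_alive\<close> below.\<close>

definition alive :: "(real \<Rightarrow> real) \<Rightarrow> real \<Rightarrow> bool" where
  "alive Z s \<longleftrightarrow> (\<forall>r\<in>dyadics. r \<le> s \<longrightarrow> 0 \<le> Z r)"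

definition galive :: "(real \<Rightarrow> real) \<Rightarrow> real \<Rightarrow> real \<Rightarrow> bool" where
  "galive Z e s \<longleftrightarrow> (\<forall>i::nat. real i * e \<le> s \<longrightarrow> 0 \<le> Z (real i * e))"

text \<open>The level \<open>l\<close> is arbitrary: refining the grid of any fixed period length
  exhausts all dyadic times.\<close>

lemma alive_iff_galive: "alive Z s \<longleftrightarrow> (\<forall>m. galive Z (1 / 2^l / 2^m) s)"
  unfolding alive_def galive_def using dyadics_grid dyadics_grid_eq by metis

lemma galive_half: "galive Z (e / 2) s \<Longrightarrow> galive Z e s"
  unfolding galive_def
proof (intro allI impI)
  fix i assume h: "\<forall>i::nat. real i * (e / 2) \<le> s \<longrightarrow> 0 \<le> Z (real i * (e / 2))" and "real i * e \<le> s"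
  with h[rule_format, of "2 * i"] show "0 \<le> Z (real i * e)" by simp
qed

text \<open>A shift by a dyadic \<open>k\<close> maps tested times to tested times, so survival can
  be restarted at grid points.\<close>

lemma alive_add:
  assumes k: "k \<in> dyadics" and s: "0 \<le> s"
  shows "alive Z (k + s) \<longleftrightarrow> alive Z k \<and> alive (\<lambda>r. Z (k + r)) s"
proof
  assume a: "alive Z (k + s)"
  show "alive Z k \<and> alive (\<lambda>r. Z (k + r)) s"
    using a s dyadics_add[OF k] unfolding alive_def by (auto intro!: a[unfolded alive_def, rule_format])
next
  assume a: "alive Z k \<and> alive (\<lambda>r. Z (k + r)) s"
  show "alive Z (k + s)" unfolding alive_def
  proof (intro ballI impI)
    fix r assume r: "r \<in> dyadics" "r \<le> k + s"
    show "0 \<le> Z r"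
    proof (cases "r \<le> k")
      case True then show ?thesis using a r by (auto simp: alive_def)
    next
      case False
      then have "r - k \<in> dyadics" using r k by (intro dyadics_diff) auto
      moreover have "r - k \<le> s" using r by simp
      ultimately have "0 \<le> Z (k + (r - k))" using a unfolding alive_def by blast
      then show ?thesis by simp
    qed
  qed
qed

context bm_model begin

lemma prob_space_gauss: "0 < e \<Longrightarrow> prob_space (gauss e)"
  unfolding gauss_def by (rule prob_space_normal_density) simp

lemma sets_gauss [simp, measurable_cong]: "sets (gauss e) = sets borel"
  by (simp add: gauss_def)

text \<open>Ruin is checked only at the beginning of the step, so \<open>K\<close> overlooks ruin
  inside it; iterating over short steps brings it back. The first summand is the integral of c *
  exp(-q*s) over the step.\<close>

definition K :: "real \<Rightarrow> real \<Rightarrow> (real \<Rightarrow> ennreal) \<Rightarrow> real \<Rightarrow> ennreal" where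
  "K c e f y = (if 0 \<le> y then ennreal (c * ((1 - exp (- (q * e))) / q))
     + ennreal (exp (- (q * e))) * (\<integral>\<^sup>+z. f (y + (\<mu> - c) * e + \<sigma> * z) \<partial>gauss e) else 0)"

lemma K_measurable [measurable]:
  assumes e: "0 < e" and [measurable]: "f \<in> borel_measurable borel"
  shows "K c e f \<in> borel_measurable borel"
proof -
  interpret G: prob_space "gauss e" by (rule prob_space_gauss[OF e])
  have [measurable]: "(\<lambda>y. \<integral>\<^sup>+z. f (y + (\<mu> - c) * e + \<sigma> * z) \<partial>gauss e) \<in> borel_measurable borel"
    by (rule G.borel_measurable_nn_integral) measurable
  show ?thesis unfolding K_def[abs_def] by measurable
qed

lemma K_mono: "(\<And>y. f y \<le> g y) \<Longrightarrow> K c e f y \<le> K c e g y"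
  unfolding K_def by (auto intro!: add_left_mono mult_left_mono nn_integral_mono)

lemma Kpow_measurable [measurable]:
  assumes e: "0 < e" and f: "f \<in> borel_measurable borel"
  shows "(K c e ^^ n) f \<in> borel_measurable borel"
  by (induction n) (use f K_measurable[OF e] in auto)

lemma Kpow_mono: "(\<And>y. f y \<le> g y) \<Longrightarrow> (K c e ^^ n) f y \<le> (K c e ^^ n) g y"
  by (induction n arbitrary: y) (auto intro!: K_mono)

text \<open>The surplus at time t + s when the rate is held at \<open>c\<close> from time
  \<open>t\<close> on, written through the increment after \<open>t\<close> so that the past enters
  only via \<open>Y\<close>.\<close>

definition zpath :: "real \<Rightarrow> real \<Rightarrow> ('a \<Rightarrow> real) \<Rightarrow> 'a \<Rightarrow> real \<Rightarrow> real" where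
  "zpath c t Y \<omega> s = Y \<omega> + (\<mu> - c) * s + \<sigma> * (W (t + s) \<omega> - W t \<omega>)"

lemma zpath_measurable_F:
  assumes "0 \<le> t" "0 \<le> s" "Y \<in> borel_measurable (F t)" "t + s \<le> u"
  shows "(\<lambda>\<omega>. zpath c t Y \<omega> s) \<in> borel_measurable (F u)"
proof -
  have [measurable]: "Y \<in> borel_measurable (F u)" "W (t + s) \<in> borel_measurable (F u)" "W t \<in> borel_measurable (F u)"
    using assms by (auto intro: F_measurable_mono W_F_measurable)
  show ?thesis unfolding zpath_def by measurable
qed

lemma K_step:
  assumes t: "0 \<le> t" and e: "0 < e" and A: "A \<in> sets (F t)" and Y: "Y \<in> borel_measurable (F t)"
    and f: "f \<in> borel_measurable borel"
  shows "(\<integral>\<^sup>+\<omega>. indicator A \<omega> * K c e f (Y \<omega>) \<partial>M)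
    = (\<integral>\<^sup>+\<omega>. indicator (A \<inter> {\<omega> \<in> space M. 0 \<le> Y \<omega>}) \<omega> * (ennreal (c * ((1 - exp (- (q * e))) / q))
        + ennreal (exp (- (q * e))) * f (zpath c t Y \<omega> e)) \<partial>M)"
proof -
  interpret G: prob_space "gauss e" by (rule prob_space_gauss[OF e])
  note [measurable] = A Y f
  define A' where "A' = A \<inter> {\<omega> \<in> space M. 0 \<le> Y \<omega>}"
  have "{\<omega> \<in> space (F t). 0 \<le> Y \<omega>} \<in> sets (F t)" by measurable
  then have A'm[measurable]: "A' \<in> sets (F t)" using A unfolding A'_def by auto
  let ?r = "ennreal (c * ((1 - exp (- (q * e))) / q))" and ?x = "ennreal (exp (- (q * e)))"
  let ?g = "\<lambda>(\<omega>, z). indicator A' \<omega> * (?r + ?x * f (Y \<omega> + (\<mu> - c) * e + \<sigma> * z))"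
  have gm: "?g \<in> borel_measurable (F t \<Otimes>\<^sub>M borel)" by measurable
  have "(\<integral>\<^sup>+\<omega>. indicator A \<omega> * K c e f (Y \<omega>) \<partial>M) = (\<integral>\<^sup>+\<omega>. (\<integral>\<^sup>+z. ?g (\<omega>, z) \<partial>gauss e) \<partial>M)"
  proof (rule nn_integral_cong)
    fix \<omega> assume "\<omega> \<in> space M"
    have [measurable]: "(\<lambda>z. f (Y \<omega> + (\<mu> - c) * e + \<sigma> * z)) \<in> borel_measurable (gauss e)" by measurable
    have "(\<integral>\<^sup>+z. ?g (\<omega>, z) \<partial>gauss e) = indicator A' \<omega> * (?r + ?x * (\<integral>\<^sup>+z. f (Y \<omega> + (\<mu> - c) * e + \<sigma> * z) \<partial>gauss e))"
      by (simp add: nn_integral_cmult nn_integral_add G.emeasure_space_1)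
    also have "\<dots> = indicator A \<omega> * K c e f (Y \<omega>)"
      unfolding K_def A'_def using \<open>\<omega> \<in> space M\<close> by (auto simp: indicator_def)
    finally show "indicator A \<omega> * K c e f (Y \<omega>) = (\<integral>\<^sup>+z. ?g (\<omega>, z) \<partial>gauss e)" ..
  qed
  also have "\<dots> = (\<integral>\<^sup>+\<omega>. ?g (\<omega>, W (t + e) \<omega> - W t \<omega>) \<partial>M)"
    by (rule nn_integral_freeze[symmetric, OF t e gm])
  finally show ?thesis unfolding A'_def zpath_def by simp
qed

text \<open>Iterating \<open>K\<close> amounts to following the path on the grid. The induction
  restarts at time t + e from the surplus there, on the event that \<open>Y\<close> was nonnegative,
  so time, event and starting variable all have to be arbitrary. Carrying the event \<open>A\<close>
  along supplies the Markov property at fixed times.\<close>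

lemma Kpow_rep:
  assumes t: "0 \<le> t" and e: "0 < e" and A: "A \<in> sets (F t)" and Y: "Y \<in> borel_measurable (F t)"
    and f: "f \<in> borel_measurable borel" and c: "0 \<le> c"
  shows "(\<integral>\<^sup>+\<omega>. indicator A \<omega> * (K c e ^^ n) f (Y \<omega>) \<partial>M)
    = (\<integral>\<^sup>+\<omega>. indicator A \<omega> * ((\<Sum>j<n. ennreal (exp (- (q * (real j * e))) * (c * ((1 - exp (- (q * e))) / q)))
           * (if \<forall>i\<le>j. 0 \<le> zpath c t Y \<omega> (real i * e) then 1 else 0))
        + ennreal (exp (- (q * (real n * e)))) * (if \<forall>i<n. 0 \<le> zpath c t Y \<omega> (real i * e) then 1 else 0)
           * f (zpath c t Y \<omega> (real n * e))) \<partial>M)"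
  using t A Y
proof (induction n arbitrary: t A Y)
  case 0
  then show ?case by (simp add: zpath_def)
next
  case (Suc n)
  note t = Suc.prems(1) and A = Suc.prems(2) and Y = Suc.prems(3)
  let ?c = "c * ((1 - exp (- (q * e))) / q)" and ?x = "exp (- (q * e))"
  have c0: "0 \<le> ?c" using c q_pos e by simp
  define A' where "A' = A \<inter> {\<omega> \<in> space M. 0 \<le> Y \<omega>}"
  note [measurable] = A Y f
  have "{\<omega> \<in> space (F t). 0 \<le> Y \<omega>} \<in> sets (F t)" by measurable
  then have A'F: "A' \<in> sets (F t)" using A unfolding A'_def by auto
  then have A'm: "A' \<in> sets (F (t + e))" using F_mono[of t "t + e"] e unfolding subalgebra_def by auto
  have A'M[measurable]: "A' \<in> sets M" using A'F subalgebra_F unfolding subalgebra_def by auto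
  define Y' where "Y' \<omega> = zpath c t Y \<omega> e" for \<omega>
  have Y'm: "Y' \<in> borel_measurable (F (t + e))"
    unfolding Y'_def[abs_def] by (rule zpath_measurable_F) (use t e Y in auto)
  have Y'M[measurable]: "Y' \<in> borel_measurable M" using Y'm F_measurable_M by auto
  let ?g = "(K c e ^^ n) f"
  have [measurable]: "?g \<in> borel_measurable borel" by (rule Kpow_measurable[OF e f])
  have z: "zpath c (t + e) Y' \<omega> s = zpath c t Y \<omega> (s + e)" for s \<omega>
    unfolding Y'_def zpath_def by (simp add: algebra_simps)
  \<comment> \<open>The pathwise integrand as a function of \<open>n\<close>, \<open>Y\<close> and
    \<open>t\<close>, which turns the induction step into the recursion
    \<open>R_Suc\<close>.\<close>
  define R where "R n Y t \<omega> = (\<Sum>j<n. ennreal (exp (- (q * (real j * e))) * ?c)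
           * (if \<forall>i\<le>j. 0 \<le> zpath c t Y \<omega> (real i * e) then 1 else 0))
        + ennreal (exp (- (q * (real n * e)))) * (if \<forall>i<n. 0 \<le> zpath c t Y \<omega> (real i * e) then 1 else 0)
           * f (zpath c t Y \<omega> (real n * e))" for n Y t \<omega>
  have zM[measurable]: "(\<lambda>\<omega>. zpath c (t + e) Y' \<omega> (real i * e)) \<in> borel_measurable M" for i
    by (rule F_measurable_M, rule zpath_measurable_F[OF _ _ Y'm order_refl]) (use t e in auto)
  have RM[measurable]: "(\<lambda>\<omega>. R n Y' (t + e) \<omega>) \<in> borel_measurable M"
    unfolding R_def by measurable
  have R_Suc: "R (Suc n) Y t \<omega> = (if 0 \<le> Y \<omega> then ennreal ?c + ennreal ?x * R n Y' (t + e) \<omega> else 0)" for \<omega>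
  proof -
    have zz: "zpath c (t + e) Y' \<omega> (real i * e) = zpath c t Y \<omega> (real (Suc i) * e)" for i
      unfolding z by (simp add: algebra_simps)
    have Z0: "zpath c t Y \<omega> 0 = Y \<omega>" by (simp add: zpath_def)
    have all1: "(\<forall>i\<le>Suc j. 0 \<le> zpath c t Y \<omega> (real i * e)) \<longleftrightarrow> 0 \<le> Y \<omega> \<and> (\<forall>i\<le>j. 0 \<le> zpath c t Y \<omega> (real (Suc i) * e))" for j
      unfolding less_Suc_eq_le[symmetric] All_less_Suc2[of "Suc j"] using Z0 by (simp del: of_nat_Suc)
    have all2: "(\<forall>i<Suc j. 0 \<le> zpath c t Y \<omega> (real i * e)) \<longleftrightarrow> 0 \<le> Y \<omega> \<and> (\<forall>i<j. 0 \<le> zpath c t Y \<omega> (real (Suc i) * e))" for j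
      unfolding All_less_Suc2 using Z0 by (simp del: of_nat_Suc)
    have all0: "(\<forall>i\<le>(0::nat). 0 \<le> zpath c t Y \<omega> (real i * e)) \<longleftrightarrow> 0 \<le> Y \<omega>" using Z0 by simp
    have ex: "ennreal (exp (- (q * (real (Suc j) * e))) * d) = ennreal ?x * ennreal (exp (- (q * (real j * e))) * d)" if "0 \<le> d" for j d
    proof -
      have eq: "exp (- (q * (real (Suc j) * e))) * d = ?x * (exp (- (q * (real j * e))) * d)"
        by (simp add: exp_add[symmetric] algebra_simps)
      show ?thesis unfolding eq by (rule ennreal_mult) (use that in auto)
    qed
    show ?thesis
    proof (cases "0 \<le> Y \<omega>")
      case True
      then show ?thesis
        unfolding R_def sum.lessThan_Suc_shift zz all1 all2 all0 using Z0 ex[OF c0] ex[of 1]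
        by (simp add: distrib_left sum_distrib_left mult.assoc add.assoc cong: if_cong del: of_nat_Suc)
    next
      case False
      then show ?thesis
        unfolding R_def sum.lessThan_Suc_shift all1 all2 all0 using Z0 by simp
    qed
  qed
  have "(\<integral>\<^sup>+\<omega>. indicator A \<omega> * (K c e ^^ Suc n) f (Y \<omega>) \<partial>M) = (\<integral>\<^sup>+\<omega>. indicator A \<omega> * K c e ?g (Y \<omega>) \<partial>M)"
    by simp
  also have "\<dots> = (\<integral>\<^sup>+\<omega>. indicator A' \<omega> * (ennreal ?c + ennreal ?x * ?g (Y' \<omega>)) \<partial>M)"
    unfolding A'_def Y'_def by (rule K_step[OF t e A Y]) measurable
  also have "\<dots> = (\<integral>\<^sup>+\<omega>. indicator A' \<omega> * ennreal ?c \<partial>M) + ennreal ?x * (\<integral>\<^sup>+\<omega>. indicator A' \<omega> * ?g (Y' \<omega>) \<partial>M)"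
    by (subst nn_integral_cmult[symmetric], measurable, subst nn_integral_add[symmetric], measurable)
      (simp add: distrib_left mult.left_commute)
  also have "(\<integral>\<^sup>+\<omega>. indicator A' \<omega> * ?g (Y' \<omega>) \<partial>M) = (\<integral>\<^sup>+\<omega>. indicator A' \<omega> * R n Y' (t + e) \<omega> \<partial>M)"
    unfolding R_def by (rule Suc.IH) (use t e A'm Y'm in auto)
  also have "(\<integral>\<^sup>+\<omega>. indicator A' \<omega> * ennreal ?c \<partial>M) + ennreal ?x * (\<integral>\<^sup>+\<omega>. indicator A' \<omega> * R n Y' (t + e) \<omega> \<partial>M)
     = (\<integral>\<^sup>+\<omega>. indicator A' \<omega> * (ennreal ?c + ennreal ?x * R n Y' (t + e) \<omega>) \<partial>M)"
    by (subst nn_integral_cmult[symmetric], measurable, subst nn_integral_add[symmetric], measurable)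
      (simp add: distrib_left mult.left_commute)
  also have "\<dots> = (\<integral>\<^sup>+\<omega>. indicator A \<omega> * R (Suc n) Y t \<omega> \<partial>M)"
    by (rule nn_integral_cong) (auto simp: R_Suc A'_def indicator_def)
  finally show ?case unfolding R_def .
qed

lemma nn_integral_exp_interval:
  assumes "a \<le> b" "0 \<le> c"
  shows "(\<integral>\<^sup>+s. ennreal (exp (- (q * s)) * c) * indicator {a..<b} s \<partial>lborel)
     = ennreal (c * ((exp (- (q * a)) - exp (- (q * b))) / q))"
proof -
  have "(\<integral>\<^sup>+s. ennreal (exp (- (q * s)) * c) * indicator {a..<b} s \<partial>lborel)
     = (\<integral>\<^sup>+s. ennreal (exp (- (q * s)) * c) * indicator {a..b} s \<partial>lborel)"
    by (rule nn_integral_cong_AE) (use AE_lborel_singleton[of b] in \<open>eventually_elim, auto simp: indicator_def\<close>)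
  also have "\<dots> = ennreal ((- (c / q) * exp (- (q * b))) - (- (c / q) * exp (- (q * a))))"
    by (rule nn_integral_FTC_Icc[where F = "\<lambda>s. - (c / q) * exp (- (q * s))"])
      (use assms q_pos in \<open>auto intro!: derivative_eq_intros\<close>)
  also have "(- (c / q) * exp (- (q * b))) - (- (c / q) * exp (- (q * a))) = c * ((exp (- (q * a)) - exp (- (q * b))) / q)"
    using q_pos by (simp add: field_simps)
  finally show ?thesis .
qed

text \<open>On the j-th grid interval the tested times are those with index at most
  \<open>j\<close>, so survival is constant there and the integral splits into explicit
  pieces.\<close>

lemma grid_reward_integral:
  assumes e: "0 < e" and c: "0 \<le> c"
  shows "(\<Sum>j<n. ennreal (exp (- (q * (real j * e))) * (c * ((1 - exp (- (q * e))) / q)))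
           * (if \<forall>i\<le>j. 0 \<le> Z (real i * e) then 1 else 0))
    = (\<integral>\<^sup>+s. ennreal (exp (- (q * s)) * c) * (if 0 \<le> s \<and> s < real n * e \<and> galive Z e s then 1 else 0) \<partial>lborel)"
proof -
  have piece: "(if real j * e \<le> s \<and> s < real (Suc j) * e \<and> galive Z e s then 1 else (0::ennreal))
     = (if \<forall>i\<le>j. 0 \<le> Z (real i * e) then 1 else 0) * indicator {real j * e..<real (Suc j) * e} s" for j s
  proof (cases "s \<in> {real j * e..<real (Suc j) * e}")
    case True
    have "real i * e \<le> s \<longleftrightarrow> i \<le> j" for i
    proof
      assume "real i * e \<le> s"
      then have "real i * e < real (Suc j) * e" using True by simp
      then show "i \<le> j" using e by (simp only: mult_less_cancel_right_pos of_nat_less_iff) 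
    next
      assume "i \<le> j"
      then have "real i * e \<le> real j * e" using e by simp
      then show "real i * e \<le> s" using True by simp
    qed
    then show ?thesis using True by (simp add: galive_def)
  qed (auto simp: indicator_def)
  have split: "(if 0 \<le> s \<and> s < real n * e \<and> galive Z e s then 1 else (0::ennreal))
     = (\<Sum>j<n. if real j * e \<le> s \<and> s < real (Suc j) * e \<and> galive Z e s then 1 else 0)" for s
  proof (induction n)
    case (Suc n)
    have "0 \<le> real n * e" "real n * e \<le> real (Suc n) * e" using e by auto
    then show ?case unfolding sum.lessThan_Suc Suc[symmetric] by auto
  qed auto
  have trm: "(\<integral>\<^sup>+s. ennreal (exp (- (q * s)) * c) * (if real j * e \<le> s \<and> s < real (Suc j) * e \<and> galive Z e s then 1 else 0) \<partial>lborel)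
     = ennreal (exp (- (q * (real j * e))) * (c * ((1 - exp (- (q * e))) / q))) * (if \<forall>i\<le>j. 0 \<le> Z (real i * e) then 1 else 0)" for j
  proof -
    have "(\<integral>\<^sup>+s. ennreal (exp (- (q * s)) * c) * (if real j * e \<le> s \<and> s < real (Suc j) * e \<and> galive Z e s then 1 else 0) \<partial>lborel)
     = (if \<forall>i\<le>j. 0 \<le> Z (real i * e) then 1 else 0) * (\<integral>\<^sup>+s. ennreal (exp (- (q * s)) * c) * indicator {real j * e..<real (Suc j) * e} s \<partial>lborel)"
      unfolding piece by (subst nn_integral_cmult[symmetric]) (auto intro!: nn_integral_cong)
    also have "(\<integral>\<^sup>+s. ennreal (exp (- (q * s)) * c) * indicator {real j * e..<real (Suc j) * e} s \<partial>lborel)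
       = ennreal (c * ((exp (- (q * (real j * e))) - exp (- (q * (real (Suc j) * e)))) / q))"
      using e c by (intro nn_integral_exp_interval) auto
    also have "c * ((exp (- (q * (real j * e))) - exp (- (q * (real (Suc j) * e)))) / q)
      = exp (- (q * (real j * e))) * (c * ((1 - exp (- (q * e))) / q))"
    proof -
      have "exp (- (q * (real (Suc j) * e))) = exp (- (q * (real j * e))) * exp (- (q * e))"
        by (simp add: exp_add[symmetric] algebra_simps)
      then show ?thesis by (simp add: algebra_simps)
    qed
    finally show ?thesis by (simp add: mult.commute)
  qed
  have m: "(\<lambda>s. ennreal (exp (- (q * s)) * c) * (if real j * e \<le> s \<and> s < real (Suc j) * e \<and> galive Z e s then 1 else 0)) \<in> borel_measurable lborel" for j
    unfolding piece by measurable
  show ?thesis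
    unfolding split sum_distrib_left by (subst nn_integral_sum[OF m]) (simp only: trm)
qed

end

section \<open>The killed one-step operator\<close>

lemma galive_pred [measurable]: "Measurable.pred borel (\<lambda>s. galive Z e s)"
  unfolding galive_def by measurable

lemma alive_pred [measurable]: "Measurable.pred borel (\<lambda>s. alive Z s)"
  unfolding alive_iff_galive[of Z _ 0] by measurable

context bm_model begin

definition rwd :: "real \<Rightarrow> real \<Rightarrow> (real \<Rightarrow> bool) \<Rightarrow> ennreal" where
  "rwd c d Q = (\<integral>\<^sup>+s. ennreal (exp (- (q * s)) * c) * (if 0 \<le> s \<and> s < d \<and> Q s then 1 else 0) \<partial>lborel)"

lemma rwd_le: assumes "0 \<le> c" "0 \<le> d" shows "rwd c d Q \<le> ennreal (c * ((1 - exp (- (q * d))) / q))"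
proof -
  have "rwd c d Q \<le> (\<integral>\<^sup>+s. ennreal (exp (- (q * s)) * c) * indicator {0..<d} s \<partial>lborel)"
    unfolding rwd_def by (intro nn_integral_mono mult_left_mono) (auto simp: indicator_def)
  also have "\<dots> = ennreal (c * ((1 - exp (- (q * d))) / q))"
    using nn_integral_exp_interval[OF assms(2,1)] by simp
  finally show ?thesis .
qed

lemma rwd_mono: "(\<And>s. Q s \<Longrightarrow> Q' s) \<Longrightarrow> rwd c d Q \<le> rwd c d Q'"
  unfolding rwd_def by (intro nn_integral_mono mult_left_mono) auto

lemma rwd_full: assumes "0 \<le> c" "0 \<le> d" "\<And>s. 0 \<le> s \<Longrightarrow> s < d \<Longrightarrow> Q s"
  shows "rwd c d Q = ennreal (c * ((1 - exp (- (q * d))) / q))"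
proof -
  have "rwd c d Q = (\<integral>\<^sup>+s. ennreal (exp (- (q * s)) * c) * indicator {0..<d} s \<partial>lborel)"
    unfolding rwd_def using assms(3) by (intro nn_integral_cong) (auto simp: indicator_def)
  then show ?thesis using nn_integral_exp_interval[OF assms(2,1)] by simp
qed

lemma galive_mono_grid:
  assumes "m \<le> n" "galive Z (1 / 2^l / 2^n) s" shows "galive Z (1 / 2^l / 2^m) s"
  using assms
proof (induction n rule: dec_induct)
  case (step n)
  then show ?case using galive_half[of Z "1 / 2^l / 2^n" s] by (simp add: field_simps)
qed auto

text \<open>Finer monitoring only removes surviving times. Downward monotone convergence is
  legitimate because the reward under the coarsest monitoring is finite.\<close>

lemma rwd_alive_INF:
  assumes c: "0 \<le> c" and d: "0 \<le> d"
  shows "rwd c d (alive Z) = (INF m. rwd c d (galive Z (1 / 2^l / 2^m)))"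
proof -
  let ?f = "\<lambda>m s. ennreal (exp (- (q * s)) * c) * (if 0 \<le> s \<and> s < d \<and> galive Z (1 / 2^l / 2^m) s then 1 else 0)"
  have dec: "decseq ?f"
  proof (rule decseq_SucI, rule le_funI, rule mult_left_mono)
    fix m s
    show "(if 0 \<le> s \<and> s < d \<and> galive Z (1 / 2^l / 2^Suc m) s then 1 else 0)
      \<le> (if 0 \<le> s \<and> s < d \<and> galive Z (1 / 2^l / 2^m) s then 1 else (0::ennreal))"
      using galive_mono_grid[of m "Suc m" Z l s] by auto
  qed simp
  have fin: "integral\<^sup>N lborel (?f 0) < \<infinity>"
    using rwd_le[OF c d, of "galive Z (1 / 2^l / 2^0)"] unfolding rwd_def
    by (rule le_less_trans) simp
  have "(INF m. ?f m s) = ennreal (exp (- (q * s)) * c) * (if 0 \<le> s \<and> s < d \<and> alive Z s then 1 else 0)" for s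
  proof (cases "0 \<le> s \<and> s < d \<and> alive Z s")
    case True
    then have "galive Z (1 / 2^l / 2^m) s" for m using alive_iff_galive[of Z s l] by blast
    then show ?thesis using True by simp
  next
    case False
    then obtain m where "\<not> (0 \<le> s \<and> s < d \<and> galive Z (1 / 2^l / 2^m) s)" using alive_iff_galive[of Z s l] by blast
    then have "?f m s = 0" by (simp only: if_False mult_zero_right)
    then have "(INF m. ?f m s) \<le> 0" by (metis (no_types, lifting) INF_lower UNIV_I)
    then show ?thesis using False by auto
  qed
  then have "rwd c d (alive Z) = (\<integral>\<^sup>+s. (INF m. ?f m s) \<partial>lborel)" unfolding rwd_def by simp
  also have "\<dots> = (INF m. integral\<^sup>N lborel (?f m))"
    by (rule nn_integral_monotone_convergence_INF_decseq[OF dec _ fin]) measurable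
  finally show ?thesis unfolding rwd_def .
qed

lemma rwd_galive_measurable:
  assumes c: "0 \<le> c" and e: "0 < e" and Z: "\<And>i::nat. (\<lambda>\<omega>. Z \<omega> (real i * e)) \<in> borel_measurable N"
  shows "(\<lambda>\<omega>. rwd c (real n * e) (galive (Z \<omega>) e)) \<in> borel_measurable N"
proof -
  note [measurable] = Z
  have "(\<lambda>\<omega>. rwd c (real n * e) (galive (Z \<omega>) e)) = (\<lambda>\<omega>. \<Sum>j<n. ennreal (exp (- (q * (real j * e))) * (c * ((1 - exp (- (q * e))) / q)))
           * (if \<forall>i\<le>j. 0 \<le> Z \<omega> (real i * e) then 1 else 0))"
    unfolding rwd_def grid_reward_integral[OF e c, symmetric] ..
  also have "\<dots> \<in> borel_measurable N" by measurable
  finally show ?thesis .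
qed

text \<open>Defined as a limit of deterministic kernels and not as an expectation over paths, so
  that measurability and monotonicity are inherited from \<open>K\<close>. Its meaning as a killed
  expectation is \<open>P_rep\<close>.\<close>

definition P :: "nat \<Rightarrow> real \<Rightarrow> (real \<Rightarrow> ennreal) \<Rightarrow> real \<Rightarrow> ennreal" where
  "P l c f y = (INF m. (K c (1 / 2^l / 2^m) ^^ (2^m)) f y)"

context
  fixes l :: nat and c B :: real and f :: "real \<Rightarrow> ennreal"
  assumes c: "0 \<le> c" and f: "f \<in> borel_measurable borel" and fneg: "\<And>y. y < 0 \<Longrightarrow> f y = 0"
    and fB: "\<And>y. f y \<le> ennreal B" and B: "0 \<le> B"
begin

definition gridR :: "real \<Rightarrow> ('a \<Rightarrow> real) \<Rightarrow> nat \<Rightarrow> 'a \<Rightarrow> ennreal" where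
  "gridR t Y m \<omega> = rwd c (1 / 2^l) (galive (zpath c t Y \<omega>) (1 / 2^l / 2^m))
     + ennreal (exp (- (q * (1 / 2^l)))) * (if galive (zpath c t Y \<omega>) (1 / 2^l / 2^m) (1 / 2^l) then f (zpath c t Y \<omega> (1 / 2^l)) else 0)"

lemma Kpow_gridR:
  assumes t: "0 \<le> t" and A: "A \<in> sets (F t)" and Y: "Y \<in> borel_measurable (F t)"
  shows "(\<integral>\<^sup>+\<omega>. indicator A \<omega> * (K c (1 / 2^l / 2^m) ^^ (2^m)) f (Y \<omega>) \<partial>M) = (\<integral>\<^sup>+\<omega>. indicator A \<omega> * gridR t Y m \<omega> \<partial>M)"
proof -
  define e :: real where "e = 1 / 2^l / 2^m"
  have e: "0 < e" by (simp add: e_def)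
  have ne: "real (2^m) * e = 1 / 2^l" by (simp add: e_def)
  \<comment> \<open>The kernels do not test the end of the period, \<open>galive\<close> does; the
    two agree because \<open>f\<close> vanishes at negative surplus.\<close>
  have "(if \<forall>i<2^m. 0 \<le> Z (real i * e) then 1 else 0) * f (Z (1 / 2^l)) = (if galive Z e (1 / 2^l) then f (Z (1 / 2^l)) else 0)" for Z
  proof -
    have "real i * e \<le> 1 / 2^l \<longleftrightarrow> i \<le> 2^m" for i
      unfolding ne[symmetric] using e by (simp only: mult_le_cancel_right_pos of_nat_le_iff)
    then have "galive Z e (1 / 2^l) \<longleftrightarrow> (\<forall>i<2^m. 0 \<le> Z (real i * e)) \<and> 0 \<le> Z (1 / 2^l)"
      unfolding galive_def using ne by (metis le_neq_implies_less less_imp_le order_refl)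
    then show ?thesis using fneg[of "Z (1 / 2^l)"] by auto
  qed
  then have "gridR t Y m \<omega> = (\<Sum>j<2^m. ennreal (exp (- (q * (real j * e))) * (c * ((1 - exp (- (q * e))) / q)))
           * (if \<forall>i\<le>j. 0 \<le> zpath c t Y \<omega> (real i * e) then 1 else 0))
        + ennreal (exp (- (q * (real (2^m) * e)))) * (if \<forall>i<2^m. 0 \<le> zpath c t Y \<omega> (real i * e) then 1 else 0)
           * f (zpath c t Y \<omega> (real (2^m) * e))" for \<omega>
    unfolding gridR_def rwd_def e_def[symmetric] ne grid_reward_integral[OF e c, where n = "2^m", unfolded ne]
    by (simp add: mult.assoc)
  then show ?thesis using Kpow_rep[OF t e A Y f c, of "2^m"] unfolding e_def[symmetric] by simp
qed

lemma gridR_dec: "gridR t Y (Suc m) \<omega> \<le> gridR t Y m \<omega>"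
  unfolding gridR_def using galive_mono_grid[of m "Suc m" _ l]
  by (intro add_mono mult_left_mono rwd_mono) auto

lemma gridR_le: "gridR t Y m \<omega> \<le> ennreal (c / q + B)"
proof -
  have "gridR t Y m \<omega> \<le> ennreal (c / q) + 1 * ennreal B"
    unfolding gridR_def
  proof (intro add_mono mult_mono)
    have "rwd c (1 / 2^l) (galive (zpath c t Y \<omega>) (1 / 2^l / 2^m)) \<le> ennreal (c * ((1 - exp (- (q * (1 / 2^l)))) / q))"
      by (rule rwd_le[OF c]) simp
    also have "\<dots> \<le> ennreal (c / q)"
    proof (rule ennreal_leI)
      have "c * ((1 - exp (- (q * (1 / 2^l)))) / q) \<le> c * (1 / q)"
        using c q_pos by (intro mult_left_mono divide_right_mono) auto
      then show "c * ((1 - exp (- (q * (1 / 2^l)))) / q) \<le> c / q" by simp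
    qed
    finally show "rwd c (1 / 2^l) (galive (zpath c t Y \<omega>) (1 / 2^l / 2^m)) \<le> ennreal (c / q)" .
    show "ennreal (exp (- (q * (1 / 2^l)))) \<le> 1" using q_pos by simp
  qed (use fB B in auto)
  also have "\<dots> = ennreal (c / q + B)" using c q_pos B by (simp add: ennreal_plus)
  finally show ?thesis .
qed

lemma gridR_measurable:
  assumes t: "0 \<le> t" and Y: "Y \<in> borel_measurable (F t)"
  shows "gridR t Y m \<in> borel_measurable M"
proof -
  note [measurable] = f
  have Z[measurable]: "(\<lambda>\<omega>. zpath c t Y \<omega> s) \<in> borel_measurable M" if "0 \<le> s" for s
    by (rule F_measurable_M, rule zpath_measurable_F[OF t that Y order_refl])
  have Zi[measurable]: "(\<lambda>\<omega>. zpath c t Y \<omega> (real i * (1 / 2^l / 2^m))) \<in> borel_measurable M" for i by (rule Z) simp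
  have Z1[measurable]: "(\<lambda>\<omega>. zpath c t Y \<omega> (1 / 2^l)) \<in> borel_measurable M" by (rule Z) simp
  have [measurable]: "(\<lambda>\<omega>. rwd c (1 / 2^l) (galive (zpath c t Y \<omega>) (1 / 2^l / 2^m))) \<in> borel_measurable M"
    using rwd_galive_measurable[OF c, where e = "1 / 2^l / 2^m" and n = "2^m" and N = M and Z = "\<lambda>\<omega>. zpath c t Y \<omega>"] Zi by simp
  have [measurable]: "Measurable.pred M (\<lambda>\<omega>. galive (zpath c t Y \<omega>) (1 / 2^l / 2^m) (1 / 2^l))"
    unfolding galive_def by measurable
  show ?thesis unfolding gridR_def by measurable
qed

lemma gridR_INF: "(INF m. gridR t Y m \<omega>) = rwd c (1 / 2^l) (alive (zpath c t Y \<omega>))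
     + ennreal (exp (- (q * (1 / 2^l)))) * (if alive (zpath c t Y \<omega>) (1 / 2^l) then f (zpath c t Y \<omega> (1 / 2^l)) else 0)"
proof -
  let ?Z = "zpath c t Y \<omega>"
  let ?a = "\<lambda>m. rwd c (1 / 2^l) (galive ?Z (1 / 2^l / 2^m))"
  let ?b = "\<lambda>m. ennreal (exp (- (q * (1 / 2^l)))) * (if galive ?Z (1 / 2^l / 2^m) (1 / 2^l) then f (?Z (1 / 2^l)) else 0)"
  have da: "decseq ?a" unfolding decseq_def using galive_mono_grid by (auto intro!: rwd_mono)
  have db: "decseq ?b" unfolding decseq_def using galive_mono_grid by (auto intro!: mult_left_mono)
  have "?a \<longlonglongrightarrow> rwd c (1 / 2^l) (alive ?Z)"
    using LIMSEQ_INF[OF da] rwd_alive_INF[OF c, of "1/2^l" ?Z l] by simp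
  moreover have "(INF m. ?b m) = ennreal (exp (- (q * (1 / 2^l)))) * (if alive ?Z (1 / 2^l) then f (?Z (1 / 2^l)) else 0)"
  proof (cases "alive ?Z (1 / 2^l)")
    case True
    then have "galive ?Z (1 / 2^l / 2^m) (1 / 2^l)" for m using alive_iff_galive[of ?Z _ l] by blast
    then show ?thesis using True by simp
  next
    case False
    then obtain m where "\<not> galive ?Z (1 / 2^l / 2^m) (1 / 2^l)" using alive_iff_galive[of ?Z _ l] by blast
    then have "?b m = 0" by simp
    then have "(INF m. ?b m) \<le> 0" by (metis (no_types, lifting) INF_lower UNIV_I)
    then show ?thesis using False by auto
  qed
  then have "?b \<longlonglongrightarrow> ennreal (exp (- (q * (1 / 2^l)))) * (if alive ?Z (1 / 2^l) then f (?Z (1 / 2^l)) else 0)"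
    using LIMSEQ_INF[OF db] by simp
  ultimately have "(\<lambda>m. gridR t Y m \<omega>) \<longlonglongrightarrow> rwd c (1 / 2^l) (alive ?Z)
     + ennreal (exp (- (q * (1 / 2^l)))) * (if alive ?Z (1 / 2^l) then f (?Z (1 / 2^l)) else 0)"
    unfolding gridR_def by (rule tendsto_add)
  moreover have "(\<lambda>m. gridR t Y m \<omega>) \<longlonglongrightarrow> (INF m. gridR t Y m \<omega>)"
    by (rule LIMSEQ_INF) (auto intro!: decseq_SucI gridR_dec)
  ultimately show ?thesis by (rule LIMSEQ_unique[symmetric])
qed

lemma Kpow_point: "(K c (1 / 2^l / 2^m) ^^ (2^m)) f y = (\<integral>\<^sup>+\<omega>. gridR 0 (\<lambda>_. y) m \<omega> \<partial>M)"
  using Kpow_gridR[of 0 "space M" "\<lambda>_. y" m] sets.top[of "F 0"]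
  by (simp add: emeasure_space_1 cong: nn_integral_cong_simp)

lemma Kpow_dec: "(K c (1 / 2^l / 2^Suc m) ^^ (2^Suc m)) f y \<le> (K c (1 / 2^l / 2^m) ^^ (2^m)) f y"
  unfolding Kpow_point by (intro nn_integral_mono gridR_dec)

lemma Kpow_le: "(K c (1 / 2^l / 2^m) ^^ (2^m)) f y \<le> ennreal (c / q + B)"
proof -
  have "(\<integral>\<^sup>+\<omega>. gridR 0 (\<lambda>_. y) m \<omega> \<partial>M) \<le> (\<integral>\<^sup>+\<omega>. ennreal (c / q + B) \<partial>M)"
    by (intro nn_integral_mono gridR_le)
  then show ?thesis unfolding Kpow_point by (simp add: emeasure_space_1)
qed

text \<open>Both sides of \<open>Kpow_gridR\<close> decrease in \<open>m\<close>, and the common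
  bound c/q + B allows downward monotone convergence on each. The event \<open>A\<close> and the
  random start \<open>Y\<close> make this the Markov property of the killed path at time
  \<open>t\<close>.\<close>

lemma P_rep:
  assumes t: "0 \<le> t" and A: "A \<in> sets (F t)" and Y: "Y \<in> borel_measurable (F t)"
  shows "(\<integral>\<^sup>+\<omega>. indicator A \<omega> * P l c f (Y \<omega>) \<partial>M)
    = (\<integral>\<^sup>+\<omega>. indicator A \<omega> * (rwd c (1 / 2^l) (alive (zpath c t Y \<omega>))
     + ennreal (exp (- (q * (1 / 2^l)))) * (if alive (zpath c t Y \<omega>) (1 / 2^l) then f (zpath c t Y \<omega> (1 / 2^l)) else 0)) \<partial>M)"
proof -
  have AM[measurable]: "A \<in> sets M" using A subalgebra_F unfolding subalgebra_def by auto
  have YM[measurable]: "Y \<in> borel_measurable M" using Y F_measurable_M by auto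
  have ind: "indicator A \<omega> * (INF m. h m) = (INF m. indicator A \<omega> * (h m :: ennreal))" for h :: "nat \<Rightarrow> ennreal" and \<omega>
    by (cases "\<omega> \<in> A") auto
  have fin: "(\<integral>\<^sup>+\<omega>. indicator A \<omega> * h \<omega> \<partial>M) < \<infinity>" if "\<And>\<omega>. h \<omega> \<le> ennreal (c / q + B)" for h
  proof -
    have "(\<integral>\<^sup>+\<omega>. indicator A \<omega> * h \<omega> \<partial>M) \<le> (\<integral>\<^sup>+\<omega>. ennreal (c / q + B) \<partial>M)"
      using that by (intro nn_integral_mono) (auto simp: indicator_def)
    also have "\<dots> < \<infinity>" by (simp add: emeasure_space_1)
    finally show ?thesis .
  qed
  have [measurable]: "(K c (1 / 2^l / 2^m) ^^ (2^m)) f \<in> borel_measurable borel" for m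
    by (rule Kpow_measurable[OF _ f]) simp
  have [measurable]: "gridR t Y m \<in> borel_measurable M" for m by (rule gridR_measurable[OF t Y])
  have "(\<integral>\<^sup>+\<omega>. indicator A \<omega> * P l c f (Y \<omega>) \<partial>M)
    = (\<integral>\<^sup>+\<omega>. (INF m. indicator A \<omega> * (K c (1 / 2^l / 2^m) ^^ (2^m)) f (Y \<omega>)) \<partial>M)"
    unfolding P_def ind ..
  also have "\<dots> = (INF m. \<integral>\<^sup>+\<omega>. indicator A \<omega> * (K c (1 / 2^l / 2^m) ^^ (2^m)) f (Y \<omega>) \<partial>M)"
  proof (rule nn_integral_monotone_convergence_INF_decseq[where i = 0])
    show "decseq (\<lambda>m \<omega>. indicator A \<omega> * (K c (1 / 2^l / 2^m) ^^ (2^m)) f (Y \<omega>))"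
      by (rule decseq_SucI, rule le_funI, rule mult_left_mono, rule Kpow_dec) simp
    show "(\<lambda>\<omega>. indicator A \<omega> * (K c (1 / 2^l / 2^m) ^^ (2^m)) f (Y \<omega>)) \<in> borel_measurable M" for m
      by measurable
  qed (rule fin, rule Kpow_le)
  also have "\<dots> = (INF m. \<integral>\<^sup>+\<omega>. indicator A \<omega> * gridR t Y m \<omega> \<partial>M)"
    unfolding Kpow_gridR[OF t A Y] ..
  also have "\<dots> = (\<integral>\<^sup>+\<omega>. (INF m. indicator A \<omega> * gridR t Y m \<omega>) \<partial>M)"
  proof (rule nn_integral_monotone_convergence_INF_decseq[where i = 0, symmetric])
    show "decseq (\<lambda>m \<omega>. indicator A \<omega> * gridR t Y m \<omega>)"
      by (rule decseq_SucI, rule le_funI, rule mult_left_mono, rule gridR_dec) simp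
    show "(\<lambda>\<omega>. indicator A \<omega> * gridR t Y m \<omega>) \<in> borel_measurable M" for m by measurable
  qed (rule fin, rule gridR_le)
  finally show ?thesis unfolding ind[symmetric] gridR_INF .
qed

lemma P_point: "P l c f y = (\<integral>\<^sup>+\<omega>. rwd c (1 / 2^l) (alive (zpath c 0 (\<lambda>_. y) \<omega>))
     + ennreal (exp (- (q * (1 / 2^l)))) * (if alive (zpath c 0 (\<lambda>_. y) \<omega>) (1 / 2^l) then f (zpath c 0 (\<lambda>_. y) \<omega> (1 / 2^l)) else 0) \<partial>M)"
  using P_rep[of 0 "space M" "\<lambda>_. y"] sets.top[of "F 0"]
  by (simp add: emeasure_space_1 cong: nn_integral_cong_simp)

lemma P_integrand_measurable:
  assumes t: "0 \<le> t" and Y: "Y \<in> borel_measurable (F t)"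
  shows "(\<lambda>\<omega>. rwd c (1 / 2^l) (alive (zpath c t Y \<omega>))) \<in> borel_measurable M"
    "(\<lambda>\<omega>. if alive (zpath c t Y \<omega>) (1 / 2^l) then f (zpath c t Y \<omega> (1 / 2^l)) else 0) \<in> borel_measurable M"
proof -
  note [measurable] = f
  have Z: "(\<lambda>\<omega>. zpath c t Y \<omega> s) \<in> borel_measurable M" if "0 \<le> s" for s
    by (rule F_measurable_M, rule zpath_measurable_F[OF t that Y order_refl])
  have Zi[measurable]: "(\<lambda>\<omega>. zpath c t Y \<omega> (real i * (1 / 2^l / 2^m))) \<in> borel_measurable M" for i m by (rule Z) simp
  have Z1[measurable]: "(\<lambda>\<omega>. zpath c t Y \<omega> (1 / 2^l)) \<in> borel_measurable M" by (rule Z) simp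
  have [measurable]: "(\<lambda>\<omega>. rwd c (1 / 2^l) (galive (zpath c t Y \<omega>) (1 / 2^l / 2^m))) \<in> borel_measurable M" for m
    using rwd_galive_measurable[OF c, where e = "1 / 2^l / 2^m" and n = "2^m" and N = M and Z = "\<lambda>\<omega>. zpath c t Y \<omega>"] Zi by simp
  have d: "(0::real) \<le> 1 / 2^l" by simp
  show "(\<lambda>\<omega>. rwd c (1 / 2^l) (alive (zpath c t Y \<omega>))) \<in> borel_measurable M"
    unfolding rwd_alive_INF[OF c d, where l = l] by measurable
  show "(\<lambda>\<omega>. if alive (zpath c t Y \<omega>) (1 / 2^l) then f (zpath c t Y \<omega> (1 / 2^l)) else 0) \<in> borel_measurable M"
  proof -
    have [measurable]: "Measurable.pred M (\<lambda>\<omega>. galive (zpath c t Y \<omega>) (1 / 2^l / 2^m) (1 / 2^l))" for m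
      unfolding galive_def by measurable
    show ?thesis unfolding alive_iff_galive[where l = l] by measurable
  qed
qed

end

lemma P_measurable [measurable]: "f \<in> borel_measurable borel \<Longrightarrow> P l c f \<in> borel_measurable borel"
proof -
  assume f: "f \<in> borel_measurable borel"
  have [measurable]: "(K c (1 / 2^l / 2^m) ^^ (2^m)) f \<in> borel_measurable borel" for m
    by (rule Kpow_measurable[OF _ f]) simp
  show ?thesis unfolding P_def[abs_def] by measurable
qed

lemma P_mono: "(\<And>y. f y \<le> g y) \<Longrightarrow> P l c f y \<le> P l c g y"
  unfolding P_def by (intro INF_mono') (auto intro: Kpow_mono)

lemma P_le_K: "P l c f y \<le> K c (1 / 2^l) f y"
  unfolding P_def by (rule INF_lower2[of 0]) auto

lemma P_neg: assumes "y < 0" shows "P l c f y = 0"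
proof -
  have "P l c f y \<le> K c (1 / 2^l) f y" by (rule P_le_K)
  also have "\<dots> = 0" using assms by (simp add: K_def)
  finally show ?thesis by simp
qed

lemma K_mono_point: assumes "mono f" shows "mono (K c e f)"
  unfolding K_def by (rule monoI) (auto intro!: add_left_mono mult_left_mono nn_integral_mono monoD[OF assms])

lemma P_mono_point: assumes "mono f" shows "mono (P l c f)"
proof -
  have "mono ((K c e ^^ n) f)" for e n by (induction n) (use assms K_mono_point in auto)
  then show ?thesis unfolding P_def[abs_def] by (auto intro!: monoI INF_mono' dest: monoD)
qed

text \<open>Over one step discounting loses B * (1 - exp(-q*e)), and this is at least the reward
  paid when c \<le> q*B.\<close>

lemma K_le_bound:
  assumes e: "0 < e" and f: "\<And>y. f y \<le> ennreal B" and c: "0 \<le> c" "c \<le> q * B"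
  shows "K c e f y \<le> ennreal B"
proof (cases "0 \<le> y")
  case True
  interpret G: prob_space "gauss e" by (rule prob_space_gauss[OF e])
  have B: "0 \<le> B" using c q_pos by (meson order_trans zero_le_mult_iff less_le_not_le)
  have "(\<integral>\<^sup>+z. f (y + (\<mu> - c) * e + \<sigma> * z) \<partial>gauss e) \<le> (\<integral>\<^sup>+z. ennreal B \<partial>gauss e)"
    by (intro nn_integral_mono f)
  also have "\<dots> = ennreal B" by (simp add: G.emeasure_space_1)
  finally have "K c e f y \<le> ennreal (c * ((1 - exp (- (q * e))) / q)) + ennreal (exp (- (q * e))) * ennreal B"
    unfolding K_def using True by (auto intro!: add_left_mono mult_left_mono)
  also have "\<dots> = ennreal (c * ((1 - exp (- (q * e))) / q) + exp (- (q * e)) * B)"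
    using c e q_pos B by (simp add: ennreal_plus ennreal_mult)
  also have "\<dots> \<le> ennreal B"
  proof (rule ennreal_leI)
    have "c / q * (1 - exp (- (q * e))) \<le> B * (1 - exp (- (q * e)))"
      using c q_pos e by (intro mult_right_mono) (auto simp: field_simps)
    then show "c * ((1 - exp (- (q * e))) / q) + exp (- (q * e)) * B \<le> B" by (simp add: algebra_simps diff_divide_distrib)
  qed
  finally show ?thesis .
qed (simp add: K_def)

lemma P_le_bound:
  assumes f: "\<And>y. f y \<le> ennreal B" and c: "0 \<le> c" "c \<le> q * B"
  shows "P l c f y \<le> ennreal B"
  by (rule order_trans[OF P_le_K K_le_bound[OF _ assms]]) simp

text \<open>An infimum of kernels need not commute with suprema, but in the form
  \<open>P_point\<close> the function enters affinely under one integral, where monotone convergence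
  applies.\<close>

lemma P_SUP_le:
  assumes c: "0 \<le> c" and f: "\<And>n. f n \<in> borel_measurable borel" and fneg: "\<And>n y. y < 0 \<Longrightarrow> f n y = 0"
    and fB: "\<And>n y. f n y \<le> ennreal B" and B: "0 \<le> B" and inc: "\<And>y. incseq (\<lambda>n. f n y)"
  shows "P l c (\<lambda>y. SUP n. f n y) y \<le> (SUP n. P l c (f n) y)"
proof -
  let ?Z = "zpath c 0 (\<lambda>_. y)"
  let ?r = "\<lambda>\<omega>. rwd c (1 / 2^l) (alive (?Z \<omega>))" and ?x = "ennreal (exp (- (q * (1 / 2^l))))"
  let ?h = "\<lambda>n \<omega>. if alive (?Z \<omega>) (1 / 2^l) then f n (?Z \<omega> (1 / 2^l)) else 0"
  have Y: "(\<lambda>_. y) \<in> borel_measurable (F 0)" by simp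
  have rm[measurable]: "?r \<in> borel_measurable M"
    by (rule P_integrand_measurable(1)[OF c f fneg fB B _ Y]) auto
  have hm[measurable]: "?h n \<in> borel_measurable M" for n
    by (rule P_integrand_measurable(2)[OF c f fneg fB B _ Y]) auto
  have "P l c (\<lambda>y. SUP n. f n y) y = (\<integral>\<^sup>+\<omega>. ?r \<omega> + ?x * (if alive (?Z \<omega>) (1 / 2^l) then (SUP n. f n (?Z \<omega> (1 / 2^l))) else 0) \<partial>M)"
  proof (rule P_point[OF c _ _ _ B])
    show "(\<lambda>y. SUP n. f n y) \<in> borel_measurable borel" using f by measurable
  qed (auto simp: fneg intro!: SUP_least fB)
  also have "\<dots> = (\<integral>\<^sup>+\<omega>. (SUP n. ?r \<omega> + ?x * ?h n \<omega>) \<partial>M)"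
  proof (rule nn_integral_cong)
    fix \<omega>
    have "(if alive (?Z \<omega>) (1 / 2^l) then (SUP n. f n (?Z \<omega> (1 / 2^l))) else 0) = (SUP n. ?h n \<omega>)" by auto
    then show "?r \<omega> + ?x * (if alive (?Z \<omega>) (1 / 2^l) then (SUP n. f n (?Z \<omega> (1 / 2^l))) else 0) = (SUP n. ?r \<omega> + ?x * ?h n \<omega>)"
      by (simp add: SUP_mult_left_ennreal ennreal_SUP_add_right)
  qed
  also have "\<dots> = (SUP n. \<integral>\<^sup>+\<omega>. ?r \<omega> + ?x * ?h n \<omega> \<partial>M)"
    by (rule nn_integral_monotone_convergence_SUP)
      (measurable, use inc in \<open>auto simp: incseq_def le_fun_def intro!: add_left_mono mult_left_mono\<close>)
  also have "\<dots> = (SUP n. P l c (f n) y)"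
    using P_point[OF c f fneg fB B] by simp
  finally show ?thesis by simp
qed

end

section \<open>Controls that are constant on grid intervals\<close>

lemma dyadics_dense: fixes a b :: real assumes "0 \<le> a" "a < b" shows "\<exists>r\<in>dyadics. a < r \<and> r < b"
proof -
  obtain n where n: "(1/2::real)^n < b - a" using real_arch_pow_inv[of "b - a" "1/2"] assms by auto
  then have n': "1 / 2^n < b - a" by (simp add: power_divide)
  define i where "i = nat \<lfloor>a * 2^n\<rfloor> + 1"
  have fl: "0 \<le> \<lfloor>a * 2^n\<rfloor>" using assms by simp
  have i: "real i = of_int \<lfloor>a * 2^n\<rfloor> + 1" unfolding i_def using fl by simp
  have "a * 2^n < real i" "real i \<le> a * 2^n + 1" unfolding i by linarith+
  then have "a < real i / 2^n" "real i / 2^n \<le> a + 1 / 2^n" by (auto simp: field_simps)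
  moreover have "real i / 2^n \<in> dyadics" by (auto simp: dyadics_def)
  ultimately show ?thesis using n' by (intro bexI[of _ "real i / 2^n"]) auto
qed

text \<open>A continuous path that is negative at \<open>t\<close> is negative at some dyadic time
  shortly after \<open>t\<close>. The ruin time itself is exempt, as the path may still be
  nonnegative there; being a single point, it does not affect integrals over time.\<close>

lemma ruin_time_iff_alive:
  fixes y :: "real \<Rightarrow> 'b \<Rightarrow> real"
  assumes cont: "continuous_on {0..} (\<lambda>t. y t \<omega>)" and s: "0 \<le> s" "ereal s \<noteq> ruin_time y \<omega>"
  shows "ereal s < ruin_time y \<omega> \<longleftrightarrow> alive (\<lambda>t. y t \<omega>) s"
proof
  assume a: "ereal s < ruin_time y \<omega>"
  show "alive (\<lambda>t. y t \<omega>) s" unfolding alive_def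
  proof (intro ballI impI, rule ccontr)
    fix r assume r: "r \<in> dyadics" "r \<le> s" and "\<not> 0 \<le> y r \<omega>"
    then have "ruin_time y \<omega> \<le> ereal r"
      unfolding ruin_time_def using dyadics_nonneg[OF r(1)] by (intro Inf_lower) auto
    then have "ereal s < ereal r" using a by (rule less_le_trans[rotated])
    then show False using r by simp
  qed
next
  assume a: "alive (\<lambda>t. y t \<omega>) s"
  have "ereal s \<le> ruin_time y \<omega>"
    unfolding ruin_time_def
  proof (intro Inf_greatest, safe)
    fix t assume t: "0 \<le> t" "y t \<omega> < 0"
    show "ereal s \<le> ereal t"
    proof (rule ccontr)
      assume "\<not> ereal s \<le> ereal t"
      then have ts: "t < s" by simp
      have "continuous (at t within {0..}) (\<lambda>t. y t \<omega>)" using cont t by (simp add: continuous_on_eq_continuous_within)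
      then obtain d where d: "d > 0" "\<And>r. r \<ge> 0 \<Longrightarrow> \<bar>r - t\<bar> < d \<Longrightarrow> \<bar>y r \<omega> - y t \<omega>\<bar> < - y t \<omega>"
        using t unfolding continuous_within_eps_delta dist_real_def by (metis atLeast_iff neg_0_less_iff_less)
      obtain r where r: "r \<in> dyadics" "t < r" "r < min s (t + d)"
        using dyadics_dense[of t "min s (t + d)"] t ts d by auto
      then have "y r \<omega> < 0" using d(2)[of r] t by auto
      moreover have "0 \<le> y r \<omega>" using a r unfolding alive_def by auto
      ultimately show False by simp
    qed
  qed
  then show "ereal s < ruin_time y \<omega>" using s(2) by simp
qed

locale div_model = bm_model M W \<mu> \<sigma> q x for M :: "'a measure" and W \<mu> \<sigma> q x +
  fixes S :: "real set"
  assumes S_finite: "finite S" and S_nonneg: "\<And>c. c \<in> S \<Longrightarrow> 0 \<le> c"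
begin

definition grid :: "nat \<Rightarrow> (real \<Rightarrow> 'a \<Rightarrow> real) \<Rightarrow> bool" where
  "grid l C \<longleftrightarrow> (\<forall>t\<ge>0. \<forall>\<omega>\<in>space M. C t \<omega> = C (real (nat \<lfloor>t * 2^l\<rfloor>) * (1 / 2^l)) \<omega>)"

lemma S_le_Max: "c \<in> S \<Longrightarrow> c \<le> Max S" using S_finite by simp

lemma control_integrable:
  assumes C: "C \<in> controls M X S c0" and \<omega>: "\<omega> \<in> space M"
  shows "set_integrable lborel {0..b} (\<lambda>s. C s \<omega>)"
proof -
  have mono: "mono_on {0..} (\<lambda>t. C t \<omega>)" and inS: "\<And>t. 0 \<le> t \<Longrightarrow> C t \<omega> \<in> S"
    using C \<omega> unfolding controls_def by auto
  have "mono_on {0..b} (\<lambda>t. C t \<omega>)" using mono by (auto simp: mono_on_def)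
  then have "(\<lambda>t. C t \<omega>) \<in> borel_measurable (restrict_space borel {0..b})" by (rule borel_measurable_mono_on_fnc)
  then have "(\<lambda>t. indicator {0..b} t *\<^sub>R C t \<omega>) \<in> borel_measurable borel"
    by (subst (asm) borel_measurable_restrict_space_iff) auto
  then have m: "set_borel_measurable lborel {0..b} (\<lambda>t. C t \<omega>)" by (simp add: set_borel_measurable_def)
  have bd: "norm (C t \<omega>) \<le> norm (Max S)" if "t \<in> {0..b}" for t
    using inS[of t] S_nonneg[of "C t \<omega>"] S_le_Max[of "C t \<omega>"] that by auto
  have i: "set_integrable lborel {0..b} (\<lambda>_. Max S)"
    by (rule borel_integrable_atLeastAtMost') (intro continuous_intros)
  show ?thesis
    by (rule set_integrable_bound[OF i m]) (use bd in blast)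
qed

lemma Xctrl_eq:
  assumes C: "C \<in> controls M X S c0" and \<omega>: "\<omega> \<in> space M"
  shows "Xctrl X C t \<omega> = X t \<omega> - integral {0..t} (\<lambda>s. C s \<omega>)" "(\<lambda>s. C s \<omega>) integrable_on {0..t}"
  using set_borel_integral_eq_integral[OF control_integrable[OF C \<omega>, of t]] unfolding Xctrl_def by auto

lemma Xctrl_continuous:
  assumes C: "C \<in> controls M X S c0" and \<omega>: "\<omega> \<in> space M" and W: "continuous_on {0..} (\<lambda>t. W t \<omega>)"
  shows "continuous_on {0..} (\<lambda>t. Xctrl X C t \<omega>)"
proof (rule continuous_on_eq_continuous_within[THEN iffD2, rule_format])
  fix t :: real assume t: "t \<in> {0..}"
  have "continuous_on {0..t+1} (\<lambda>t. integral {0..t} (\<lambda>s. C s \<omega>))"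
    by (rule indefinite_integral_continuous_1) (rule Xctrl_eq(2)[OF C \<omega>])
  then have "continuous_on {0..t+1} (\<lambda>t. Xctrl X C t \<omega>)"
    unfolding Xctrl_eq(1)[OF C \<omega>] Xproc_def
    by (intro continuous_intros continuous_on_subset[OF W]) auto
  then have "continuous (at t within {0..t+1}) (\<lambda>t. Xctrl X C t \<omega>)" using t by (simp add: continuous_on_eq_continuous_within)
  moreover have "at t within {0..t+1} = at t within {0..}"
    by (rule at_within_nhd[of _ "{..<t+1}"]) auto
  ultimately show "continuous (at t within {0..}) (\<lambda>t. Xctrl X C t \<omega>)" by simp
qed

lemma floor_grid:
  assumes "real k * (1 / 2^l) \<le> t" "t < real (Suc k) * (1 / 2^l)"
  shows "nat \<lfloor>t * 2^l\<rfloor> = k"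
proof -
  have "real k \<le> t * 2^l" "t * 2^l < real k + 1" using assms by (auto simp: field_simps)
  then have "\<lfloor>t * 2^l\<rfloor> = int k" by (intro floor_unique) auto
  then show ?thesis by simp
qed

lemma grid_const:
  assumes "grid l C" "\<omega> \<in> space M" "real k * (1 / 2^l) \<le> t" "t < real (Suc k) * (1 / 2^l)"
  shows "C t \<omega> = C (real k * (1 / 2^l)) \<omega>"
proof -
  have "0 \<le> t" by (rule order_trans[OF _ assms(3)]) simp
  then have "C t \<omega> = C (real (nat \<lfloor>t * 2^l\<rfloor>) * (1 / 2^l)) \<omega>" using assms unfolding grid_def by blast
  then show ?thesis unfolding floor_grid[OF assms(3,4)] .
qed

lemma Xctrl_step:
  assumes C: "C \<in> controls M X S c0" and g: "grid l C" and \<omega>: "\<omega> \<in> space M" and s: "0 \<le> s" "s \<le> 1 / 2^l"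
  shows "Xctrl X C (real k * (1 / 2^l) + s) \<omega>
    = zpath (C (real k * (1 / 2^l)) \<omega>) (real k * (1 / 2^l)) (\<lambda>\<omega>. Xctrl X C (real k * (1 / 2^l)) \<omega>) \<omega> s"
proof -
  let ?a = "real k * (1 / 2^l)"
  have "integral {0..?a} (\<lambda>s. C s \<omega>) + integral {?a..?a+s} (\<lambda>s. C s \<omega>) = integral {0..?a+s} (\<lambda>s. C s \<omega>)"
    by (rule Henstock_Kurzweil_Integration.integral_combine) (use s Xctrl_eq(2)[OF C \<omega>] in auto)
  moreover have "integral {?a..?a+s} (\<lambda>s. C s \<omega>) = integral {?a..?a+s} (\<lambda>_. C ?a \<omega>)"
  \<comment> \<open>The rate may jump at the right end of the interval, when \<open>s\<close> is the
    full period length.\<close>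
  proof (rule integral_spike[of "{?a+s}"])
    fix r assume r: "r \<in> {?a..?a+s} - {?a+s}"
    then have "r < ?a + 1 / 2^l" using s by auto
    then have "r < real (Suc k) * (1 / 2^l)" by (simp add: algebra_simps add_divide_distrib)
    then show "C ?a \<omega> = C r \<omega>" using grid_const[OF g \<omega>, of k r] r by simp
  qed auto
  ultimately have "integral {0..?a+s} (\<lambda>s. C s \<omega>) = integral {0..?a} (\<lambda>s. C s \<omega>) + C ?a \<omega> * s"
    using s by (simp add: mult.commute)
  then show ?thesis unfolding Xctrl_eq(1)[OF C \<omega>] zpath_def Xproc_def by (simp add: algebra_simps)
qed

lemma control_F_measurable:
  "C \<in> controls M X S c0 \<Longrightarrow> 0 \<le> t \<Longrightarrow> C t \<in> borel_measurable (F t)"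
  unfolding controls_def F_def by auto

lemma Xctrl_zero: assumes "C \<in> controls M X S c0" "\<omega> \<in> space M" shows "Xctrl X C 0 \<omega> = X 0 \<omega>"
  unfolding Xctrl_eq(1)[OF assms] by simp

text \<open>With the rate constant on each period, adaptedness of the surplus follows period by
  period. Grid controls suffice here because arbitrary controls are reached by approximation
  only.\<close>

lemma Xctrl_grid_measurable:
  assumes C: "C \<in> controls M X S c0" and g: "grid l C"
  shows "Xctrl X C (real k * (1 / 2^l)) \<in> borel_measurable (F (real k * (1 / 2^l)))"
proof (induction k)
  case 0
  have "X 0 \<in> borel_measurable (F 0)" by (rule X_F_measurable) auto
  then show ?case using Xctrl_zero[OF C] by (subst measurable_cong[where g = "X 0"]) auto
next
  case (Suc k)
  let ?a = "real k * (1 / 2^l)"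
  have a1: "real (Suc k) * (1 / 2^l) = ?a + 1 / 2^l" by (simp add: algebra_simps add_divide_distrib)
  have [measurable]: "Xctrl X C ?a \<in> borel_measurable (F (?a + 1 / 2^l))" "C ?a \<in> borel_measurable (F (?a + 1 / 2^l))"
    "W ?a \<in> borel_measurable (F (?a + 1 / 2^l))" "W (?a + 1 / 2^l) \<in> borel_measurable (F (?a + 1 / 2^l))"
    by (rule F_measurable_mono[OF Suc] F_measurable_mono[OF control_F_measurable[OF C]] W_F_measurable; simp)+
  have "(\<lambda>\<omega>. zpath (C ?a \<omega>) ?a (\<lambda>\<omega>. Xctrl X C ?a \<omega>) \<omega> (1 / 2^l)) \<in> borel_measurable (F (?a + 1 / 2^l))"
    unfolding zpath_def by measurable
  then show ?case unfolding a1
    by (subst measurable_cong[OF Xctrl_step[OF C g]]) auto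
qed

lemma Xctrl_F_measurable:
  assumes C: "C \<in> controls M X S c0" and g: "grid l C" and t: "0 \<le> t"
  shows "Xctrl X C t \<in> borel_measurable (F t)"
proof -
  define k where "k = nat \<lfloor>t * 2^l\<rfloor>"
  let ?a = "real k * (1 / 2^l)"
  define s where "s = t - ?a"
  have "0 \<le> t * 2^l" using t by simp
  then have "real k \<le> t * 2^l" "t * 2^l < real k + 1" unfolding k_def by linarith+
  then have "?a \<le> t" "t < ?a + 1 / 2^l" by (auto simp: field_simps)
  then have s: "0 \<le> s" "s \<le> 1 / 2^l" unfolding s_def by linarith+
  have ts: "t = ?a + s" by (simp add: s_def)
  have a0: "0 \<le> ?a" by simp
  have [measurable]: "Xctrl X C ?a \<in> borel_measurable (F (?a + s))" "C ?a \<in> borel_measurable (F (?a + s))"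
    "W ?a \<in> borel_measurable (F (?a + s))" "W (?a + s) \<in> borel_measurable (F (?a + s))"
    by (rule F_measurable_mono[OF Xctrl_grid_measurable[OF C g]] F_measurable_mono[OF control_F_measurable[OF C a0]] W_F_measurable; use s in simp)+
  have "(\<lambda>\<omega>. zpath (C ?a \<omega>) ?a (\<lambda>\<omega>. Xctrl X C ?a \<omega>) \<omega> s) \<in> borel_measurable (F (?a + s))"
    unfolding zpath_def by measurable
  then show ?thesis unfolding ts
    by (subst measurable_cong[OF Xctrl_step[OF C g _ s]]) auto
qed

lemma alive_F_sets:
  assumes C: "C \<in> controls M X S c0" and g: "grid l C"
  shows "{\<omega> \<in> space M. alive (\<lambda>r. Xctrl X C r \<omega>) t} \<in> sets (F t)"
proof -
  have "{\<omega> \<in> space (F t). \<forall>r\<in>{r\<in>dyadics. r \<le> t}. 0 \<le> Xctrl X C r \<omega>} \<in> sets (F t)"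
  proof (rule sets.sets_Collect_countable_All'[rotated])
    show "countable {r\<in>dyadics. r \<le> t}" using countable_dyadics by (rule countable_subset[rotated]) auto
    fix r assume r: "r \<in> {r\<in>dyadics. r \<le> t}"
    have [measurable]: "Xctrl X C r \<in> borel_measurable (F t)"
      using r dyadics_nonneg by (intro F_measurable_mono[OF Xctrl_F_measurable[OF C g]]) auto
    show "{\<omega> \<in> space (F t). 0 \<le> Xctrl X C r \<omega>} \<in> sets (F t)" by measurable
  qed
  moreover have "{\<omega> \<in> space (F t). \<forall>r\<in>{r\<in>dyadics. r \<le> t}. 0 \<le> Xctrl X C r \<omega>} = {\<omega> \<in> space M. alive (\<lambda>r. Xctrl X C r \<omega>) t}"
    by (auto simp: alive_def)
  ultimately show ?thesis by simp
qed

lemma grid_point_dyadic: "real k * (1 / 2^l) \<in> dyadics"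
  unfolding dyadics_def by (rule CollectI, rule exI[of _ k], rule exI[of _ l]) simp

text \<open>Discounted to the beginning of period \<open>k\<close>, not to time 0.\<close>

definition Trew :: "nat \<Rightarrow> (real \<Rightarrow> 'a \<Rightarrow> real) \<Rightarrow> nat \<Rightarrow> 'a \<Rightarrow> ennreal" where
  "Trew l C k \<omega> = rwd (C (real k * (1 / 2^l)) \<omega>) (1 / 2^l) (\<lambda>s. alive (\<lambda>r. Xctrl X C r \<omega>) (real k * (1 / 2^l) + s))"

text \<open>The rate at a grid time takes finitely many values and is known at that time. Survival
  therefore splits into finitely many events \<open>A c\<close> of \<open>F t\<close>, on each of
  which the rate is constant and \<open>P_rep\<close> applies.\<close>

lemma P_chain_step:
  assumes C: "C \<in> controls M X S c0" and g: "grid l C"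
    and f: "\<And>c. c \<in> S \<Longrightarrow> f c \<in> borel_measurable borel" and fneg: "\<And>c y. c \<in> S \<Longrightarrow> y < 0 \<Longrightarrow> f c y = 0"
    and fB: "\<And>c y. c \<in> S \<Longrightarrow> f c y \<le> ennreal B" and B: "0 \<le> B"
  shows "Trew l C k \<in> borel_measurable M" 
   and "(\<integral>\<^sup>+\<omega>. (if alive (\<lambda>r. Xctrl X C r \<omega>) (real k * (1 / 2^l))
        then P l (C (real k * (1 / 2^l)) \<omega>) (f (C (real k * (1 / 2^l)) \<omega>)) (Xctrl X C (real k * (1 / 2^l)) \<omega>) else 0) \<partial>M)
     = (\<integral>\<^sup>+\<omega>. Trew l C k \<omega> \<partial>M)
       + ennreal (exp (- (q * (1 / 2^l)))) * (\<integral>\<^sup>+\<omega>. (if alive (\<lambda>r. Xctrl X C r \<omega>) (real (Suc k) * (1 / 2^l))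
        then f (C (real k * (1 / 2^l)) \<omega>) (Xctrl X C (real (Suc k) * (1 / 2^l)) \<omega>) else 0) \<partial>M)" (is "?L = ?R")
proof -
  let ?d = "1 / 2^l :: real"
  define t where "t = real k * ?d"
  have t0: "0 \<le> t" by (simp add: t_def)
  have t1: "real (Suc k) * ?d = t + ?d" by (simp add: t_def algebra_simps add_divide_distrib)
  have td: "t \<in> dyadics" unfolding t_def by (rule grid_point_dyadic)
  define Y where "Y = Xctrl X C t"
  have Y: "Y \<in> borel_measurable (F t)" unfolding Y_def by (rule Xctrl_F_measurable[OF C g t0])
  define al where "al s \<omega> \<longleftrightarrow> alive (\<lambda>r. Xctrl X C r \<omega>) s" for s \<omega>
  define A where "A c = {\<omega> \<in> space M. al t \<omega> \<and> C t \<omega> = c}" for c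
  have AF: "A c \<in> sets (F t)" for c
  proof -
    have [measurable]: "C t \<in> borel_measurable (F t)" by (rule control_F_measurable[OF C t0])
    have "{\<omega> \<in> space (F t). C t \<omega> = c} \<in> sets (F t)" by measurable
    moreover have "A c = {\<omega> \<in> space M. al t \<omega>} \<inter> {\<omega> \<in> space (F t). C t \<omega> = c}" by (auto simp: A_def)
    ultimately show ?thesis using alive_F_sets[OF C g, of t] unfolding al_def by auto
  qed
  have AM[measurable]: "A c \<in> sets M" for c using AF subalgebra_F unfolding subalgebra_def by auto
  have CS: "C t \<omega> \<in> S" if "\<omega> \<in> space M" for \<omega> using C that t0 unfolding controls_def by auto
  have Z: "zpath c t Y \<omega> s = Xctrl X C (t + s) \<omega>" if "\<omega> \<in> A c" "0 \<le> s" "s \<le> ?d" for c \<omega> s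
    using Xctrl_step[OF C g _ that(2,3), of \<omega> k] that(1) unfolding A_def t_def[symmetric] Y_def by (simp add: eta_contract_eq zpath_def)
  have alZ: "alive (zpath c t Y \<omega>) s \<longleftrightarrow> al (t + s) \<omega>" if "\<omega> \<in> A c" "0 \<le> s" "s \<le> ?d" for c \<omega> s
  proof -
    have "alive (zpath c t Y \<omega>) s \<longleftrightarrow> alive (\<lambda>r. Xctrl X C (t + r) \<omega>) s"
      unfolding alive_def using Z[OF that(1)] that dyadics_nonneg by auto
    also have "\<dots> \<longleftrightarrow> al (t + s) \<omega>"
      unfolding al_def alive_add[OF td that(2)] using that(1) unfolding A_def al_def by auto
    finally show ?thesis .
  qed
  have sum1: "(\<Sum>c\<in>S. indicator (A c) \<omega> * h c) = (if al t \<omega> then h (C t \<omega>) else 0)" if "\<omega> \<in> space M" for \<omega> and h :: "real \<Rightarrow> ennreal"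
  proof -
    have "(\<Sum>c\<in>S. indicator (A c) \<omega> * h c) = (\<Sum>c\<in>S. if c = C t \<omega> then (if al t \<omega> then h (C t \<omega>) else 0) else 0)"
      using that by (intro sum.cong) (auto simp: A_def indicator_def)
    also have "\<dots> = (if al t \<omega> then h (C t \<omega>) else 0)" using S_finite CS[OF that] by (simp add: sum.delta)
    finally show ?thesis .
  qed
  have neg: "\<not> al (t + s) \<omega>" if "\<not> al t \<omega>" "0 \<le> s" for s \<omega>
    using that unfolding al_def alive_add[OF td that(2)] by blast
  let ?r = "\<lambda>c \<omega>. rwd c ?d (alive (zpath c t Y \<omega>))"
  let ?h = "\<lambda>c \<omega>. if alive (zpath c t Y \<omega>) ?d then f c (zpath c t Y \<omega> ?d) else 0"
  let ?x = "ennreal (exp (- (q * ?d)))"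
  have rm: "?r c \<in> borel_measurable M" and hm: "?h c \<in> borel_measurable M" if "c \<in> S" for c
    using P_integrand_measurable[OF S_nonneg f fneg fB B t0 Y] that by auto
  have Tr: "Trew l C k \<omega> = (\<Sum>c\<in>S. indicator (A c) \<omega> * ?r c \<omega>)" if w: "\<omega> \<in> space M" for \<omega>
  proof (cases "al t \<omega>")
    case True
    then have "\<omega> \<in> A (C t \<omega>)" using w by (simp add: A_def)
    then have "?r (C t \<omega>) \<omega> = Trew l C k \<omega>"
      unfolding Trew_def t_def[symmetric] al_def[symmetric] rwd_def using alZ
      by (intro nn_integral_cong) auto
    then show ?thesis using True unfolding sum1[OF w] by simp
  next
    case False
    then have "Trew l C k \<omega> = rwd (C t \<omega>) ?d (\<lambda>s. 0 \<le> s \<and> False)"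
      unfolding Trew_def t_def[symmetric] al_def[symmetric] rwd_def using neg
      by (intro nn_integral_cong) auto
    also have "\<dots> = 0" by (simp add: rwd_def)
    finally show ?thesis using False unfolding sum1[OF w] by simp
  qed
  show Tm: "Trew l C k \<in> borel_measurable M"
    by (subst measurable_cong[OF Tr]) (auto intro!: borel_measurable_sum borel_measurable_times_ennreal rm)
  have h2: "(if al (t + ?d) \<omega> then f (C t \<omega>) (Xctrl X C (t + ?d) \<omega>) else 0) = (\<Sum>c\<in>S. indicator (A c) \<omega> * ?h c \<omega>)"
    if w: "\<omega> \<in> space M" for \<omega>
  proof (cases "al t \<omega>")
    case True
    then have "\<omega> \<in> A (C t \<omega>)" using w by (simp add: A_def)
    then show ?thesis using True unfolding sum1[OF w] by (simp add: alZ Z)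
  next
    case False
    then show ?thesis unfolding sum1[OF w] using neg[of \<omega> ?d] by simp
  qed
  have "?L = (\<integral>\<^sup>+\<omega>. (\<Sum>c\<in>S. indicator (A c) \<omega> * P l c (f c) (Y \<omega>)) \<partial>M)"
    unfolding t_def[symmetric] al_def[symmetric] by (intro nn_integral_cong) (simp add: sum1 Y_def)
  also have "\<dots> = (\<Sum>c\<in>S. \<integral>\<^sup>+\<omega>. indicator (A c) \<omega> * P l c (f c) (Y \<omega>) \<partial>M)"
  proof (rule nn_integral_sum)
    fix c assume "c \<in> S"
    then have [measurable]: "P l c (f c) \<in> borel_measurable borel" "Y \<in> borel_measurable M"
      using f F_measurable_M[OF Y] by (auto intro: P_measurable)
    show "(\<lambda>\<omega>. indicator (A c) \<omega> * P l c (f c) (Y \<omega>)) \<in> borel_measurable M" by measurable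
  qed
  also have "\<dots> = (\<Sum>c\<in>S. \<integral>\<^sup>+\<omega>. indicator (A c) \<omega> * (?r c \<omega> + ?x * ?h c \<omega>) \<partial>M)"
    by (intro sum.cong refl P_rep[OF S_nonneg f fneg fB B t0 AF Y])
  also have "\<dots> = (\<integral>\<^sup>+\<omega>. (\<Sum>c\<in>S. indicator (A c) \<omega> * (?r c \<omega> + ?x * ?h c \<omega>)) \<partial>M)"
    by (rule nn_integral_sum[symmetric]) (use rm hm in \<open>auto intro!: borel_measurable_times_ennreal borel_measurable_add\<close>)
  also have "\<dots> = (\<integral>\<^sup>+\<omega>. Trew l C k \<omega> + ?x * (if al (t + ?d) \<omega> then f (C t \<omega>) (Xctrl X C (t + ?d) \<omega>) else 0) \<partial>M)"
    by (intro nn_integral_cong) (simp add: Tr h2 distrib_left sum.distrib sum_distrib_left mult.left_commute)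
  also have "\<dots> = (\<integral>\<^sup>+\<omega>. Trew l C k \<omega> \<partial>M) + ?x * (\<integral>\<^sup>+\<omega>. (if al (t + ?d) \<omega> then f (C t \<omega>) (Xctrl X C (t + ?d) \<omega>) else 0) \<partial>M)"
  proof -
    have m: "(\<lambda>\<omega>. if al (t + ?d) \<omega> then f (C t \<omega>) (Xctrl X C (t + ?d) \<omega>) else 0) \<in> borel_measurable M"
      by (subst measurable_cong[OF h2]) (use hm in \<open>auto intro!: borel_measurable_sum borel_measurable_times_ennreal\<close>)
    show ?thesis using Tm m by (subst nn_integral_add) (auto simp: nn_integral_cmult)
  qed
  finally show "?L = ?R" unfolding t1 al_def t_def .
qed

lemma Trew_measurable: "C \<in> controls M X S c0 \<Longrightarrow> grid l C \<Longrightarrow> Trew l C k \<in> borel_measurable M"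
  by (rule P_chain_step(1)[where f = "\<lambda>_ _. 0" and B = 0]) auto

text \<open>Each time lies in exactly one grid period, where the rate is constant; shifting time to
  the start of the period pulls out the discount factor of the earlier ones. The ruin time is
  discarded as a null set.\<close>

lemma Jinner_grid:
  assumes C: "C \<in> controls M X S c0" and g: "grid l C"
  shows "AE \<omega> in M. (\<integral>\<^sup>+ s. ennreal (exp (- q * s) * C s \<omega> * indicator {s. 0 \<le> s \<and> ereal s < ruin_time (Xctrl X C) \<omega>} s) \<partial>lborel)
    = (\<Sum>k. ennreal (exp (- (q * (1 / 2^l)))) ^ k * Trew l C k \<omega>)"
proof -
  let ?d = "1 / 2^l :: real"
  let ?x = "ennreal (exp (- (q * ?d)))"
  have inner: "(\<integral>\<^sup>+ s. ennreal (exp (- q * s) * C s \<omega> * indicator {s. 0 \<le> s \<and> ereal s < ruin_time (Xctrl X C) \<omega>} s) \<partial>lborel)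
     = (\<Sum>k. ?x ^ k * Trew l C k \<omega>)" if w: "\<omega> \<in> space M" and W: "continuous_on {0..} (\<lambda>t. W t \<omega>)" for \<omega>
  proof -
    let ?al = "alive (\<lambda>r. Xctrl X C r \<omega>)"
    have cont: "continuous_on {0..} (\<lambda>t. Xctrl X C t \<omega>)" by (rule Xctrl_continuous[OF C w W])
    let ?D = "\<lambda>k s. ennreal (exp (- (q * s)) * C (real k * ?d) \<omega>) * (if real k * ?d \<le> s \<and> s < real (Suc k) * ?d \<and> ?al s then 1 else 0)"
    have "(\<integral>\<^sup>+ s. ennreal (exp (- q * s) * C s \<omega> * indicator {s. 0 \<le> s \<and> ereal s < ruin_time (Xctrl X C) \<omega>} s) \<partial>lborel)
      = (\<integral>\<^sup>+ s. (\<Sum>k. ?D k s) \<partial>lborel)"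
    proof (rule nn_integral_cong_AE)
      show "AE s in lborel. ennreal (exp (- q * s) * C s \<omega> * indicator {s. 0 \<le> s \<and> ereal s < ruin_time (Xctrl X C) \<omega>} s) = (\<Sum>k. ?D k s)"
        using AE_lborel_singleton[of "real_of_ereal (ruin_time (Xctrl X C) \<omega>)"]
      proof eventually_elim
        case (elim s)
        then have ne: "ereal s \<noteq> ruin_time (Xctrl X C) \<omega>" by (metis real_of_ereal.simps(1))
        show ?case
        proof (cases "0 \<le> s")
          case True
          define k where "k = nat \<lfloor>s * 2^l\<rfloor>"
          have "0 \<le> s * 2^l" using True by simp
          then have "real k \<le> s * 2^l" "s * 2^l < real k + 1" unfolding k_def by linarith+
          then have ks: "real k * ?d \<le> s" "s < real (Suc k) * ?d" by (auto simp: field_simps)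
          have "?D j s = 0" if "j \<noteq> k" for j
          proof -
            have "\<not> (real j * ?d \<le> s \<and> s < real (Suc j) * ?d)"
              using floor_grid[of j l s] floor_grid[OF ks] that by metis
            then show ?thesis by auto
          qed
          then have "(\<Sum>j. ?D j s) = ?D k s" by (subst suminf_finite[of "{k}"]) auto
          also have "\<dots> = ennreal (exp (- (q * s)) * C s \<omega>) * (if ?al s then 1 else 0)"
            using ks grid_const[OF g w ks] by simp
          finally show ?thesis using ruin_time_iff_alive[OF cont True ne] True by (auto simp: indicator_def)
        next
          case False
          have "?D j s = 0" for j
          proof -
            have "0 \<le> real j * ?d" by simp
            then have "\<not> real j * ?d \<le> s" using False by linarith
            then show ?thesis by simp
          qed
          then have "(\<Sum>j. ?D j s) = 0" by (simp only: suminf_zero)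
          then show ?thesis using False by simp
        qed
      qed
    qed
    also have "\<dots> = (\<Sum>k. \<integral>\<^sup>+ s. ?D k s \<partial>lborel)" by (rule nn_integral_suminf) measurable
    also have "\<dots> = (\<Sum>k. ?x ^ k * Trew l C k \<omega>)"
    proof (rule suminf_cong)
      fix k
      have C0: "0 \<le> C (real k * ?d) \<omega>" using C w S_nonneg unfolding controls_def by auto
      have e: "ennreal (exp (- (q * (real k * ?d + 1 * s))) * C (real k * ?d) \<omega>) = ?x ^ k * ennreal (exp (- (q * s)) * C (real k * ?d) \<omega>)" for s
      proof -
        have e2: "exp (- (q * (real k * ?d + 1 * s))) * C (real k * ?d) \<omega> = exp (- (q * ?d)) ^ k * (exp (- (q * s)) * C (real k * ?d) \<omega>)"
          by (simp add: exp_of_nat_mult[symmetric] exp_add[symmetric] algebra_simps)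
        have "ennreal (exp (- (q * ?d)) ^ k * (exp (- (q * s)) * C (real k * ?d) \<omega>))
          = ennreal (exp (- (q * ?d)) ^ k) * ennreal (exp (- (q * s)) * C (real k * ?d) \<omega>)"
          by (rule ennreal_mult) (use C0 in auto)
        then show ?thesis unfolding e2 by (simp only: ennreal_power exp_ge_zero)
      qed
      have "(\<integral>\<^sup>+ s. ?D k s \<partial>lborel) = (\<integral>\<^sup>+ s. ?D k (real k * ?d + 1 * s) \<partial>lborel)"
        by (subst nn_integral_real_affine[where c = 1 and t = "real k * ?d"]) auto
      also have "\<dots> = (\<integral>\<^sup>+ s. ?x ^ k * (ennreal (exp (- (q * s)) * C (real k * ?d) \<omega>) * (if 0 \<le> s \<and> s < ?d \<and> ?al (real k * ?d + s) then 1 else 0)) \<partial>lborel)"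
        unfolding e by (intro nn_integral_cong) (auto simp: algebra_simps add_divide_distrib)
      also have "\<dots> = ?x ^ k * Trew l C k \<omega>"
        unfolding Trew_def rwd_def by (rule nn_integral_cmult) measurable
      finally show "(\<integral>\<^sup>+ s. ?D k s \<partial>lborel) = ?x ^ k * Trew l C k \<omega>" .
    qed
    finally show ?thesis .
  qed
  show ?thesis using W_cont inner by auto
qed

lemma Jfun_grid:
  assumes C: "C \<in> controls M X S c0" and g: "grid l C"
  shows "Jfun M q X C = (\<Sum>k. ennreal (exp (- (q * (1 / 2^l)))) ^ k * (\<integral>\<^sup>+\<omega>. Trew l C k \<omega> \<partial>M))"
proof -
  let ?x = "ennreal (exp (- (q * (1 / 2^l))))"
  have "Jfun M q X C = (\<integral>\<^sup>+\<omega>. (\<Sum>k. ?x ^ k * Trew l C k \<omega>) \<partial>M)"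
    unfolding Jfun_def by (rule nn_integral_cong_AE[OF Jinner_grid[OF C g]])
  also have "\<dots> = (\<Sum>k. \<integral>\<^sup>+\<omega>. ?x ^ k * Trew l C k \<omega> \<partial>M)"
    by (rule nn_integral_suminf) (use Trew_measurable[OF C g] in auto)
  finally show ?thesis using Trew_measurable[OF C g] by (simp add: nn_integral_cmult)
qed

end

section \<open>Dynamic programming on the grid\<close>

context div_model begin

text \<open>\<open>w l N c y\<close> is the optimal discounted dividend over \<open>N\<close> periods of length \<open>2 ^ - l\<close> from surplus
  \<open>y\<close> and current rate \<open>c\<close>, the rate being raised only at the beginning of a period.\<close>

primrec w :: "nat \<Rightarrow> nat \<Rightarrow> real \<Rightarrow> real \<Rightarrow> ennreal" where
  "w l 0 = (\<lambda>c y. 0)"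
| "w l (Suc N) = (\<lambda>c y. SUP c'\<in>{c'\<in>S. c \<le> c'}. P l c' (w l N c') y)"

lemma w_measurable [measurable]: "w l N c \<in> borel_measurable borel"
proof (induction N arbitrary: c)
  case (Suc N)
  show ?case unfolding w.simps
    by (rule borel_measurable_SUP) (use S_finite Suc in \<open>auto intro: countable_finite P_measurable\<close>)
qed simp

lemma w_neg: "y < 0 \<Longrightarrow> w l N c y = 0"
  by (cases N) (auto simp: P_neg intro!: antisym SUP_least)

lemma bound_nonneg: assumes "S \<noteq> {}" shows "0 \<le> Max S / q"
  using S_nonneg[of "Max S"] Max_in[OF S_finite assms] q_pos by simp

lemma w_le: "w l N c y \<le> ennreal (Max S / q)"
proof (induction N arbitrary: c y)
  case (Suc N)
  show ?case unfolding w.simps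
  proof (rule SUP_least)
    fix c' assume "c' \<in> {c'\<in>S. c \<le> c'}"
    then show "P l c' (w l N c') y \<le> ennreal (Max S / q)"
      using Suc S_nonneg S_le_Max q_pos by (intro P_le_bound) auto
  qed
qed simp

lemma w_anti: "c \<le> c' \<Longrightarrow> w l N c' y \<le> w l N c y"
  by (cases N) (auto intro!: SUP_subset_mono)

lemma w_ge_P: "c \<in> S \<Longrightarrow> P l c (w l N c) y \<le> w l (Suc N) c y"
  by (auto intro!: SUP_upper)

lemma w_Suc_ge: "w l N c y \<le> w l (Suc N) c y"
proof (induction N arbitrary: c y)
  case (Suc N)
  have "P l c' (w l N c') y \<le> P l c' (w l (Suc N) c') y" for c' by (rule P_mono) (rule Suc)
  then have "(SUP c'\<in>{c'\<in>S. c \<le> c'}. P l c' (w l N c') y) \<le> (SUP c'\<in>{c'\<in>S. c \<le> c'}. P l c' (w l (Suc N) c') y)"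
    by (intro SUP_mono')
  then show ?case by (simp only: w.simps)
qed simp

lemma w_incseq: "incseq (\<lambda>N. w l N c y)"
  by (rule incseq_SucI) (rule w_Suc_ge)

lemma w_mono_point: "mono (w l N c)"
proof (induction N arbitrary: c)
  case (Suc N)
  show ?case unfolding w.simps
    by (rule monoI, rule SUP_mono') (use P_mono_point[OF Suc] in \<open>auto dest: monoD\<close>)
qed (simp add: mono_def)

lemma w_attained:
  assumes "c \<in> S"
  obtains c' where "c' \<in> S" "c \<le> c'" "w l (Suc n) c y \<le> P l c' (w l n c') y"
proof -
  let ?T = "{c'\<in>S. c \<le> c'}" and ?f = "\<lambda>c'. P l c' (w l n c') y"
  have "finite (?f ` ?T)" "?f ` ?T \<noteq> {}" using S_finite assms by auto
  then have "Max (?f ` ?T) \<in> ?f ` ?T" "\<And>z. z \<in> ?f ` ?T \<Longrightarrow> z \<le> Max (?f ` ?T)" by auto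
  then have "w l (Suc n) c y \<le> Max (?f ` ?T)" "Max (?f ` ?T) \<in> ?f ` ?T"
    unfolding w.simps by (auto intro!: SUP_least)
  then show ?thesis using that by auto
qed

text \<open>The function depends on the outcome as well as on the surplus because the continuation
  value depends on the rate in force.\<close>

definition start :: "nat \<Rightarrow> (real \<Rightarrow> 'a \<Rightarrow> real) \<Rightarrow> nat \<Rightarrow> ('a \<Rightarrow> real \<Rightarrow> ennreal) \<Rightarrow> ennreal" where
  "start l C k f = (\<integral>\<^sup>+\<omega>. (if alive (\<lambda>r. Xctrl X C r \<omega>) (real k * (1 / 2^l))
      then f \<omega> (Xctrl X C (real k * (1 / 2^l)) \<omega>) else 0) \<partial>M)"

lemma start_mono: "(\<And>\<omega> y. \<omega> \<in> space M \<Longrightarrow> f \<omega> y \<le> g \<omega> y) \<Longrightarrow> start l C k f \<le> start l C k g"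
  unfolding start_def by (intro nn_integral_mono) auto

lemma start_0:
  assumes C: "C \<in> controls M X S c0" and f: "\<And>y. y < 0 \<Longrightarrow> f y = 0"
  shows "start l C 0 (\<lambda>_. f) = f x"
proof -
  have "start l C 0 (\<lambda>_. f) = (\<integral>\<^sup>+\<omega>. f x \<partial>M)"
    unfolding start_def
  proof (rule nn_integral_cong_AE)
    have al: "alive Z 0 \<longleftrightarrow> 0 \<le> Z 0" for Z
    proof -
      have "r \<in> dyadics \<Longrightarrow> r \<le> 0 \<longleftrightarrow> r = 0" for r using dyadics_nonneg[of r] by auto
      moreover have "0 \<in> dyadics" using grid_point_dyadic[of 0 0] by simp
      ultimately show ?thesis unfolding alive_def by auto
    qed
    show "AE \<omega> in M. (if alive (\<lambda>r. Xctrl X C r \<omega>) (real 0 * (1 / 2^l)) then f (Xctrl X C (real 0 * (1 / 2^l)) \<omega>) else 0) = f x"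
      using W_cont AE_space
    proof eventually_elim
      case (elim \<omega>)
      then have "Xctrl X C 0 \<omega> = x" using Xctrl_zero[OF C, of \<omega>] by (simp add: Xproc_def)
      then show ?case using f[of x] by (auto simp: al)
    qed
  qed
  then show ?thesis by (simp add: emeasure_space_1)
qed

lemma chain_step:
  assumes C: "C \<in> controls M X S c0" and g: "grid l C"
  shows "start l C k (\<lambda>\<omega>. P l (C (real k * (1 / 2^l)) \<omega>) (w l N (C (real k * (1 / 2^l)) \<omega>)))
    = (\<integral>\<^sup>+\<omega>. Trew l C k \<omega> \<partial>M) + ennreal (exp (- (q * (1 / 2^l)))) * start l C (Suc k) (\<lambda>\<omega>. w l N (C (real k * (1 / 2^l)) \<omega>))"
proof (cases "S = {}")
  \<comment> \<open>Without admissible rates a control could exist only on an empty space. The case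
    is separated because \<open>Max S / q\<close> is a nonnegative bound only when \<open>S\<close>
    is nonempty.\<close>
  case True
  have "space M = {}" using C True unfolding controls_def by fastforce
  then show ?thesis using not_empty by simp
next
  case False
  show ?thesis unfolding start_def
    by (rule P_chain_step(2)[OF C g _ _ _ bound_nonneg[OF False]]) (auto intro: w_neg w_le)
qed

lemma control_in_S:
  assumes "C \<in> controls M X S c0" "\<omega> \<in> space M" "0 \<le> t" shows "C t \<omega> \<in> S" "c0 \<le> C t \<omega>"
  using assms unfolding controls_def by auto

lemma control_mono:
  assumes "C \<in> controls M X S c0" "\<omega> \<in> space M" "0 \<le> s" "s \<le> t" shows "C s \<omega> \<le> C t \<omega>"
proof -
  have "mono_on {0..} (\<lambda>t. C t \<omega>)" using assms unfolding controls_def by auto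
  then show ?thesis by (rule mono_onD) (use assms in auto)
qed

text \<open>No control collects more than \<open>w\<close> promises. Going back from period k + 1 to
  period k uses that the rate has not decreased, so by \<open>w_anti\<close> the continuation value
  at the new rate is at most the one at the old rate.\<close>

lemma chain_upper:
  assumes C: "C \<in> controls M X S c0" and g: "grid l C"
  shows "(\<Sum>j<N. ennreal (exp (- (q * (1 / 2^l)))) ^ j * (\<integral>\<^sup>+\<omega>. Trew l C (k + j) \<omega> \<partial>M))
     \<le> start l C k (\<lambda>\<omega>. w l N (C (real k * (1 / 2^l)) \<omega>))"
proof (induction N arbitrary: k)
  case (Suc N)
  let ?x = "ennreal (exp (- (q * (1 / 2^l))))" and ?T = "\<lambda>k. \<integral>\<^sup>+\<omega>. Trew l C k \<omega> \<partial>M"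
  let ?C = "\<lambda>k. C (real k * (1 / 2^l))"
  have "(\<Sum>j<Suc N. ?x ^ j * ?T (k + j)) = ?T k + ?x * (\<Sum>j<N. ?x ^ j * ?T (Suc k + j))"
    unfolding sum.lessThan_Suc_shift by (simp add: sum_distrib_left mult.assoc)
  also have "\<dots> \<le> ?T k + ?x * start l C (Suc k) (\<lambda>\<omega>. w l N (?C (Suc k) \<omega>))"
    by (intro add_left_mono mult_left_mono Suc) auto
  also have "\<dots> \<le> ?T k + ?x * start l C (Suc k) (\<lambda>\<omega>. w l N (?C k \<omega>))"
    by (intro add_left_mono mult_left_mono start_mono w_anti control_mono[OF C]) (auto intro!: mult_right_mono divide_right_mono)
  also have "\<dots> = start l C k (\<lambda>\<omega>. P l (?C k \<omega>) (w l N (?C k \<omega>)))"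
    by (rule chain_step[OF C g, symmetric])
  also have "\<dots> \<le> start l C k (\<lambda>\<omega>. w l (Suc N) (?C k \<omega>))"
    by (intro start_mono w_ge_P control_in_S[OF C]) auto
  finally show ?case .
qed simp

lemma Jfun_grid_le:
  assumes C: "C \<in> controls M X S c0" and g: "grid l C"
  shows "Jfun M q X C \<le> (SUP N. w l N c0 x)"
  unfolding Jfun_grid[OF C g]
proof (rule suminf_le_const)
  show "summable (\<lambda>k. ennreal (exp (- (q * (1 / 2^l)))) ^ k * (\<integral>\<^sup>+\<omega>. Trew l C k \<omega> \<partial>M))" by simp
  fix N
  have "(\<Sum>j<N. ennreal (exp (- (q * (1 / 2^l)))) ^ j * (\<integral>\<^sup>+\<omega>. Trew l C j \<omega> \<partial>M))
     \<le> start l C 0 (\<lambda>\<omega>. w l N (C (real 0 * (1 / 2^l)) \<omega>))"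
    using chain_upper[OF C g, where N = N and k = 0] by (simp only: add_0)
  also have "\<dots> \<le> start l C 0 (\<lambda>_. w l N c0)"
    by (intro start_mono w_anti control_in_S[OF C]) auto
  also have "\<dots> = w l N c0 x" by (rule start_0[OF C w_neg])
  also have "\<dots> \<le> (SUP N. w l N c0 x)" by (rule SUP_upper) simp
  finally show "(\<Sum>j<N. ennreal (exp (- (q * (1 / 2^l)))) ^ j * (\<integral>\<^sup>+\<omega>. Trew l C j \<omega> \<partial>M)) \<le> (SUP N. w l N c0 x)" .
qed

section \<open>Optimal controls on the grid\<close>

lemma step_control:
  assumes m: "\<And>k. Ck k \<in> borel_measurable (F (real k * (1 / 2^l)))"
    and S: "\<And>k \<omega>. \<omega> \<in> space M \<Longrightarrow> Ck k \<omega> \<in> S \<and> c0 \<le> Ck k \<omega> \<and> Ck k \<omega> \<le> Ck (Suc k) \<omega>"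
  defines "C \<equiv> \<lambda>t \<omega>. Ck (nat \<lfloor>t * 2^l\<rfloor>) \<omega>"
  shows "C \<in> controls M X S c0" "grid l C" "C (real k * (1 / 2^l)) = Ck k"
proof -
  have mono: "Ck i \<omega> \<le> Ck j \<omega>" if "i \<le> j" "\<omega> \<in> space M" for i j \<omega>
    using lift_Suc_mono_le[of "\<lambda>k. Ck k \<omega>" i j] S[OF that(2)] that(1) by auto
  have k: "real (nat \<lfloor>t * 2^l\<rfloor>) * (1 / 2^l) \<le> t \<and> t < real (Suc (nat \<lfloor>t * 2^l\<rfloor>)) * (1 / 2^l)" if "0 \<le> t" for t
  proof -
    have "0 \<le> t * 2^l" using that by simp
    then have "real (nat \<lfloor>t * 2^l\<rfloor>) \<le> t * 2^l" "t * 2^l < real (nat \<lfloor>t * 2^l\<rfloor>) + 1" by linarith+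
    then show ?thesis by (auto simp: field_simps)
  qed
  show eqk: "C (real k * (1 / 2^l)) = Ck k" for k
    unfolding C_def using floor_grid[of k l "real k * (1 / 2^l)"] by (simp add: fun_eq_iff divide_strict_right_mono)
  show "grid l C" unfolding grid_def eqk by (simp add: C_def)
  have rc: "continuous (at_right t) (\<lambda>s. C s \<omega>)" if "0 \<le> t" for t \<omega>
  proof -
    let ?k = "nat \<lfloor>t * 2^l\<rfloor>"
    have "eventually (\<lambda>s. C s \<omega> = C t \<omega>) (at_right t)"
      unfolding eventually_at_right[OF conjunct2[OF k[OF that]]]
    proof (intro exI[of _ "real (Suc ?k) * (1 / 2^l)"] conjI allI impI)
      show "t < real (Suc ?k) * (1 / 2^l)" using k[OF that] by blast
      fix s assume "t < s" "s < real (Suc ?k) * (1 / 2^l)"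
      then have "nat \<lfloor>s * 2^l\<rfloor> = ?k" using k[OF that] by (intro floor_grid) auto
      then show "C s \<omega> = C t \<omega>" by (simp add: C_def)
    qed
    then show ?thesis unfolding continuous_within by (rule tendsto_eventually)
  qed
  have ad: "C t \<in> borel_measurable (F t)" if "0 \<le> t" for t
    unfolding C_def using k[OF that] by (intro F_measurable_mono[OF m]) auto
  show "C \<in> controls M X S c0"
    unfolding controls_def F_def[symmetric]
  proof (intro CollectI conjI ballI allI impI)
    fix \<omega> assume "\<omega> \<in> space M"
    then show "mono_on {0..} (\<lambda>t. C t \<omega>)"
      unfolding C_def by (intro mono_onI mono nat_mono floor_mono mult_right_mono) auto
  qed (use rc ad S in \<open>auto simp: C_def\<close>)
qed

text \<open>Taking the smallest maximiser makes each sublevel set a finite union of sets where one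
  Borel function dominates another. With no period left the current rate is kept.\<close>

definition sel :: "nat \<Rightarrow> nat \<Rightarrow> real \<Rightarrow> real \<Rightarrow> real" where
  "sel l n c y = (if n = 0 then c else Min {c'\<in>S. c \<le> c' \<and> w l n c y \<le> P l c' (w l (n - 1) c') y})"

lemma sel_props:
  assumes "c \<in> S"
  shows "sel l n c y \<in> S" "c \<le> sel l n c y" "w l (Suc n) c y = P l (sel l (Suc n) c y) (w l n (sel l (Suc n) c y)) y"
proof -
  have ne: "Min {c'\<in>S. c \<le> c' \<and> w l (Suc m) c y \<le> P l c' (w l m c') y} \<in> {c'\<in>S. c \<le> c' \<and> w l (Suc m) c y \<le> P l c' (w l m c') y}" for m
    by (rule Min_in) (use S_finite w_attained[OF assms, of l m y] in \<open>auto simp del: w.simps\<close>)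
  show "sel l n c y \<in> S" "c \<le> sel l n c y"
    using ne[of "n - 1"] assms by (cases n; simp add: sel_def del: w.simps)+
  have "sel l (Suc n) c y \<in> S" "c \<le> sel l (Suc n) c y" "w l (Suc n) c y \<le> P l (sel l (Suc n) c y) (w l n (sel l (Suc n) c y)) y"
    using ne[of n] by (simp_all add: sel_def del: w.simps)
  moreover have "P l (sel l (Suc n) c y) (w l n (sel l (Suc n) c y)) y \<le> w l (Suc n) c y"
    unfolding w.simps using calculation by (intro SUP_upper) auto
  ultimately show "w l (Suc n) c y = P l (sel l (Suc n) c y) (w l n (sel l (Suc n) c y)) y" by (simp only: antisym)
qed

lemma sel_measurable [measurable]: assumes "c \<in> S" shows "sel l n c \<in> borel_measurable borel"
proof (cases n)
  case (Suc m)
  show ?thesis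
  proof (rule borel_measurable_iff_le[THEN iffD2], rule allI)
    fix a
    have "sel l n c y \<le> a \<longleftrightarrow> (\<exists>c'\<in>{c'\<in>S. c \<le> c' \<and> c' \<le> a}. w l n c y \<le> P l c' (w l (n - 1) c') y)" for y
    proof -
      have "{c'\<in>S. c \<le> c' \<and> w l n c y \<le> P l c' (w l (n - 1) c') y} \<noteq> {}"
        using w_attained[OF assms, of l m y] Suc by (auto simp del: w.simps)
      then show ?thesis using S_finite Suc by (auto simp: sel_def Min_le_iff simp del: w.simps)
    qed
    moreover have "{y \<in> space borel. \<exists>c'\<in>{c'\<in>S. c \<le> c' \<and> c' \<le> a}. w l n c y \<le> P l c' (w l (n - 1) c') y} \<in> sets borel"
    proof (rule sets.sets_Collect_finite_Ex)
      show "finite {c' \<in> S. c \<le> c' \<and> c' \<le> a}" using S_finite by auto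
      fix c'
      have [measurable]: "P l c' (w l (n - 1) c') \<in> borel_measurable borel" by (rule P_measurable) (rule w_measurable)
      show "{y \<in> space borel. w l n c y \<le> P l c' (w l (n - 1) c') y} \<in> sets borel" by measurable
    qed
    ultimately show "{y \<in> space borel. sel l n c y \<le> a} \<in> sets borel" by simp
  qed
qed (simp add: sel_def[abs_def])

text \<open>Under the maximising feedback rule the inequalities of \<open>chain_upper\<close> become
  equalities, and after N periods the remaining value \<open>w l 0\<close> is zero. The control
  still collects dividends afterwards, hence the inequality.\<close>

lemma exists_optimal_control:
  assumes c0: "c0 \<in> S"
  shows "\<exists>C \<in> controls M X S c0. grid l C \<and> w l N c0 x \<le> Jfun M q X C"
proof -
  let ?d = "1 / 2^l :: real"
  \<comment> \<open>State of the feedback recursion: the surplus at the k-th grid time and the rate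
    chosen there with N - k periods to go.\<close>
  define st where "st = rec_nat (\<lambda>\<omega>. (X 0 \<omega>, sel l N c0 (X 0 \<omega>)))
     (\<lambda>k prev \<omega>. let y = fst (prev \<omega>) + (\<mu> - snd (prev \<omega>)) * ?d + \<sigma> * (W (real (Suc k) * ?d) \<omega> - W (real k * ?d) \<omega>)
        in (y, sel l (N - Suc k) (snd (prev \<omega>)) y))"
  define Y where "Y k \<omega> = fst (st k \<omega>)" for k \<omega>
  define Ck where "Ck k \<omega> = snd (st k \<omega>)" for k \<omega>
  have Y0: "Y 0 \<omega> = X 0 \<omega>" and C0: "Ck 0 \<omega> = sel l N c0 (X 0 \<omega>)" for \<omega>
    by (simp_all add: Y_def Ck_def st_def)
  have YS: "Y (Suc k) \<omega> = Y k \<omega> + (\<mu> - Ck k \<omega>) * ?d + \<sigma> * (W (real (Suc k) * ?d) \<omega> - W (real k * ?d) \<omega>)"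
    and CS: "Ck (Suc k) \<omega> = sel l (N - Suc k) (Ck k \<omega>) (Y (Suc k) \<omega>)" for k \<omega>
    by (simp_all add: Y_def Ck_def st_def Let_def del: of_nat_Suc)
  have CinS: "Ck k \<omega> \<in> S" for k \<omega> by (induction k) (simp_all add: C0 CS c0 sel_props del: of_nat_Suc)
  have Cmono: "Ck k \<omega> \<le> Ck (Suc k) \<omega>" for k \<omega> unfolding CS by (rule sel_props(2)[OF CinS])
  have Cge: "c0 \<le> Ck k \<omega>" for k \<omega>
    by (induction k) (auto simp: C0 sel_props(2)[OF c0] intro: order_trans[OF _ Cmono])
  have meas: "Y k \<in> borel_measurable (F (real k * ?d)) \<and> Ck k \<in> borel_measurable (F (real k * ?d))" for k
  proof (induction k)
    case 0
    have [measurable]: "X 0 \<in> borel_measurable (F 0)" by (rule X_F_measurable) auto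
    have [measurable]: "sel l N c0 \<in> borel_measurable borel" by (rule sel_measurable[OF c0])
    have "Y 0 = X 0" "Ck 0 = (\<lambda>\<omega>. sel l N c0 (X 0 \<omega>))" by (auto simp: Y0 C0)
    then show ?case by simp
  next
    case (Suc k)
    have le: "real k * ?d \<le> real (Suc k) * ?d" by (intro mult_right_mono) auto
    have [measurable]: "Y k \<in> borel_measurable (F (real (Suc k) * ?d))" "Ck k \<in> borel_measurable (F (real (Suc k) * ?d))"
      "W (real (Suc k) * ?d) \<in> borel_measurable (F (real (Suc k) * ?d))" "W (real k * ?d) \<in> borel_measurable (F (real (Suc k) * ?d))"
      using Suc le by (auto intro: F_measurable_mono W_F_measurable simp del: of_nat_Suc)
    have Ym[measurable]: "Y (Suc k) \<in> borel_measurable (F (real (Suc k) * ?d))"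
      unfolding YS[abs_def] by measurable
    \<comment> \<open>\<open>sel\<close> is known to be measurable in the surplus for each fixed
      rate; splitting by the finitely many values of the previous rate gives measurability of the
      composition.\<close>
    have "Ck (Suc k) = (\<lambda>\<omega>. \<Sum>c\<in>S. (if Ck k \<omega> = c then sel l (N - Suc k) c (Y (Suc k) \<omega>) else 0))"
      using CinS S_finite by (auto simp: CS fun_eq_iff)
    also have "\<dots> \<in> borel_measurable (F (real (Suc k) * ?d))"
    proof (rule borel_measurable_sum)
      fix c assume "c \<in> S"
      then have [measurable]: "sel l (N - Suc k) c \<in> borel_measurable borel" by (rule sel_measurable)
      show "(\<lambda>\<omega>. if Ck k \<omega> = c then sel l (N - Suc k) c (Y (Suc k) \<omega>) else 0) \<in> borel_measurable (F (real (Suc k) * ?d))"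
        by measurable
    qed
    finally show ?case using Ym by blast
  qed
  define C where "C = (\<lambda>(t::real) \<omega>. Ck (nat \<lfloor>t * 2^l\<rfloor>) \<omega>)"
  have C: "C \<in> controls M X S c0" and g: "grid l C" and Ceq: "\<And>k. C (real k * ?d) = Ck k"
    unfolding C_def using step_control[of Ck l c0] meas CinS Cge Cmono by auto
  have XY: "Xctrl X C (real k * ?d) \<omega> = Y k \<omega>" if "\<omega> \<in> space M" for k \<omega>
  proof (induction k)
    case 0 show ?case using Xctrl_zero[OF C that] by (simp add: Y0)
  next
    case (Suc k)
    have a1: "real (Suc k) * ?d = real k * ?d + ?d" by (simp add: algebra_simps add_divide_distrib)
    show ?case unfolding YS unfolding a1 using Xctrl_step[OF C g that, of ?d k] Suc unfolding Ceq zpath_def by simp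
  qed
  \<comment> \<open>\<open>w l (N - k)\<close> takes the rate in force before the choice at the k-th
    grid time: \<open>c0\<close> at the start, the previous choice afterwards.\<close>
  define prev where "prev k = (if k = 0 then (\<lambda>_. c0) else Ck (k - 1))" for k
  let ?x = "ennreal (exp (- (q * ?d)))" and ?T = "\<lambda>k. \<integral>\<^sup>+\<omega>. Trew l C k \<omega> \<partial>M"
  have eq: "w l N c0 x = (\<Sum>j<k. ?x ^ j * ?T j) + ?x ^ k * start l C k (\<lambda>\<omega>. w l (N - k) (prev k \<omega>))" if "k \<le> N" for k
    using that
  proof (induction k)
    case 0 then show ?case by (simp add: prev_def start_0[OF C w_neg])
  next
    case (Suc k)
    define n where "n = N - Suc k"
    have Nk: "N - k = Suc n" using Suc.prems by (simp add: n_def)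
    have "start l C k (\<lambda>\<omega>. w l (N - k) (prev k \<omega>)) = start l C k (\<lambda>\<omega>. P l (C (real k * ?d) \<omega>) (w l n (C (real k * ?d) \<omega>)))"
      unfolding start_def
    proof (intro nn_integral_cong if_cong refl)
      fix \<omega> assume w: "\<omega> \<in> space M"
      have pS: "prev k \<omega> \<in> S" by (simp add: prev_def c0 CinS)
      have "Ck k \<omega> = sel l (Suc n) (prev k \<omega>) (Y k \<omega>)"
        unfolding Nk[symmetric] by (cases k) (auto simp: prev_def C0 Y0 CS)
      then show "w l (N - k) (prev k \<omega>) (Xctrl X C (real k * ?d) \<omega>)
        = P l (C (real k * ?d) \<omega>) (w l n (C (real k * ?d) \<omega>)) (Xctrl X C (real k * ?d) \<omega>)"
        unfolding XY[OF w] Ceq Nk using sel_props(3)[OF pS] by simp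
    qed
    also have "\<dots> = ?T k + ?x * start l C (Suc k) (\<lambda>\<omega>. w l n (C (real k * ?d) \<omega>))" by (rule chain_step[OF C g])
    finally have "start l C k (\<lambda>\<omega>. w l (N - k) (prev k \<omega>)) = ?T k + ?x * start l C (Suc k) (\<lambda>\<omega>. w l (N - Suc k) (prev (Suc k) \<omega>))"
      unfolding Ceq n_def by (simp add: prev_def)
    then show ?case using Suc by (simp add: distrib_left add.assoc mult.assoc mult.left_commute)
  qed
  have "w l N c0 x = (\<Sum>j<N. ?x ^ j * ?T j)" using eq[of N] by (simp add: start_def)
  also have "\<dots> \<le> (\<Sum>j. ?x ^ j * ?T j)" by (rule sum_le_suminf) auto
  also have "\<dots> = Jfun M q X C" by (rule Jfun_grid[OF C g, symmetric])
  finally show ?thesis using C g by blast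
qed

section \<open>Refining the grid and reaching arbitrary controls\<close>

lemma grid_Suc: assumes "grid l C" shows "grid (Suc l) C"
  unfolding grid_def
proof (intro allI impI ballI)
  fix t :: real and \<omega> assume t: "0 \<le> t" and w: "\<omega> \<in> space M"
  define k where "k = nat \<lfloor>t * 2^l\<rfloor>"
  define j where "j = nat \<lfloor>t * 2^Suc l\<rfloor>"
  have "0 \<le> t * 2^l" "0 \<le> t * 2^Suc l" using t by auto
  then have kk: "real k \<le> t * 2^l" "t * 2^l < real k + 1" and jj: "real j \<le> t * 2^Suc l" "t * 2^Suc l < real j + 1"
    unfolding k_def j_def by linarith+
  have "2 * real k \<le> t * 2^Suc l" using kk by simp
  then have "real (2 * k) < real (j + 1)" using jj by simp
  then have "2 * k \<le> j" by (simp only: of_nat_less_iff)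
  then have "2 * real k \<le> real j" by (simp add: of_nat_le_iff[symmetric, where 'a=real] del: of_nat_le_iff)
  then have "real k * (1 / 2^l) \<le> real j * (1 / 2^Suc l)" "real j * (1 / 2^Suc l) \<le> t"
    using jj by (auto simp: field_simps)
  moreover have "t < real (Suc k) * (1 / 2^l)" "real k * (1 / 2^l) \<le> t" using kk by (auto simp: field_simps)
  ultimately have "C t \<omega> = C (real k * (1 / 2^l)) \<omega>" "C (real j * (1 / 2^Suc l)) \<omega> = C (real k * (1 / 2^l)) \<omega>"
    by (intro grid_const[OF assms w]; linarith)+
  then show "C t \<omega> = C (real (nat \<lfloor>t * 2^Suc l\<rfloor>) * (1 / 2^Suc l)) \<omega>" unfolding j_def by simp
qed

text \<open>A control on the coarse grid is also one on the fine grid, so an optimal coarse control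
  bounds the fine value. This avoids comparing the two recursions directly.\<close>

lemma v_inc: assumes "c \<in> S" shows "(SUP N. w l N c x) \<le> (SUP N. w (Suc l) N c x)"
proof (rule SUP_least)
  fix N
  obtain C where C: "C \<in> controls M X S c" "grid l C" "w l N c x \<le> Jfun M q X C"
    using exists_optimal_control[OF assms] by blast
  then show "w l N c x \<le> (SUP N. w (Suc l) N c x)"
    using Jfun_grid_le[OF C(1) grid_Suc[OF C(2)]] by (rule_tac order_trans)
qed

text \<open>The rounded controls converge wherever the monotone path of \<open>C\<close> is
  continuous, that is at all but countably many times, and later ruin means that their survival
  indicators dominate that of \<open>C\<close>. Fatou's lemma is used twice, first in time and then
  in the outcome.\<close>

lemma Jfun_le:
  assumes C: "C \<in> controls M X S c"
  shows "Jfun M q X C \<le> (SUP l. SUP N. w l N c x)"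
proof -
  define D where "D l = (\<lambda>(t::real) \<omega>. C (real (nat \<lfloor>t * 2^l\<rfloor>) * (1 / 2^l)) \<omega>)" for l :: nat
  have D: "D l \<in> controls M X S c" "grid l (D l)" for l
    unfolding D_def
  proof -
    have "real k * (1 / 2^l) \<le> real (Suc k) * (1 / 2^l)" for k by (intro mult_right_mono) auto
    then show "(\<lambda>t \<omega>. C (real (nat \<lfloor>t * 2^l\<rfloor>) * (1 / 2^l)) \<omega>) \<in> controls M X S c"
      "grid l (\<lambda>t \<omega>. C (real (nat \<lfloor>t * 2^l\<rfloor>) * (1 / 2^l)) \<omega>)"
      using step_control[of "\<lambda>k. C (real k * (1 / 2^l))" l c] control_F_measurable[OF C] control_in_S[OF C] control_mono[OF C]
      by (auto simp del: of_nat_Suc)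
  qed
  let ?in = "\<lambda>C \<omega>. \<integral>\<^sup>+ s. ennreal (exp (- q * s) * C s \<omega> * indicator {s. 0 \<le> s \<and> ereal s < ruin_time (Xctrl X C) \<omega>} s) \<partial>lborel"
  have tl: "0 \<le> real (nat \<lfloor>t * 2^l\<rfloor>) * (1 / 2^l) \<and> real (nat \<lfloor>t * 2^l\<rfloor>) * (1 / 2^l) \<le> t \<and> t - 1 / 2^l \<le> real (nat \<lfloor>t * 2^l\<rfloor>) * (1 / 2^l)"
    if "0 \<le> t" for t and l :: nat
  proof -
    have "0 \<le> t * 2^l" using that by simp
    then have "real (nat \<lfloor>t * 2^l\<rfloor>) \<le> t * 2^l" "t * 2^l \<le> real (nat \<lfloor>t * 2^l\<rfloor>) + 1" by linarith+
    then have a: "real (nat \<lfloor>t * 2^l\<rfloor>) * (1 / 2^l) \<le> t" "t \<le> real (nat \<lfloor>t * 2^l\<rfloor>) * (1 / 2^l) + 1 / 2^l" by (auto simp: field_simps)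
    moreover have "0 \<le> real (nat \<lfloor>t * 2^l\<rfloor>) * (1 / 2^l)" by simp
    ultimately show ?thesis by linarith
  qed
  have inner: "?in C \<omega> \<le> liminf (\<lambda>l. ?in (D l) \<omega>)" if w: "\<omega> \<in> space M" for \<omega>
  proof -
    let ?g = "\<lambda>C T s. ennreal (exp (- q * s) * C s \<omega> * indicator {s. 0 \<le> s \<and> ereal s < T} s)"
    have gm: "?g C' T \<in> borel_measurable lborel" if C': "C' \<in> controls M X S c" for C' T
    proof -
      have "mono_on {0..} (\<lambda>t. C' t \<omega>)" using C' w unfolding controls_def by auto
      then have "(\<lambda>t. C' t \<omega>) \<in> borel_measurable (restrict_space borel {0..})" by (rule borel_measurable_mono_on_fnc)
      then have [measurable]: "(\<lambda>t. indicator {0..} t *\<^sub>R C' t \<omega>) \<in> borel_measurable borel"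
        by (subst (asm) borel_measurable_restrict_space_iff) auto
      have "?g C' T = (\<lambda>s. ennreal (exp (- q * s) * (indicator {0..} s *\<^sub>R C' s \<omega>) * indicator {s. 0 \<le> s \<and> ereal s < T} s))"
        by (auto simp: fun_eq_iff indicator_def)
      also have "\<dots> \<in> borel_measurable lborel" by measurable
      finally show ?thesis .
    qed
    have ruin: "ruin_time (Xctrl X C) \<omega> \<le> ruin_time (Xctrl X (D l)) \<omega>" for l
    proof -
      have "Xctrl X C t \<omega> \<le> Xctrl X (D l) t \<omega>" if "0 \<le> t" for t
      proof -
        have "integral {0..t} (\<lambda>s. D l s \<omega>) \<le> integral {0..t} (\<lambda>s. C s \<omega>)"
        proof (rule integral_le)
          fix s assume "s \<in> {0..t}"
          then show "D l s \<omega> \<le> C s \<omega>" unfolding D_def using tl[of s l] by (intro control_mono[OF C w]) auto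
        qed (use Xctrl_eq(2)[OF C w] Xctrl_eq(2)[OF D(1) w] in auto)
        then show ?thesis unfolding Xctrl_eq(1)[OF C w] Xctrl_eq(1)[OF D(1) w] by simp
      qed
      then show ?thesis unfolding ruin_time_def by (intro Inf_superset_mono image_mono) force
    qed
    have "?in C \<omega> \<le> (\<integral>\<^sup>+ s. liminf (\<lambda>l. ?g (D l) (ruin_time (Xctrl X (D l)) \<omega>) s) \<partial>lborel)"
    proof (rule nn_integral_mono_AE)
      let ?N = "{a \<in> {0..}. \<not> continuous (at a within {0..}) (\<lambda>t. C t \<omega>)}"
      have "mono_on {0..} (\<lambda>t. C t \<omega>)" using C w unfolding controls_def by auto
      then have "countable ?N" by (rule mono_on_ctble_discont)
      then have "?N \<in> null_sets lborel" by (rule countable_imp_null_set_lborel)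
      then have "AE s in lborel. s \<notin> ?N" by (rule AE_not_in)
      then show "AE s in lborel. ?g C (ruin_time (Xctrl X C) \<omega>) s \<le> liminf (\<lambda>l. ?g (D l) (ruin_time (Xctrl X (D l)) \<omega>) s)"
      proof eventually_elim
        case (elim s)
        show ?case
        proof (cases "0 \<le> s \<and> ereal s < ruin_time (Xctrl X C) \<omega>")
          case True
          then have cont: "continuous (at s within {0..}) (\<lambda>t. C t \<omega>)" using elim by auto
          have "(\<lambda>l. real (nat \<lfloor>s * 2^l\<rfloor>) * (1 / 2^l)) \<longlonglongrightarrow> s"
          proof (rule tendsto_sandwich[of "\<lambda>l. s - 1 / 2^l" _ _ "\<lambda>_. s"])
            have "(\<lambda>l. s - (1/2)^l) \<longlonglongrightarrow> s - 0" by (intro tendsto_intros) auto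
            then show "(\<lambda>l. s - 1 / 2^l) \<longlonglongrightarrow> s" by (simp add: power_divide)
          qed (use tl True in auto)
          then have "(\<lambda>l. C (real (nat \<lfloor>s * 2^l\<rfloor>) * (1 / 2^l)) \<omega>) \<longlonglongrightarrow> C s \<omega>"
            using cont tl True unfolding continuous_within_sequentially o_def by auto
          then have "(\<lambda>l. ennreal (exp (- q * s) * D l s \<omega>)) \<longlonglongrightarrow> ennreal (exp (- q * s) * C s \<omega>)"
            unfolding D_def by (intro tendsto_ennrealI tendsto_intros)
          then have "ennreal (exp (- q * s) * C s \<omega>) = liminf (\<lambda>l. ennreal (exp (- q * s) * D l s \<omega>))"
            by (metis lim_imp_Liminf trivial_limit_sequentially)
          moreover have "?g (D l) (ruin_time (Xctrl X (D l)) \<omega>) s = ennreal (exp (- q * s) * D l s \<omega>)" for l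
            using True ruin[of l] by (auto simp: indicator_def)
          ultimately show ?thesis using True by simp
        qed (auto simp: indicator_def)
      qed
    qed
    also have "\<dots> \<le> liminf (\<lambda>l. ?in (D l) \<omega>)" by (rule nn_integral_liminf) (rule gm[OF D(1)])
    finally show ?thesis .
  qed
  \<comment> \<open>A measurable version of the inner time integral for \<open>D l\<close>, as
    Fatou's lemma in the outcome requires; for \<open>C\<close> itself monotonicity of the integral
    suffices.\<close>
  define h where "h l \<omega> = (\<Sum>k. ennreal (exp (- (q * (1 / 2^l)))) ^ k * Trew l (D l) k \<omega>)" for l \<omega>
  have hm: "h l \<in> borel_measurable M" for l
    unfolding h_def using Trew_measurable[OF D] by measurable
  have ae: "AE \<omega> in M. ?in (D l) \<omega> = h l \<omega>" for l unfolding h_def by (rule Jinner_grid[OF D])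
  have "Jfun M q X C \<le> (\<integral>\<^sup>+\<omega>. liminf (\<lambda>l. h l \<omega>) \<partial>M)"
    unfolding Jfun_def
  proof (rule nn_integral_mono_AE)
    have "AE \<omega> in M. \<forall>l. ?in (D l) \<omega> = h l \<omega>" using ae by (simp add: AE_all_countable)
    with AE_space show "AE \<omega> in M. ?in C \<omega> \<le> liminf (\<lambda>l. h l \<omega>)"
    proof eventually_elim
      case (elim \<omega>)
      then show ?case using inner[OF elim(1)] by (simp only:)
    qed
  qed
  also have "\<dots> \<le> liminf (\<lambda>l. \<integral>\<^sup>+\<omega>. h l \<omega> \<partial>M)" by (rule nn_integral_liminf[OF hm])
  also have "\<dots> = liminf (\<lambda>l. Jfun M q X (D l))"
    unfolding Jfun_def nn_integral_cong_AE[OF ae] ..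
  also have "\<dots> \<le> (SUP l. SUP N. w l N c x)"
  proof (rule Liminf_le)
    have "Jfun M q X (D l) \<le> (SUP l. SUP N. w l N c x)" for l
      by (rule order_trans[OF Jfun_grid_le[OF D]], rule SUP_upper) simp
    then show "\<forall>\<^sub>F l in sequentially. Jfun M q X (D l) \<le> (SUP l. SUP N. w l N c x)" by simp
  qed simp
  finally show ?thesis .
qed

theorem SUP_Jfun:
  assumes "c \<in> S"
  shows "(SUP C\<in>controls M X S c. Jfun M q X C) = (SUP l. SUP N. w l N c x)"
proof (rule antisym)
  show "(SUP C\<in>controls M X S c. Jfun M q X C) \<le> (SUP l. SUP N. w l N c x)"
    by (rule SUP_least) (rule Jfun_le)
  show "(SUP l. SUP N. w l N c x) \<le> (SUP C\<in>controls M X S c. Jfun M q X C)"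
  proof (intro SUP_least)
    fix l N
    obtain C where "C \<in> controls M X S c" "w l N c x \<le> Jfun M q X C"
      using exists_optimal_control[OF assms] by blast
    then show "w l N c x \<le> (SUP C\<in>controls M X S c. Jfun M q X C)" by (rule SUP_upper2[of C])
  qed
qed

end

section \<open>Small-time expansions\<close>

context bm_model begin

lemma gauss_integral:
  assumes e: "0 < e" and h: "has_bochner_integral lborel (\<lambda>z. normal_density 0 (sqrt e) z * f z) I" and f: "f \<in> borel_measurable borel"
  shows "has_bochner_integral (gauss e) f I"
proof -
  note [measurable] = f
  have i: "integrable (gauss e) f"
    unfolding gauss_def using h by (subst integrable_density) (auto simp: has_bochner_integral_iff)
  moreover have "integral\<^sup>L (gauss e) f = I"
    unfolding gauss_def using h by (subst integral_density) (auto simp: has_bochner_integral_iff)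
  ultimately show ?thesis by (simp add: has_bochner_integral_iff)
qed

lemma gauss_moments:
  assumes e: "0 < e"
  shows "has_bochner_integral (gauss e) (\<lambda>z. z) 0" "has_bochner_integral (gauss e) (\<lambda>z. z^2) e"
    "has_bochner_integral (gauss e) (\<lambda>z. z^3) 0" "has_bochner_integral (gauss e) (\<lambda>z. z^4) (3 * e^2)"
    "has_bochner_integral (gauss e) (\<lambda>z. 1) (1::real)"
proof -
  interpret N: prob_space "gauss e" by (rule prob_space_gauss[OF e])
  have s: "0 < sqrt e" using e by simp
  show "has_bochner_integral (gauss e) (\<lambda>z. z) 0"
    using normal_moment_odd[OF s, of 0 0] by (intro gauss_integral[OF e]) simp_all
  show "has_bochner_integral (gauss e) (\<lambda>z. z^3) 0"
    using normal_moment_odd[OF s, of 0 1] by (intro gauss_integral[OF e]) simp_all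
  show "has_bochner_integral (gauss e) (\<lambda>z. z^2) e"
    using normal_moment_even[OF s, of 0 1] e by (intro gauss_integral[OF e]) simp_all
  have "fact (2 * 2) / ((2 / (sqrt e)\<^sup>2)^2 * fact 2) = 3 * e^2"
    using e by (simp add: fact_numeral power_divide)
  then show "has_bochner_integral (gauss e) (\<lambda>z. z^4) (3 * e^2)"
    using normal_moment_even[OF s, of 0 2] by (intro gauss_integral[OF e]) simp_all
  show "has_bochner_integral (gauss e) (\<lambda>z. 1) (1::real)"
    using N.prob_space by (simp add: has_bochner_integral_iff)
qed

definition quart :: "real \<Rightarrow> real \<Rightarrow> real \<Rightarrow> real \<Rightarrow> real \<Rightarrow> real" where
  "quart a p A k d = a + p * d + A / 2 * d\<^sup>2 + k * d^4"

lemma gauss_quart: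
  assumes e: "0 < e"
  shows "has_bochner_integral (gauss e) (\<lambda>z. quart a p A k (m * e + \<sigma> * z))
     (a + p * (m * e) + A / 2 * (m\<^sup>2 * e\<^sup>2 + \<sigma>\<^sup>2 * e) + k * (m^4 * e^4 + 6 * m\<^sup>2 * \<sigma>\<^sup>2 * e^3 + 3 * \<sigma>^4 * e\<^sup>2))"
proof -
  note g = gauss_moments[OF e]
  let ?t = "m * e"
  have eq: "quart a p A k (?t + \<sigma> * z) = (a + p * ?t + A / 2 * ?t\<^sup>2 + k * ?t^4) * 1
     + (p * \<sigma> + A * ?t * \<sigma> + 4 * k * ?t^3 * \<sigma>) * z + (A / 2 * \<sigma>\<^sup>2 + 6 * k * ?t\<^sup>2 * \<sigma>\<^sup>2) * z^2
     + (4 * k * ?t * \<sigma>^3) * z^3 + (k * \<sigma>^4) * z^4" for z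
    unfolding quart_def by (simp add: power2_eq_square power3_eq_cube power4_eq_xxxx algebra_simps add_divide_distrib)
  have "has_bochner_integral (gauss e) (\<lambda>z. quart a p A k (?t + \<sigma> * z)) ((a + p * ?t + A / 2 * ?t\<^sup>2 + k * ?t^4) * 1
     + (p * \<sigma> + A * ?t * \<sigma> + 4 * k * ?t^3 * \<sigma>) * 0 + (A / 2 * \<sigma>\<^sup>2 + 6 * k * ?t\<^sup>2 * \<sigma>\<^sup>2) * e
     + (4 * k * ?t * \<sigma>^3) * 0 + (k * \<sigma>^4) * (3 * e^2))"
    unfolding eq by (intro has_bochner_integral_add has_bochner_integral_mult_right) (use g in auto)
  moreover have "(a + p * ?t + A / 2 * ?t\<^sup>2 + k * ?t^4) * 1
     + (p * \<sigma> + A * ?t * \<sigma> + 4 * k * ?t^3 * \<sigma>) * 0 + (A / 2 * \<sigma>\<^sup>2 + 6 * k * ?t\<^sup>2 * \<sigma>\<^sup>2) * e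
     + (4 * k * ?t * \<sigma>^3) * 0 + (k * \<sigma>^4) * (3 * e^2) = a + p * ?t + A / 2 * (m\<^sup>2 * e\<^sup>2 + \<sigma>\<^sup>2 * e) + k * (m^4 * e^4 + 6 * m\<^sup>2 * \<sigma>\<^sup>2 * e^3 + 3 * \<sigma>^4 * e\<^sup>2)"
    by (simp add: power2_eq_square power3_eq_cube power4_eq_xxxx algebra_simps)
  ultimately show ?thesis by (simp only:)
qed

text \<open>The quartic coefficient is computed from the common bound \<open>R\<close> on the jet,
  so that it stays the same when the contact point moves.\<close>

lemma quart_above:
  assumes r: "0 < r" and B: "0 \<le> B" and k: "k = (B + R) / r^4 + R / r^3 + R / (2 * r\<^sup>2)"
    and R: "\<bar>a\<bar> \<le> R" "\<bar>p\<bar> \<le> R" "\<bar>A\<bar> \<le> R"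
    and near: "\<bar>d\<bar> < r \<Longrightarrow> u \<le> a + p * d + A / 2 * d\<^sup>2" and far: "u \<le> B"
  shows "u \<le> quart a p A k d"
proof (cases "\<bar>d\<bar> < r")
  case True
  have "0 \<le> k" unfolding k using r B R by (auto intro!: add_nonneg_nonneg divide_nonneg_pos)
  then show ?thesis using near[OF True] by (simp add: quart_def add_increasing2)
next
  case False
  have "B + \<bar>a\<bar> + \<bar>p * d\<bar> + \<bar>A / 2 * d\<^sup>2\<bar> \<le> ((B + \<bar>a\<bar>) / r^4 + \<bar>p\<bar> / r^3 + \<bar>A\<bar> / (2 * r\<^sup>2)) * d^4"
    by (rule quartic_dominates) (use r B False in auto)
  also have "\<dots> \<le> k * d^4" unfolding k
    using r R by (intro mult_right_mono add_mono divide_right_mono) auto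
  finally show ?thesis using far unfolding quart_def by linarith
qed

lemma exp_bounds:
  fixes s :: real
  assumes "0 \<le> s" shows "exp (- s) \<le> 1 - s + s\<^sup>2 / 2" "1 - s \<le> exp (- s)"
proof -
  show 1: "1 - s \<le> exp (- s)" using exp_ge_add_one_self[of "- s"] by simp
  define f where "f t = 1 - t + t\<^sup>2 / 2 - exp (- t)" for t :: real
  have "f 0 \<le> f s"
  proof (rule DERIV_nonneg_imp_nondecreasing[OF assms])
    fix t :: real assume "0 \<le> t" "t \<le> s"
    have "(f has_real_derivative (- 1 + t + exp (- t))) (at t)"
      unfolding f_def by (auto intro!: derivative_eq_intros)
    moreover have "0 \<le> - 1 + t + exp (- t)" using exp_ge_add_one_self[of "- t"] by simp
    ultimately show "\<exists>y. (f has_real_derivative y) (at t) \<and> 0 \<le> y" by blast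
  qed
  then show "exp (- s) \<le> 1 - s + s\<^sup>2 / 2" by (simp add: f_def)
qed

text \<open>\<open>C1\<close> collects the Gaussian moment terms of order at least e^2,
  \<open>D0\<close> bounds drift plus diffusion of the jet, and the remaining terms come from
  expanding the discount factor to second order.\<close>

definition Kconst :: "real \<Rightarrow> real \<Rightarrow> real \<Rightarrow> real \<Rightarrow> real" where
  "Kconst c B R r = (let m = \<mu> - c; k = (B + R) / r^4 + R / r^3 + R / (2 * r\<^sup>2);
      C1 = R / 2 * m\<^sup>2 + k * (m^4 + 6 * m\<^sup>2 * \<sigma>\<^sup>2 + 3 * \<sigma>^4); D0 = R * (\<bar>m\<bar> + \<sigma>\<^sup>2 / 2)
      in C1 + q * D0 + q\<^sup>2 / 2 * (R + D0 + C1))"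

text \<open>The quartic majorant holds on the whole line, so the Gaussian expectation is bounded by
  explicit moments. The terms of first order in \<open>e\<close> form the operator of the equation
  evaluated on the jet; those of higher order are absorbed into e^2 since e \<le> 1.\<close>

lemma K_upper:
  assumes e: "0 < e" "e \<le> 1" and c: "0 \<le> c" and r: "0 < r"
    and gm: "g \<in> borel_measurable borel" and g: "\<And>y. 0 \<le> g y" "\<And>y. g y \<le> B"
    and R: "\<bar>a\<bar> \<le> R" "\<bar>p\<bar> \<le> R" "\<bar>A\<bar> \<le> R"
    and near: "\<And>d. \<bar>d\<bar> < r \<Longrightarrow> g (y + d) \<le> a + p * d + A / 2 * d\<^sup>2" and y: "0 \<le> y"
  shows "K c e (\<lambda>y. ennreal (g y)) y \<le> ennreal (a + e * (c - q * a + p * (\<mu> - c) + \<sigma>\<^sup>2 / 2 * A) + Kconst c B R r * e\<^sup>2)"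
proof -
  interpret N: prob_space "gauss e" by (rule prob_space_gauss[OF e(1)])
  note [measurable] = gm
  define m where "m = \<mu> - c"
  define k where "k = (B + R) / r^4 + R / r^3 + R / (2 * r\<^sup>2)"
  define C1 where "C1 = R / 2 * m\<^sup>2 + k * (m^4 + 6 * m\<^sup>2 * \<sigma>\<^sup>2 + 3 * \<sigma>^4)"
  define D0 where "D0 = R * (\<bar>m\<bar> + \<sigma>\<^sup>2 / 2)"
  define D where "D = p * m + \<sigma>\<^sup>2 / 2 * A"
  have B: "0 \<le> B" using g[of 0] by linarith
  have R0: "0 \<le> R" using R by linarith
  have k0: "0 \<le> k" unfolding k_def using r B R0 by (auto intro!: add_nonneg_nonneg divide_nonneg_pos)
  have C1: "0 \<le> C1" unfolding C1_def using R0 k0 by (auto intro!: add_nonneg_nonneg mult_nonneg_nonneg)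
  have gi: "integrable (gauss e) (\<lambda>z. g (y + m * e + \<sigma> * z))"
    by (rule N.integrable_const_bound[of _ B]) (use g in auto)
  have D: "\<bar>D\<bar> \<le> D0"
  proof -
    have "\<bar>D\<bar> \<le> \<bar>p\<bar> * \<bar>m\<bar> + \<sigma>\<^sup>2 / 2 * \<bar>A\<bar>" unfolding D_def by (rule order_trans[OF abs_triangle_ineq]) (simp add: abs_mult)
    also have "\<dots> \<le> R * \<bar>m\<bar> + \<sigma>\<^sup>2 / 2 * R" using R by (intro add_mono mult_right_mono mult_left_mono) auto
    finally show ?thesis by (simp add: D0_def algebra_simps)
  qed
  let ?I = "\<integral>z. g (y + m * e + \<sigma> * z) \<partial>gauss e"
  have I0: "0 \<le> ?I" using g by (intro integral_nonneg_AE) auto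
  have "?I \<le> (\<integral>z. quart a p A k (m * e + \<sigma> * z) \<partial>gauss e)"
  proof (rule integral_mono)
    fix z
    show "g (y + m * e + \<sigma> * z) \<le> quart a p A k (m * e + \<sigma> * z)"
      by (rule quart_above[OF r B k_def R]) (use near[of "m * e + \<sigma> * z"] g in \<open>auto simp: add.assoc\<close>)
  qed (use gi gauss_quart[OF e(1)] in \<open>auto simp: has_bochner_integral_iff\<close>)
  also have "\<dots> = a + p * (m * e) + A / 2 * (m\<^sup>2 * e\<^sup>2 + \<sigma>\<^sup>2 * e) + k * (m^4 * e^4 + 6 * m\<^sup>2 * \<sigma>\<^sup>2 * e^3 + 3 * \<sigma>^4 * e\<^sup>2)"
    using gauss_quart[OF e(1)] by (simp add: has_bochner_integral_iff)
  also have "\<dots> \<le> a + e * D + e\<^sup>2 * C1"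
  proof -
    have e4: "e^4 \<le> e\<^sup>2" "e^3 \<le> e\<^sup>2" using e by (auto intro!: power_decreasing)
    have "A / 2 * (m\<^sup>2 * e\<^sup>2) \<le> R / 2 * (m\<^sup>2 * e\<^sup>2)" using R by (intro mult_right_mono) auto
    moreover have "k * (m^4 * e^4 + 6 * m\<^sup>2 * \<sigma>\<^sup>2 * e^3 + 3 * \<sigma>^4 * e\<^sup>2) \<le> k * (m^4 * e\<^sup>2 + 6 * m\<^sup>2 * \<sigma>\<^sup>2 * e\<^sup>2 + 3 * \<sigma>^4 * e\<^sup>2)"
      using e4 k0 by (intro mult_left_mono add_mono) auto
    ultimately show ?thesis unfolding D_def C1_def by (simp add: algebra_simps)
  qed
  finally have IG: "?I \<le> a + e * D + e\<^sup>2 * C1" .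
  define G where "G = a + e * D + e\<^sup>2 * C1"
  have G0: "0 \<le> G" using IG I0 by (simp add: G_def)
  have Gle: "G \<le> R + D0 + C1"
  proof -
    have "e * D \<le> e * D0" using D e by (intro mult_left_mono) auto
    moreover have "e * D0 \<le> 1 * D0" using D e by (intro mult_right_mono) auto
    moreover have "e\<^sup>2 * C1 \<le> 1 * C1" using C1 e by (intro mult_right_mono power_le_one) auto
    ultimately show ?thesis using R unfolding G_def by auto
  qed
  have K: "K c e (\<lambda>y. ennreal (g y)) y = ennreal (c * ((1 - exp (- (q * e))) / q) + exp (- (q * e)) * ?I)"
  proof -
    have "(\<integral>\<^sup>+z. ennreal (g (y + m * e + \<sigma> * z)) \<partial>gauss e) = ennreal ?I"
      by (rule nn_integral_eq_integral[OF gi]) (use g in auto)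
    then show ?thesis unfolding K_def m_def[symmetric] using y c q_pos e I0
      by (simp add: ennreal_plus ennreal_mult)
  qed
  have ex: "exp (- (q * e)) \<le> 1 - q * e + (q * e)\<^sup>2 / 2" "1 - q * e \<le> exp (- (q * e))"
    using exp_bounds[of "q * e"] q_pos e by auto
  have "c * ((1 - exp (- (q * e))) / q) \<le> c * e"
    using ex(2) q_pos c by (intro mult_left_mono) (auto simp: field_simps)
  moreover have "exp (- (q * e)) * ?I \<le> G - q * e * a + e\<^sup>2 * (q * D0 + q\<^sup>2 / 2 * (R + D0 + C1))"
  proof -
    have "exp (- (q * e)) * ?I \<le> exp (- (q * e)) * G" using IG by (simp add: G_def)
    also have "\<dots> \<le> (1 - q * e + (q * e)\<^sup>2 / 2) * G" using ex(1) G0 by (rule mult_right_mono)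
    also have "\<dots> = G - q * e * G + e\<^sup>2 * (q\<^sup>2 / 2) * G" by (simp add: algebra_simps power2_eq_square)
    also have "\<dots> \<le> G - q * e * (a + e * D) + e\<^sup>2 * (q\<^sup>2 / 2) * (R + D0 + C1)"
    proof (intro add_mono diff_mono mult_left_mono Gle)
      show "a + e * D \<le> G" unfolding G_def using C1 by simp
    qed (use q_pos e in auto)
    also have "\<dots> = G - q * e * a - e\<^sup>2 * (q * D) + e\<^sup>2 * (q\<^sup>2 / 2 * (R + D0 + C1))" by (simp add: algebra_simps power2_eq_square)
    also have "\<dots> \<le> G - q * e * a + e\<^sup>2 * (q * D0) + e\<^sup>2 * (q\<^sup>2 / 2 * (R + D0 + C1))"
    proof -
      have "e\<^sup>2 * (q * (- D)) \<le> e\<^sup>2 * (q * D0)" using D q_pos by (intro mult_left_mono) auto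
      then show ?thesis by simp
    qed
    finally show ?thesis by (simp add: algebra_simps)
  qed
  ultimately have "c * ((1 - exp (- (q * e))) / q) + exp (- (q * e)) * ?I \<le> c * e + (G - q * e * a + e\<^sup>2 * (q * D0 + q\<^sup>2 / 2 * (R + D0 + C1)))"
    by (rule add_mono)
  also have "\<dots> = a + e * (c - q * a + p * (\<mu> - c) + \<sigma>\<^sup>2 / 2 * A) + Kconst c B R r * e\<^sup>2"
    unfolding Kconst_def Let_def m_def[symmetric] k_def[symmetric] C1_def[symmetric] D0_def[symmetric]
    by (simp add: G_def D_def algebra_simps)
  finally show ?thesis unfolding K by (rule ennreal_leI)
qed

section \<open>Path excursions over a short period and the lower expansion\<close>

lemma increment_moment4:
  assumes "0 \<le> t" "0 < e"
  shows "(\<integral>\<omega>. (W (t + e) \<omega> - W t \<omega>)^4 \<partial>M) = 3 * e\<^sup>2" "integrable M (\<lambda>\<omega>. (W (t + e) \<omega> - W t \<omega>)^4)"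
proof -
  have D[measurable]: "(\<lambda>\<omega>. W (t + e) \<omega> - W t \<omega>) \<in> borel_measurable M" using assms by (intro increment_measurable) auto
  have g: "has_bochner_integral (distr M borel (\<lambda>\<omega>. W (t + e) \<omega> - W t \<omega>)) (\<lambda>z. z^4) (3 * e\<^sup>2)"
    unfolding distr_increment[OF assms] by (rule gauss_moments(4)[OF assms(2)])
  show "(\<integral>\<omega>. (W (t + e) \<omega> - W t \<omega>)^4 \<partial>M) = 3 * e\<^sup>2"
    using g integral_distr[OF D, of "\<lambda>z. z^4 :: real"] by (simp add: has_bochner_integral_iff)
  show "integrable M (\<lambda>\<omega>. (W (t + e) \<omega> - W t \<omega>)^4)"
    using g integrable_distr_eq[OF D, of "\<lambda>z. z^4 :: real"] by (simp add: has_bochner_integral_iff)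
qed

text \<open>With the fourth power, Markov's inequality gives e^2, which beats the number 2^m of
  increments of length d / 2^m in \<open>chaining\<close>.\<close>

lemma increment_tail:
  assumes "0 \<le> t" "0 < e" "0 < b"
  shows "prob {\<omega> \<in> space M. b \<le> \<bar>W (t + e) \<omega> - W t \<omega>\<bar>} \<le> 3 * e\<^sup>2 / b^4"
proof -
  have D[measurable]: "(\<lambda>\<omega>. W (t + e) \<omega> - W t \<omega>) \<in> borel_measurable M" using assms by (intro increment_measurable) auto
  have "prob {\<omega> \<in> space M. b^4 \<le> (W (t + e) \<omega> - W t \<omega>)^4} \<le> (\<integral>\<omega>. (W (t + e) \<omega> - W t \<omega>)^4 \<partial>M) / b^4"
    by (rule integral_Markov_inequality_measure[where A = "{}"]) (use increment_moment4[OF assms(1,2)] assms in auto)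
  moreover have "{\<omega> \<in> space M. b^4 \<le> (W (t + e) \<omega> - W t \<omega>)^4} = {\<omega> \<in> space M. b \<le> \<bar>W (t + e) \<omega> - W t \<omega>\<bar>}"
  proof -
    have "b^4 \<le> z^4 \<longleftrightarrow> b \<le> \<bar>z\<bar>" for z :: real
      using power_mono_iff[of b "\<bar>z\<bar>" 4] assms by (simp add: power_even_abs)
    then show ?thesis by simp
  qed
  ultimately show ?thesis using increment_moment4[OF assms(1,2)] by simp
qed


text \<open>A union bound over all dyadic increments, with fourth moments. The thresholds decay like
  \<open>(9/10) ^ m\<close>: fast enough to be summable along a path, and slow enough for the probabilities to be
  summable, because \<open>(9/10) ^ 4 > 1/2\<close>.\<close>

lemma chaining:
  fixes l :: nat
  assumes \<rho>: "0 < \<rho>"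
  defines "d \<equiv> 1 / 2^l :: real"
  shows "\<exists>Bad\<in>sets M. prob Bad \<le> 130000 * d\<^sup>2 / \<rho>^4
    \<and> (\<forall>\<omega>\<in>space M - Bad. \<forall>r\<in>dyadics. r \<le> d \<longrightarrow> \<bar>W r \<omega> - W 0 \<omega>\<bar> \<le> \<rho>)"
proof -
  define e where "e m = d / 2^m" for m :: nat
  have e0: "0 < e m" for m by (simp add: e_def d_def)
  \<comment> \<open>The factor 1/10 is 1 - 9/10, so that all thresholds together sum to
    \<rho>.\<close>
  define b where "b m = \<rho> / 10 * (9/10)^m" for m :: nat
  have b0: "0 < b m" for m using \<rho> by (simp add: b_def)
  define E where "E m j = {\<omega> \<in> space M. b m \<le> \<bar>W (real j * e m + e m) \<omega> - W (real j * e m) \<omega>\<bar>}" for m j :: nat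
  define Em where "Em m = (\<Union>j<2^m. E m j)" for m :: nat
  have Es: "E m j \<in> sets M" for m j
  proof -
    have [measurable]: "(\<lambda>\<omega>. W (real j * e m + e m) \<omega> - W (real j * e m) \<omega>) \<in> borel_measurable M"
      using e0[of m] by (intro increment_measurable) auto
    show ?thesis unfolding E_def by measurable
  qed
  then have Ems: "Em m \<in> sets M" for m unfolding Em_def by auto
  \<comment> \<open>The ratio (1/2) / (9/10)^4. Below, 30000 is 3 * 10^4, and 30000 / (1 - ?q) is
    about 126100, rounded up to 130000.\<close>
  let ?q = "5000 / 6561 :: real"
  have PE: "prob (Em m) \<le> 30000 * d\<^sup>2 / \<rho>^4 * ?q^m" for m
  proof -
    have "prob (Em m) \<le> (\<Sum>j<2^m. prob (E m j))"
      unfolding Em_def by (rule finite_measure_subadditive_finite) (use Es in auto)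
    also have "\<dots> \<le> (\<Sum>j<(2::nat)^m. 3 * (e m)\<^sup>2 / (b m)^4)"
      unfolding E_def using e0[of m] b0[of m] by (intro sum_mono increment_tail) auto
    also have "\<dots> = 2^m * (3 * (e m)\<^sup>2 / (b m)^4)" by simp
    also have "\<dots> = 30000 * d\<^sup>2 / \<rho>^4 * (2^m / (2^m)\<^sup>2 / ((9/10)^m)^4)"
      unfolding e_def b_def using \<rho> by (simp add: power_mult_distrib power_divide field_simps)
    also have "2^m / (2^m)\<^sup>2 / ((9/10)^m)^4 = ?q^m"
    proof -
      have p: "(b^m)^n = (b^n)^m" for b :: real and n by (metis mult.commute power_mult)
      have "2^m / (2^m)\<^sup>2 / ((9/10)^m)^4 = (2 / 2\<^sup>2 / (9/10)^4 :: real)^m"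
        unfolding p by (simp only: power_divide)
      also have "(2 / 2\<^sup>2 / (9/10)^4 :: real) = ?q" by (simp add: power2_eq_square power4_eq_xxxx)
      finally show ?thesis .
    qed
    finally show ?thesis .
  qed
  have sm: "(\<lambda>m. 30000 * d\<^sup>2 / \<rho>^4 * ?q^m) sums (30000 * d\<^sup>2 / \<rho>^4 * (1 / (1 - ?q)))"
    by (intro sums_mult geometric_sums) simp
  have sE: "summable (\<lambda>m. prob (Em m))"
    by (rule summable_comparison_test'[OF sums_summable[OF sm], of 0]) (use PE in auto)
  define Bad where "Bad = (\<Union>m. Em m)"
  have "prob Bad \<le> (\<Sum>m. prob (Em m))"
    unfolding Bad_def by (rule finite_measure_subadditive_countably[OF _ sE]) (use Ems in auto)
  also have "\<dots> \<le> 30000 * d\<^sup>2 / \<rho>^4 * (1 / (1 - ?q))"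
    using suminf_le[OF PE sE sums_summable[OF sm]] sums_unique[OF sm] by simp
  also have "\<dots> \<le> 130000 * d\<^sup>2 / \<rho>^4"
  proof -
    have "30000 * (1 / (1 - ?q)) * (d\<^sup>2 / \<rho>^4) \<le> 130000 * (d\<^sup>2 / \<rho>^4)"
      by (rule mult_right_mono) (auto simp: )
    then show ?thesis by simp
  qed
  finally have PB: "prob Bad \<le> 130000 * d\<^sup>2 / \<rho>^4" .
  have path: "\<bar>W r \<omega> - W 0 \<omega>\<bar> \<le> \<rho>" if w: "\<omega> \<in> space M - Bad" and r: "r \<in> dyadics" "r \<le> d" for \<omega> r
  proof -
    have small: "\<bar>W (real j * e m + e m) \<omega> - W (real j * e m) \<omega>\<bar> \<le> b m" if "j < 2^m" for m j
    proof -
      have "\<omega> \<notin> E m j" using w that unfolding Bad_def Em_def by auto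
      then show ?thesis using w unfolding E_def by auto
    qed
    have ind: "\<bar>W (real j * e m) \<omega> - W 0 \<omega>\<bar> \<le> (\<Sum>i\<le>m. b i)" if "j \<le> 2^m" for m j
      using that
    proof (induction m arbitrary: j)
      case 0
      then have "j = 0 \<or> j = 1" by auto
      then show ?case using small[of 0 0] b0[of 0] by (auto simp: e_def)
    next
      case (Suc m)
      have eS: "e m = 2 * e (Suc m)" by (simp add: e_def)
      show ?case
      \<comment> \<open>An even point already lies on the coarser grid; an odd one is a single fine
        increment to the right of such a point.\<close>
      proof (cases "even j")
        case True
        then obtain i where i: "j = 2 * i" by blast
        then have "\<bar>W (real i * e m) \<omega> - W 0 \<omega>\<bar> \<le> (\<Sum>i\<le>m. b i)" using Suc.prems by (intro Suc.IH) simp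
        moreover have "real j * e (Suc m) = real i * e m" by (simp add: i eS)
        ultimately show ?thesis using b0[of "Suc m"] by simp
      next
        case False
        then obtain i where i: "j = 2 * i + 1" by (metis oddE)
        have le: "i \<le> 2^m" "2 * i < 2^Suc m" using Suc.prems i by auto
        have "\<bar>W (real i * e m) \<omega> - W 0 \<omega>\<bar> \<le> (\<Sum>i\<le>m. b i)" using le by (intro Suc.IH)
        moreover have eq: "real (2 * i) * e (Suc m) = real i * e m" "real j * e (Suc m) = real i * e m + e (Suc m)"
          by (simp_all add: i eS algebra_simps)
        moreover have "\<bar>W (real i * e m + e (Suc m)) \<omega> - W (real i * e m) \<omega>\<bar> \<le> b (Suc m)"
          using small[OF le(2)] unfolding eq(1) .
        ultimately show ?thesis by simp
      qed
    qed
    obtain j m where rj: "r = real j * (1 / 2^l / 2^m)" using dyadics_grid_eq[OF r(1), of l] by blast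
    then have rj': "r = real j * e m" by (simp add: e_def d_def)
    have "real j * e m \<le> real (2^m) * e m" using r(2) unfolding rj' by (simp add: e_def)
    then have "j \<le> 2^m" using e0[of m] by (simp only: mult_le_cancel_right_pos of_nat_le_iff)
    then have "\<bar>W r \<omega> - W 0 \<omega>\<bar> \<le> (\<Sum>i\<le>m. b i)" unfolding rj' by (rule ind)
    also have "\<dots> = \<rho> / 10 * (\<Sum>i\<le>m. (9/10)^i)" by (simp add: b_def sum_distrib_left)
    also have "\<dots> \<le> \<rho> / 10 * 10"
    proof (rule mult_left_mono)
      have "(\<Sum>i\<le>m. (9/10::real)^i) \<le> (\<Sum>i. (9/10)^i)"
        by (rule sum_le_suminf) (auto intro!: summable_geometric)
      also have "\<dots> = 10" by (subst suminf_geometric) auto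
      finally show "(\<Sum>i\<le>m. (9/10::real)^i) \<le> 10" .
    qed (use \<rho> in auto)
    finally show ?thesis by simp
  qed
  show ?thesis
    by (rule bexI[of _ Bad]) (use PB path Ems in \<open>auto simp: Bad_def\<close>)
qed

lemma integral_le_nn_integral:
  fixes h :: "'a \<Rightarrow> real"
  assumes "integrable M h" shows "ennreal (\<integral>\<omega>. h \<omega> \<partial>M) \<le> (\<integral>\<^sup>+\<omega>. ennreal (h \<omega>) \<partial>M)"
proof -
  have i: "integrable M (\<lambda>\<omega>. max 0 (h \<omega>))" using assms by auto
  have "(\<integral>\<omega>. h \<omega> \<partial>M) \<le> (\<integral>\<omega>. max 0 (h \<omega>) \<partial>M)" by (rule integral_mono[OF assms i]) auto
  then have "ennreal (\<integral>\<omega>. h \<omega> \<partial>M) \<le> ennreal (\<integral>\<omega>. max 0 (h \<omega>) \<partial>M)" by (rule ennreal_leI)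
  also have "\<dots> = (\<integral>\<^sup>+\<omega>. ennreal (max 0 (h \<omega>)) \<partial>M)" by (rule nn_integral_eq_integral[symmetric, OF i]) auto
  also have "\<dots> = (\<integral>\<^sup>+\<omega>. ennreal (h \<omega>) \<partial>M)" by (intro nn_integral_cong) (auto simp: max_def ennreal_neg)
  finally show ?thesis .
qed

text \<open>Built like \<open>Kconst\<close>, with \<kappa> * e^2 bounding the probability of the
  bad event of \<open>chaining\<close> for the deviation r / (4 * \<sigma>), and B' bounding the
  quartic from above.\<close>

definition Lconst :: "real \<Rightarrow> real \<Rightarrow> real \<Rightarrow> real" where
  "Lconst c R r = (let m = \<mu> - c; k = R / r^4 + R / r^3 + R / (2 * r\<^sup>2); B' = R + R * r + R / 2 * r\<^sup>2;
      \<kappa> = 130000 / (r / (4 * \<sigma>))^4;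
      C1 = R / 2 * m\<^sup>2 + k * (m^4 + 6 * m\<^sup>2 * \<sigma>\<^sup>2 + 3 * \<sigma>^4) + B' * \<kappa>; D0 = R * (\<bar>m\<bar> + \<sigma>\<^sup>2 / 2)
      in c * \<kappa> + c * q / 2 + C1 + q * D0 + q\<^sup>2 / 2 * (R + D0 + C1))"

text \<open>Off the bad event the path stays within r \<le> y of \<open>y\<close>, so there is no
  ruin, the full reward is paid and the local minorant applies. On the bad event, of probability
  O(e^2), the nonnegative payoff is compared with something nonpositive.\<close>

lemma P_lower:
  fixes l :: nat
  defines "e \<equiv> 1 / 2^l :: real"
  assumes c: "0 \<le> c" and r: "0 < r" "r \<le> y" "\<bar>\<mu> - c\<bar> * e < r / 2"
    and gm: "g \<in> borel_measurable borel" and g: "\<And>y. 0 \<le> g y" "\<And>y. g y \<le> B" "\<And>y. y < 0 \<Longrightarrow> g y = 0"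
    and R: "\<bar>a\<bar> \<le> R" "\<bar>p\<bar> \<le> R" "\<bar>A\<bar> \<le> R"
    and near: "\<And>d. \<bar>d\<bar> < r \<Longrightarrow> a + p * d + A / 2 * d\<^sup>2 \<le> g (y + d)"
  shows "ennreal (a + e * (c - q * a + p * (\<mu> - c) + \<sigma>\<^sup>2 / 2 * A) - Lconst c R r * e\<^sup>2) \<le> P l c (\<lambda>y. ennreal (g y)) y"
proof -
  note [measurable] = gm
  have e: "0 < e" "e \<le> 1" unfolding e_def by auto
  define m where "m = \<mu> - c"
  define k where "k = R / r^4 + R / r^3 + R / (2 * r\<^sup>2)"
  define B' where "B' = R + R * r + R / 2 * r\<^sup>2"
  \<comment> \<open>Leaves r/4 for the noise, while the drift stays below r/2 by hypothesis.\<close>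
  define \<rho> where "\<rho> = r / (4 * \<sigma>)"
  define \<kappa> where "\<kappa> = 130000 / \<rho>^4"
  define C1 where "C1 = R / 2 * m\<^sup>2 + k * (m^4 + 6 * m\<^sup>2 * \<sigma>\<^sup>2 + 3 * \<sigma>^4) + B' * \<kappa>"
  define D0 where "D0 = R * (\<bar>m\<bar> + \<sigma>\<^sup>2 / 2)"
  define D where "D = p * m + \<sigma>\<^sup>2 / 2 * A"
  have \<rho>: "0 < \<rho>" using r sigma_pos by (simp add: \<rho>_def)
  have B: "0 \<le> B" using g[of 0] by linarith
  have R0: "0 \<le> R" using R by linarith
  have k0: "0 \<le> k" unfolding k_def using r R0 by (auto intro!: add_nonneg_nonneg divide_nonneg_pos)
  have B'0: "0 \<le> B'" unfolding B'_def using r R0 by (auto intro!: add_nonneg_nonneg)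
  have \<kappa>0: "0 \<le> \<kappa>" unfolding \<kappa>_def using \<rho> by simp
  have C1: "0 \<le> C1" unfolding C1_def using R0 k0 B'0 \<kappa>0 by (auto intro!: add_nonneg_nonneg mult_nonneg_nonneg)
  obtain Bad where Bad[measurable]: "Bad \<in> sets M" and PB: "prob Bad \<le> 130000 * e\<^sup>2 / \<rho>^4"
    and good: "\<And>\<omega> s. \<omega> \<in> space M \<Longrightarrow> \<omega> \<notin> Bad \<Longrightarrow> s \<in> dyadics \<Longrightarrow> s \<le> e \<Longrightarrow> \<bar>W s \<omega> - W 0 \<omega>\<bar> \<le> \<rho>"
    using chaining[OF \<rho>, of l] unfolding e_def by blast
  have pb: "prob Bad \<le> \<kappa> * e\<^sup>2" "0 \<le> prob Bad" using PB by (auto simp: \<kappa>_def)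
  let ?Z = "zpath c 0 (\<lambda>_. y)"
  define dd where "dd \<omega> = m * e + \<sigma> * (W (0 + e) \<omega> - W 0 \<omega>)" for \<omega>
  have Ze: "?Z \<omega> e = y + dd \<omega>" for \<omega> by (simp add: zpath_def dd_def m_def)
  have D[measurable]: "(\<lambda>\<omega>. W (0 + e) \<omega> - W 0 \<omega>) \<in> borel_measurable M" using e by (intro increment_measurable) auto
  define x where "x = exp (- (q * e))"
  have x: "0 < x" "x \<le> 1" using q_pos e by (auto simp: x_def)
  have xb: "x \<le> 1 - q * e + (q * e)\<^sup>2 / 2" "1 - q * e \<le> x"
    using exp_bounds[of "q * e"] q_pos e unfolding x_def by auto
  let ?rc = "c * ((1 - x) / q)"
  have rc0: "0 \<le> ?rc" using c x q_pos by simp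
  \<comment> \<open>A lower bound for the payoff with explicit expectation: subtracting B' on the
    bad event makes it nonpositive there, so the Gaussian integral need not be restricted to the
    good event.\<close>
  define h where "h \<omega> = ?rc * (1 - indicat_real Bad \<omega>) + x * (quart a p A (- k) (dd \<omega>) - B' * indicat_real Bad \<omega>)" for \<omega>
  have goodZ: "\<bar>?Z \<omega> s - y\<bar> < r" if "\<omega> \<in> space M" "\<omega> \<notin> Bad" "s \<in> dyadics" "s \<le> e" for \<omega> s
  proof -
    have s0: "0 \<le> s" by (rule dyadics_nonneg[OF that(3)])
    have "\<bar>?Z \<omega> s - y\<bar> \<le> \<bar>m\<bar> * s + \<sigma> * \<bar>W s \<omega> - W 0 \<omega>\<bar>"
      using abs_triangle_ineq[of "m * s" "\<sigma> * (W s \<omega> - W 0 \<omega>)"] s0 sigma_pos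
      by (simp add: zpath_def m_def abs_mult)
    also have "\<dots> \<le> \<bar>m\<bar> * e + \<sigma> * \<rho>"
      using good[OF that] that s0 sigma_pos by (intro add_mono mult_left_mono) auto
    also have "\<dots> < r" using r sigma_pos by (simp add: \<rho>_def m_def)
    finally show ?thesis .
  qed
  have ed: "e \<in> dyadics" unfolding e_def dyadics_def by (rule CollectI, rule exI[of _ 1], rule exI[of _ l]) simp
  have hle: "ennreal (h \<omega>) \<le> rwd c e (alive (?Z \<omega>)) + ennreal x * (if alive (?Z \<omega>) e then ennreal (g (?Z \<omega> e)) else 0)"
    if w: "\<omega> \<in> space M" for \<omega>
  proof (cases "\<omega> \<in> Bad")
    case True
    have "quart a p A (- k) (dd \<omega>) \<le> B'"
    proof (cases "\<bar>dd \<omega>\<bar> < r")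
      case True
      have "p * dd \<omega> \<le> \<bar>p\<bar> * \<bar>dd \<omega>\<bar>" by (metis abs_ge_self abs_mult)
      also have "\<dots> \<le> R * r" using R True by (intro mult_mono) auto
      finally have "p * dd \<omega> \<le> R * r" .
      moreover have "A / 2 * (dd \<omega>)\<^sup>2 \<le> R / 2 * r\<^sup>2"
      proof -
        have "(dd \<omega>)\<^sup>2 \<le> r\<^sup>2" using True r by (metis abs_le_square_iff abs_of_pos less_imp_le)
        then show ?thesis using R R0 by (intro mult_mono) auto
      qed
      moreover have "0 \<le> k * (dd \<omega>)^4" using k0 by simp
      ultimately show ?thesis using R unfolding quart_def B'_def by auto
    next
      case False
      have "0 + \<bar>a\<bar> + \<bar>p * dd \<omega>\<bar> + \<bar>A / 2 * (dd \<omega>)\<^sup>2\<bar> \<le> ((0 + \<bar>a\<bar>) / r^4 + \<bar>p\<bar> / r^3 + \<bar>A\<bar> / (2 * r\<^sup>2)) * (dd \<omega>)^4"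
        by (rule quartic_dominates) (use r False in auto)
      also have "\<dots> \<le> k * (dd \<omega>)^4" unfolding k_def
        using r R by (intro mult_right_mono add_mono divide_right_mono) auto
      finally have "quart a p A (- k) (dd \<omega>) \<le> 0" unfolding quart_def by (simp add: abs_le_iff)
      then show ?thesis using B'0 by simp
    qed
    then have "h \<omega> \<le> 0" using True x by (simp add: h_def mult_le_0_iff)
    then show ?thesis by (simp add: ennreal_neg)
  next
    case False
    have al: "alive (?Z \<omega>) s" if "s \<le> e" for s
      unfolding alive_def
    proof (intro ballI impI)
      fix t assume "t \<in> dyadics" "t \<le> s"
      then show "0 \<le> ?Z \<omega> t" using goodZ[OF w False, of t] that r by (auto simp: abs_less_iff)
    qed
    have "rwd c e (alive (?Z \<omega>)) = ennreal ?rc"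
      unfolding x_def by (rule rwd_full[OF c]) (use e al in auto)
    moreover have "\<bar>dd \<omega>\<bar> < r" using goodZ[OF w False ed] Ze by simp
    then have "quart a p A (- k) (dd \<omega>) \<le> g (y + dd \<omega>)"
      using near[of "dd \<omega>"] mult_nonneg_nonneg[OF k0, of "(dd \<omega>)^4"] unfolding quart_def by simp
    then have "h \<omega> \<le> ?rc + x * g (y + dd \<omega>)" using False x by (simp add: h_def)
    then have "ennreal (h \<omega>) \<le> ennreal ?rc + ennreal x * ennreal (g (y + dd \<omega>))"
      using rc0 x g by (simp add: ennreal_plus[symmetric] ennreal_mult[symmetric] ennreal_leI del: ennreal_plus)
    ultimately show ?thesis using al[of e] Ze by simp
  qed
  have qi: "has_bochner_integral M (\<lambda>\<omega>. quart a p A (- k) (dd \<omega>))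
     (a + p * (m * e) + A / 2 * (m\<^sup>2 * e\<^sup>2 + \<sigma>\<^sup>2 * e) + (- k) * (m^4 * e^4 + 6 * m\<^sup>2 * \<sigma>\<^sup>2 * e^3 + 3 * \<sigma>^4 * e\<^sup>2))"
  proof -
    have hb: "has_bochner_integral (distr M borel (\<lambda>\<omega>. W (0 + e) \<omega> - W 0 \<omega>)) (\<lambda>z. quart a p A (- k) (m * e + \<sigma> * z))
     (a + p * (m * e) + A / 2 * (m\<^sup>2 * e\<^sup>2 + \<sigma>\<^sup>2 * e) + (- k) * (m^4 * e^4 + 6 * m\<^sup>2 * \<sigma>\<^sup>2 * e^3 + 3 * \<sigma>^4 * e\<^sup>2))"
      unfolding distr_increment[OF order_refl e(1)] by (rule gauss_quart[OF e(1)])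
    have qm: "(\<lambda>z. quart a p A (- k) (m * e + \<sigma> * z)) \<in> borel_measurable borel" unfolding quart_def by measurable
    show ?thesis using hb
      unfolding dd_def has_bochner_integral_iff integrable_distr_eq[OF D qm] integral_distr[OF D qm] .
  qed
  have ib: "has_bochner_integral M (indicat_real Bad) (prob Bad)"
    using Bad by (simp add: has_bochner_integral_iff less_top[symmetric])
  have i1: "has_bochner_integral M (\<lambda>_. 1::real) 1" by (simp add: has_bochner_integral_iff prob_space)
  define Q where "Q = a + p * (m * e) + A / 2 * (m\<^sup>2 * e\<^sup>2 + \<sigma>\<^sup>2 * e) + (- k) * (m^4 * e^4 + 6 * m\<^sup>2 * \<sigma>\<^sup>2 * e^3 + 3 * \<sigma>^4 * e\<^sup>2)"
  have hi: "has_bochner_integral M h (?rc * (1 - prob Bad) + x * (Q - B' * prob Bad))"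
    unfolding h_def Q_def
    by (intro has_bochner_integral_add has_bochner_integral_mult_right has_bochner_integral_diff qi ib i1)
  have "ennreal (?rc * (1 - prob Bad) + x * (Q - B' * prob Bad)) \<le> (\<integral>\<^sup>+\<omega>. ennreal (h \<omega>) \<partial>M)"
    using integral_le_nn_integral[of h] hi by (simp add: has_bochner_integral_iff)
  also have "\<dots> \<le> (\<integral>\<^sup>+\<omega>. rwd c e (alive (?Z \<omega>)) + ennreal x * (if alive (?Z \<omega>) e then ennreal (g (?Z \<omega> e)) else 0) \<partial>M)"
    by (rule nn_integral_mono) (rule hle)
  also have "\<dots> = P l c (\<lambda>y. ennreal (g y)) y"
    unfolding x_def e_def by (rule P_point[symmetric, OF c _ _ _ B]) (use g in \<open>auto intro!: ennreal_leI\<close>)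
  finally have main: "ennreal (?rc * (1 - prob Bad) + x * (Q - B' * prob Bad)) \<le> P l c (\<lambda>y. ennreal (g y)) y" .
  have Dle: "\<bar>D\<bar> \<le> D0"
  proof -
    have "\<bar>D\<bar> \<le> \<bar>p\<bar> * \<bar>m\<bar> + \<sigma>\<^sup>2 / 2 * \<bar>A\<bar>" unfolding D_def by (rule order_trans[OF abs_triangle_ineq]) (simp add: abs_mult)
    also have "\<dots> \<le> R * \<bar>m\<bar> + \<sigma>\<^sup>2 / 2 * R" using R by (intro add_mono mult_right_mono mult_left_mono) auto
    finally show ?thesis by (simp add: D0_def algebra_simps)
  qed
  define G where "G = a + e * D - e\<^sup>2 * C1"
  have QG: "G \<le> Q - B' * prob Bad"
  proof -
    have e4: "e^4 \<le> e\<^sup>2" "e^3 \<le> e\<^sup>2" using e by (auto intro!: power_decreasing)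
    have "(- R) / 2 * (m\<^sup>2 * e\<^sup>2) \<le> A / 2 * (m\<^sup>2 * e\<^sup>2)" using R by (intro mult_right_mono) auto
    moreover have "k * (m^4 * e^4 + 6 * m\<^sup>2 * \<sigma>\<^sup>2 * e^3 + 3 * \<sigma>^4 * e\<^sup>2) \<le> k * (m^4 * e\<^sup>2 + 6 * m\<^sup>2 * \<sigma>\<^sup>2 * e\<^sup>2 + 3 * \<sigma>^4 * e\<^sup>2)"
      using e4 k0 by (intro mult_left_mono add_mono) auto
    moreover have "B' * prob Bad \<le> B' * (\<kappa> * e\<^sup>2)" using pb B'0 by (intro mult_left_mono) auto
    ultimately show ?thesis unfolding D_def C1_def G_def Q_def by (simp add: algebra_simps)
  qed
  have Gabs: "\<bar>G\<bar> \<le> R + D0 + C1"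
  proof -
    have "\<bar>e * D\<bar> \<le> 1 * D0" unfolding abs_mult using e Dle by (intro mult_mono) auto
    moreover have "e\<^sup>2 * C1 \<le> 1 * C1" using C1 e by (intro mult_right_mono power_le_one) auto
    moreover have "0 \<le> e\<^sup>2 * C1" using C1 by simp
    ultimately show ?thesis using R unfolding G_def by (simp add: abs_le_iff)
  qed
  have xG: "a + e * D - q * e * a - e\<^sup>2 * (C1 + q * D0 + q\<^sup>2 / 2 * (R + D0 + C1)) \<le> x * G"
  proof -
    \<comment> \<open>\<open>G\<close> may have either sign, so the second-order remainder of the
      discount factor is paired with its absolute value.\<close>
    have "(1 - x) * G \<le> q * e * G + (q * e)\<^sup>2 / 2 * \<bar>G\<bar>"
    proof -
      have "\<bar>(1 - x) - q * e\<bar> \<le> (q * e)\<^sup>2 / 2" using xb by (auto simp: abs_le_iff)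
      then have "\<bar>(1 - x) - q * e\<bar> * \<bar>G\<bar> \<le> (q * e)\<^sup>2 / 2 * \<bar>G\<bar>" by (intro mult_right_mono) auto
      then have "((1 - x) - q * e) * G \<le> (q * e)\<^sup>2 / 2 * \<bar>G\<bar>" unfolding abs_mult[symmetric] by linarith
      then show ?thesis by (simp add: algebra_simps)
    qed
    also have "\<dots> \<le> q * e * (a + e * D0) + (q * e)\<^sup>2 / 2 * (R + D0 + C1)"
    proof (intro add_mono mult_left_mono Gabs)
      have "e * D \<le> e * D0" "0 \<le> e\<^sup>2 * C1" using Dle e C1 by (auto intro!: mult_left_mono)
      then show "G \<le> a + e * D0" unfolding G_def by linarith
    qed (use q_pos e in auto)
    finally show ?thesis unfolding G_def by (simp add: algebra_simps power2_eq_square)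
  qed
  have rcl: "c * e - (c * q / 2 + c * \<kappa>) * e\<^sup>2 \<le> ?rc * (1 - prob Bad)"
  proof -
    have u: "?rc \<le> c * e" using xb(2) q_pos c by (intro mult_left_mono) (auto simp: field_simps)
    have f1: "c * (e - q * e\<^sup>2 / 2) \<le> ?rc"
    proof (rule mult_left_mono[OF _ c])
      have "q * (e - q * e\<^sup>2 / 2) \<le> 1 - x" using xb(1) by (simp add: algebra_simps power2_eq_square)
      then show "e - q * e\<^sup>2 / 2 \<le> (1 - x) / q" using q_pos by (simp add: field_simps)
    qed
    have f2: "?rc * prob Bad \<le> c * \<kappa> * e\<^sup>2"
    proof -
      have "?rc * prob Bad \<le> (c * e) * (\<kappa> * e\<^sup>2)" by (rule mult_mono[OF u pb(1)]) (use pb(2) c e in auto)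
      also have "\<dots> \<le> (c * 1) * (\<kappa> * e\<^sup>2)" using c e \<kappa>0 by (intro mult_right_mono mult_left_mono) auto
      finally show ?thesis by simp
    qed
    have "c * e - (c * q / 2 + c * \<kappa>) * e\<^sup>2 = c * (e - q * e\<^sup>2 / 2) - c * \<kappa> * e\<^sup>2"
      by (simp add: algebra_simps)
    also have "\<dots> \<le> ?rc - ?rc * prob Bad" using f1 f2 by (rule diff_mono)
    also have "\<dots> = ?rc * (1 - prob Bad)" by (simp only: right_diff_distrib mult_1_right)
    finally show ?thesis .
  qed
  have "x * G \<le> x * (Q - B' * prob Bad)" using QG x by simp
  then have "c * e - (c * q / 2 + c * \<kappa>) * e\<^sup>2 + (a + e * D - q * e * a - e\<^sup>2 * (C1 + q * D0 + q\<^sup>2 / 2 * (R + D0 + C1)))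
     \<le> ?rc * (1 - prob Bad) + x * (Q - B' * prob Bad)"
    using xG rcl by linarith
  moreover have "c * e - (c * q / 2 + c * \<kappa>) * e\<^sup>2 + (a + e * D - q * e * a - e\<^sup>2 * (C1 + q * D0 + q\<^sup>2 / 2 * (R + D0 + C1)))
    = a + e * (c - q * a + p * (\<mu> - c) + \<sigma>\<^sup>2 / 2 * A) - Lconst c R r * e\<^sup>2"
    unfolding Lconst_def Let_def m_def[symmetric] k_def[symmetric] B'_def[symmetric] \<rho>_def[symmetric] \<kappa>_def[symmetric] C1_def[symmetric] D0_def[symmetric]
    by (simp add: D_def algebra_simps)
  ultimately have "a + e * (c - q * a + p * (\<mu> - c) + \<sigma>\<^sup>2 / 2 * A) - Lconst c R r * e\<^sup>2 \<le> ?rc * (1 - prob Bad) + x * (Q - B' * prob Bad)"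
    by simp
  then have "ennreal (a + e * (c - q * a + p * (\<mu> - c) + \<sigma>\<^sup>2 / 2 * A) - Lconst c R r * e\<^sup>2) \<le> ennreal (?rc * (1 - prob Bad) + x * (Q - B' * prob Bad))"
    by (rule ennreal_leI)
  then show ?thesis using main by (rule order_trans)
qed

end

section \<open>The limiting value function\<close>

text \<open>Continuity of the grid values is not established, so their maximisers are replaced by
  approximate ones.\<close>

lemma near_max:
  fixes f :: "real \<Rightarrow> real"
  assumes "T \<noteq> {}" "\<And>y. y \<in> T \<Longrightarrow> f y \<le> b" "0 < e"
  obtains z where "z \<in> T" "\<And>y. y \<in> T \<Longrightarrow> f y \<le> f z + e"
proof -
  have bdd: "bdd_above (f ` T)" using assms(2) by (auto intro!: bdd_aboveI)
  have "Sup (f ` T) - e < Sup (f ` T)" using assms by simp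
  then obtain s where s: "s \<in> f ` T" "Sup (f ` T) - e < s"
    using less_cSup_iff[OF _ bdd] assms(1) by blast
  then obtain z where z: "z \<in> T" "Sup (f ` T) - e < f z" by blast
  have "f y \<le> f z + e" if "y \<in> T" for y
    using cSup_upper[OF imageI[OF that, of f] bdd] z(2) by linarith
  then show ?thesis using that z(1) by blast
qed

context bm_model begin

lemma rwd_split:
  assumes d: "0 \<le> d" and c: "0 \<le> c"
  shows "rwd c (2 * d) (\<lambda>s. alive Z (a + s)) = rwd c d (\<lambda>s. alive Z (a + s)) + ennreal (exp (- (q * d))) * rwd c d (\<lambda>s. alive Z (a + d + s))"
proof -
  let ?f = "\<lambda>s. ennreal (exp (- (q * s)) * c)" and ?al = "\<lambda>s. alive Z (a + s)"
  have al[measurable]: "Measurable.pred borel (\<lambda>s. alive Z (b + s))" for b by measurable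
  have "rwd c (2 * d) ?al = (\<integral>\<^sup>+s. ?f s * (if 0 \<le> s \<and> s < d \<and> ?al s then 1 else 0) + ?f s * (if d \<le> s \<and> s < 2 * d \<and> ?al s then 1 else 0) \<partial>lborel)"
    unfolding rwd_def using d by (intro nn_integral_cong) auto
  also have "\<dots> = rwd c d ?al + (\<integral>\<^sup>+s. ?f s * (if d \<le> s \<and> s < 2 * d \<and> ?al s then 1 else 0) \<partial>lborel)"
    unfolding rwd_def by (rule nn_integral_add) measurable
  also have "(\<integral>\<^sup>+s. ?f s * (if d \<le> s \<and> s < 2 * d \<and> ?al s then 1 else 0) \<partial>lborel)
     = (\<integral>\<^sup>+s. ?f (d + 1 * s) * (if d \<le> d + 1 * s \<and> d + 1 * s < 2 * d \<and> ?al (d + 1 * s) then 1 else 0) \<partial>lborel)"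
    by (subst nn_integral_real_affine[where c = 1 and t = d]) auto
  also have "\<dots> = (\<integral>\<^sup>+s. ennreal (exp (- (q * d))) * (?f s * (if 0 \<le> s \<and> s < d \<and> alive Z (a + d + s) then 1 else 0)) \<partial>lborel)"
  proof (rule nn_integral_cong)
    fix s
    have e: "exp (- (q * (d + 1 * s))) * c = exp (- (q * d)) * (exp (- (q * s)) * c)"
      by (simp add: exp_add[symmetric] algebra_simps)
    have "ennreal (exp (- (q * (d + 1 * s))) * c) = ennreal (exp (- (q * d))) * ennreal (exp (- (q * s)) * c)"
      unfolding e by (rule ennreal_mult) (use c in auto)
    then show "?f (d + 1 * s) * (if d \<le> d + 1 * s \<and> d + 1 * s < 2 * d \<and> ?al (d + 1 * s) then 1 else 0)
      = ennreal (exp (- (q * d))) * (?f s * (if 0 \<le> s \<and> s < d \<and> alive Z (a + d + s) then 1 else 0))"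
      by (simp add: mult.assoc add.assoc)
  qed
  also have "\<dots> = ennreal (exp (- (q * d))) * rwd c d (\<lambda>s. alive Z (a + d + s))"
    unfolding rwd_def by (rule nn_integral_cmult) measurable
  finally show ?thesis .
qed

lemma K_add_const:
  assumes e: "0 < e" and f: "f \<in> borel_measurable borel"
  shows "K c e (\<lambda>y. f y + b) y \<le> K c e f y + b"
proof (cases "0 \<le> y")
  case True
  interpret N: prob_space "gauss e" by (rule prob_space_gauss[OF e])
  note [measurable] = f
  have "(\<integral>\<^sup>+z. f (y + (\<mu> - c) * e + \<sigma> * z) + b \<partial>gauss e) = (\<integral>\<^sup>+z. f (y + (\<mu> - c) * e + \<sigma> * z) \<partial>gauss e) + b"
    by (subst nn_integral_add) (auto simp: N.emeasure_space_1)
  moreover have "ennreal (exp (- (q * e))) * b \<le> 1 * b" using q_pos e by (intro mult_right_mono) auto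
  ultimately show ?thesis unfolding K_def using True by (simp add: distrib_left add.assoc add_left_mono)
qed (simp add: K_def)

end

context div_model begin

lemma const_control: "c \<in> S \<Longrightarrow> (\<lambda>_ _. c) \<in> controls M X S c" "grid l (\<lambda>_ _. c)"
  unfolding controls_def grid_def by (auto simp: mono_on_def)

text \<open>Semigroup property of the killed operator. Both sides are the same expected payoff under
  the constant control \<open>c\<close> started at \<open>x\<close>, read as one period of level
  \<open>l\<close> or as two of level \<open>Suc l\<close>.\<close>

lemma P_half_x:
  assumes c: "c \<in> S" and f: "f \<in> borel_measurable borel" and fneg: "\<And>y. y < 0 \<Longrightarrow> f y = 0"
    and fB: "\<And>y. f y \<le> ennreal B" and B: "0 \<le> B" "c \<le> q * B"
  shows "P l c f x = P (Suc l) c (P (Suc l) c f) x"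
proof -
  let ?C = "\<lambda>(_::real) (_::'a). c"
  note C = const_control(1)[OF c] and g = const_control(2)[of _ c]
  have chain: "start l ?C k (\<lambda>_. P l c f) = (\<integral>\<^sup>+\<omega>. Trew l ?C k \<omega> \<partial>M) + ennreal (exp (- (q * (1 / 2^l)))) * start l ?C (Suc k) (\<lambda>_. f)"
    if "f \<in> borel_measurable borel" "\<And>y. y < 0 \<Longrightarrow> f y = 0" "\<And>y. f y \<le> ennreal B" for l k f
    unfolding start_def using P_chain_step(2)[OF C g, where f = "\<lambda>_. f" and B = B and l = l and k = k] that B by simp
  let ?x = "ennreal (exp (- (q * (1 / 2^Suc l))))" and ?T = "\<lambda>l k. \<integral>\<^sup>+\<omega>. Trew l ?C k \<omega> \<partial>M"
  have x2: "ennreal (exp (- (q * (1 / 2^l)))) = ?x * ?x"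
    by (simp add: ennreal_mult[symmetric] exp_add[symmetric])
  have Pf: "P (Suc l) c f \<in> borel_measurable borel" "\<And>y. y < 0 \<Longrightarrow> P (Suc l) c f y = 0" "\<And>y. P (Suc l) c f y \<le> ennreal B"
    using f P_le_bound[OF fB S_nonneg[OF c] B(2)] by (auto simp: P_neg intro: P_measurable)
  have "P (Suc l) c (P (Suc l) c f) x = start (Suc l) ?C 0 (\<lambda>_. P (Suc l) c (P (Suc l) c f))"
    by (rule start_0[symmetric, OF C]) (rule P_neg)
  also have "\<dots> = ?T (Suc l) 0 + ?x * (?T (Suc l) 1 + ?x * start (Suc l) ?C 2 (\<lambda>_. f))"
    using chain[OF Pf, of "Suc l" 0] chain[OF f fneg fB, of "Suc l" 1] by (simp add: numeral_2_eq_2)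
  also have "start (Suc l) ?C 2 (\<lambda>_. f) = start l ?C 1 (\<lambda>_. f)"
  proof -
    have t2: "real 2 * (1 / 2^Suc l) = real 1 * (1 / 2^l :: real)" by simp
    show ?thesis unfolding start_def t2 ..
  qed
  also have "?T (Suc l) 0 + ?x * (?T (Suc l) 1 + ?x * start l ?C 1 (\<lambda>_. f)) = (?T (Suc l) 0 + ?x * ?T (Suc l) 1) + ?x * ?x * start l ?C 1 (\<lambda>_. f)"
    by (simp add: distrib_left add.assoc mult.assoc)
  also have "?T (Suc l) 0 + ?x * ?T (Suc l) 1 = ?T l 0"
  proof -
    have "Trew l ?C 0 \<omega> = Trew (Suc l) ?C 0 \<omega> + ?x * Trew (Suc l) ?C 1 \<omega>" for \<omega>
      unfolding Trew_def using rwd_split[of "1 / 2^Suc l" c "\<lambda>r. Xctrl X ?C r \<omega>" 0] S_nonneg[OF c] by simp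
    then show ?thesis using Trew_measurable[OF C g]
      by (simp add: nn_integral_add nn_integral_cmult)
  qed
  also have "?T l 0 + ?x * ?x * start l ?C 1 (\<lambda>_. f) = start l ?C 0 (\<lambda>_. P l c f)"
    using chain[OF f fneg fB, of l 0] unfolding x2 by simp
  also have "\<dots> = P l c f x" by (rule start_0[OF C]) (rule P_neg)
  finally show ?thesis ..
qed

text \<open>The locale predicate does not mention the initial surplus \<open>x\<close>, so facts proved at \<open>x\<close> can be
  instantiated at every starting point.\<close>

lemma P_half:
  assumes "c \<in> S" "f \<in> borel_measurable borel" "\<And>y. y < 0 \<Longrightarrow> f y = 0" "\<And>y. f y \<le> ennreal B" "0 \<le> B" "c \<le> q * B"
  shows "P l c f y = P (Suc l) c (P (Suc l) c f) y"
  by (rule div_model.P_half_x[OF div_model_axioms]) (use assms in auto)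

section \<open>Grid values, their limit and the dynamic programming inequalities\<close>

definition v :: "nat \<Rightarrow> real \<Rightarrow> real \<Rightarrow> ennreal" where "v l c y = (SUP N. w l N c y)"
definition VV :: "real \<Rightarrow> real \<Rightarrow> ennreal" where "VV c y = (SUP l. v l c y)"
definition vr :: "nat \<Rightarrow> real \<Rightarrow> real \<Rightarrow> real" where "vr l c y = enn2real (v l c y)"
definition V :: "real \<Rightarrow> real \<Rightarrow> real" where "V c y = enn2real (VV c y)"

lemma v_incseq: assumes "c \<in> S" shows "incseq (\<lambda>l. v l c y)"
  unfolding v_def by (rule incseq_SucI, rule div_model.v_inc[OF div_model_axioms assms])

lemma v_measurable [measurable]: "v l c \<in> borel_measurable borel" and VV_measurable [measurable]: "VV c \<in> borel_measurable borel"
  unfolding v_def[abs_def] VV_def[abs_def] by measurable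

lemma v_neg: "y < 0 \<Longrightarrow> v l c y = 0" and VV_neg: "y < 0 \<Longrightarrow> VV c y = 0"
  by (simp_all add: v_def VV_def w_neg)

lemma v_le: "v l c y \<le> ennreal (Max S / q)" and VV_le: "VV c y \<le> ennreal (Max S / q)"
  unfolding v_def VV_def by (auto intro!: SUP_least w_le)

lemma v_le_VV: "v l c y \<le> VV c y" unfolding VV_def by (rule SUP_upper) simp

lemma VV_V: "VV c y = ennreal (V c y)"
  unfolding V_def using le_less_trans[OF VV_le[of c y] ennreal_less_top] by simp

lemma v_vr: "v l c y = ennreal (vr l c y)"
  unfolding vr_def using le_less_trans[OF v_le[of l c y] ennreal_less_top] by simp

lemma V_nonneg: "0 \<le> V c y" and vr_nonneg: "0 \<le> vr l c y" by (simp_all add: V_def vr_def)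

lemma V_le: assumes "S \<noteq> {}" shows "V c y \<le> Max S / q"
  using VV_le[of c y] bound_nonneg[OF assms] unfolding VV_V by simp

lemma vr_le_V: "vr l c y \<le> V c y"
  using v_le_VV[of l c y] unfolding VV_V v_vr using V_nonneg by simp

lemma V_measurable [measurable]: "V c \<in> borel_measurable borel" and vr_measurable [measurable]: "vr l c \<in> borel_measurable borel"
  unfolding V_def[abs_def] vr_def[abs_def] by measurable

lemma V_neg: "y < 0 \<Longrightarrow> V c y = 0" by (simp add: V_def VV_neg)

lemma V_mono: "y \<le> y' \<Longrightarrow> V c y \<le> V c y'"
proof -
  assume "y \<le> y'"
  then have "VV c y \<le> VV c y'" unfolding VV_def v_def by (intro SUP_mono' monoD[OF w_mono_point])
  then show ?thesis unfolding VV_V using V_nonneg by simp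
qed

lemma V_anti: "c \<le> c' \<Longrightarrow> V c' y \<le> V c y"
proof -
  assume "c \<le> c'"
  then have "VV c' y \<le> VV c y" unfolding VV_def v_def by (intro SUP_mono' w_anti)
  then show ?thesis unfolding VV_V using V_nonneg by simp
qed

lemma vr_tendsto: assumes "c \<in> S" shows "(\<lambda>l. vr l c y) \<longlonglongrightarrow> V c y"
proof -
  have "(\<lambda>l. v l c y) \<longlonglongrightarrow> VV c y" unfolding VV_def by (rule LIMSEQ_SUP[OF v_incseq[OF assms]])
  then show ?thesis unfolding VV_V v_vr using V_nonneg vr_nonneg by simp
qed

lemma c_le_bound: "c \<in> S \<Longrightarrow> c \<le> q * (Max S / q)" using S_le_Max q_pos by simp

lemma v_super: assumes c: "c \<in> S" shows "P l c (v l c) y \<le> v l c y"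
proof -
  have ne: "S \<noteq> {}" using c by auto
  have "P l c (v l c) y \<le> (SUP N. P l c (w l N c) y)"
    unfolding v_def[abs_def]
    by (rule P_SUP_le[OF S_nonneg[OF c] _ _ _ bound_nonneg[OF ne]]) (auto intro: w_neg w_le w_incseq simp del: w.simps)
  also have "\<dots> \<le> v l c y" unfolding v_def
  proof (rule SUP_least)
    fix N
    have "P l c (w l N c) y \<le> w l (Suc N) c y" by (rule w_ge_P[OF c])
    also have "\<dots> \<le> (SUP N. w l N c y)" by (rule SUP_upper) simp
    finally show "P l c (w l N c) y \<le> (SUP N. w l N c y)" .
  qed
  finally show ?thesis .
qed

text \<open>The level of \<open>P\<close> must stay fixed while the grid is refined. For l \<le> l',
  repeated halving of the period reduces \<open>P l\<close> to \<open>P l'\<close>, for which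
  \<open>v_super\<close> holds; then \<open>P_SUP_le\<close> lets l' tend to infinity.\<close>

lemma VV_super: assumes c: "c \<in> S" shows "P l c (VV c) y \<le> VV c y"
proof -
  have ne: "S \<noteq> {}" using c by auto
  have lv: "P l c (v l' c) y \<le> v l' c y" if "l \<le> l'" for l l' y
    using that
  proof (induction arbitrary: y rule: inc_induct)
    case base show ?case by (rule v_super[OF c])
  next
    case (step l)
    have "P l c (v l' c) y = P (Suc l) c (P (Suc l) c (v l' c)) y"
      by (rule P_half[OF c _ _ _ bound_nonneg[OF ne] c_le_bound[OF c]]) (auto intro: v_neg v_le)
    also have "\<dots> \<le> P (Suc l) c (v l' c) y" by (rule P_mono) (rule step)
    also have "\<dots> \<le> v l' c y" by (rule step)
    finally show ?case .
  qed
  have shift: "VV c = (\<lambda>y. SUP n. v (l + n) c y)"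
  proof
    fix y
    show "VV c y = (SUP n. v (l + n) c y)"
    proof (rule antisym)
      show "VV c y \<le> (SUP n. v (l + n) c y)" unfolding VV_def
      proof (rule SUP_least)
        fix n
        have "v n c y \<le> v (l + n) c y" by (rule incseqD[OF v_incseq[OF c]]) simp
        then show "v n c y \<le> (SUP n. v (l + n) c y)" by (rule SUP_upper2[rotated]) simp
      qed
    qed (auto intro!: SUP_least v_le_VV)
  qed
  have "P l c (VV c) y \<le> (SUP n. P l c (v (l + n) c) y)"
    unfolding shift
    by (rule P_SUP_le[OF S_nonneg[OF c] _ _ _ bound_nonneg[OF ne]])
      (auto intro: v_neg v_le intro!: incseq_SucI incseqD[OF v_incseq[OF c]])
  also have "\<dots> \<le> VV c y" by (rule SUP_least) (auto intro: order_trans[OF lv v_le_VV])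
  finally show ?thesis .
qed

text \<open>The first rate is either \<open>c\<close>, which gives the kernel term, or at least the
  next rate \<open>c1\<close>, which gives a value of the next problem. \<open>K\<close> stands in
  for \<open>P\<close> because an upper bound suffices and its Gaussian form fits
  \<open>K_upper\<close>.\<close>

lemma v_sub:
  assumes c: "c \<in> S" and next_S: "\<And>c'. c' \<in> S \<Longrightarrow> c < c' \<Longrightarrow> c1 \<le> c'"
  shows "v l c y \<le> max (K c (1 / 2^l) (v l c) y) (v l c1 y)"
proof -
  have "w l N c y \<le> max (K c (1 / 2^l) (v l c) y) (v l c1 y)" for N
  proof (cases N)
    case (Suc n)
    have "P l c' (w l n c') y \<le> max (K c (1 / 2^l) (v l c) y) (v l c1 y)" if c': "c' \<in> S" "c \<le> c'" for c'
    proof (cases "c' = c")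
      case True
      have "P l c' (w l n c') y \<le> P l c (v l c) y" unfolding True
        by (rule P_mono) (auto simp: v_def intro: SUP_upper)
      also have "\<dots> \<le> K c (1 / 2^l) (v l c) y" by (rule P_le_K)
      finally show ?thesis by (simp add: le_max_iff_disj)
    next
      case False
      then have "c1 \<le> c'" using c' next_S by simp
      then have "P l c' (w l n c') y \<le> w l (Suc n) c1 y" using c' by (auto intro!: SUP_upper)
      also have "\<dots> \<le> v l c1 y" unfolding v_def by (rule SUP_upper) simp
      finally show ?thesis by (simp add: le_max_iff_disj)
    qed
    then show ?thesis unfolding Suc w.simps by (intro SUP_least) auto
  qed simp
  then show ?thesis unfolding v_def[of l c] by (rule SUP_least)
qed

end

section \<open>Growth at 0, viscosity inequalities, regularity and the limit at infinity\<close>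

context div_model begin

text \<open>Along 2^m steps of length 2^-(l+m) the errors C * e^2 add up to at most C / 2^m, since
  by \<open>K_add_const\<close> a step does not amplify constants. Letting m grow removes
  them.\<close>

lemma P_le_of_K_le:
  assumes f: "f \<in> borel_measurable borel" and C: "0 \<le> C"
    and K: "\<And>e y. 0 < e \<Longrightarrow> e \<le> 1 \<Longrightarrow> K c e f y \<le> f y + ennreal (C * e\<^sup>2)"
  shows "P l c f y \<le> f y"
proof -
  have pow: "(K c e ^^ n) f y \<le> f y + ennreal (real n * (C * e\<^sup>2))" if e: "0 < e" "e \<le> 1" for e n y
  proof (induction n arbitrary: y)
    case (Suc n)
    have "(K c e ^^ Suc n) f y = K c e ((K c e ^^ n) f) y" by simp
    also have "\<dots> \<le> K c e (\<lambda>y. f y + ennreal (real n * (C * e\<^sup>2))) y" by (rule K_mono) (rule Suc)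
    also have "\<dots> \<le> K c e f y + ennreal (real n * (C * e\<^sup>2))" by (rule K_add_const[OF e(1) f])
    also have "\<dots> \<le> (f y + ennreal (C * e\<^sup>2)) + ennreal (real n * (C * e\<^sup>2))" by (intro add_right_mono K e)
    also have "\<dots> = f y + ennreal (real (Suc n) * (C * e\<^sup>2))"
      using C by (simp add: add.assoc ennreal_plus[symmetric] algebra_simps del: ennreal_plus)
    finally show ?case .
  qed simp
  have b: "P l c f y \<le> f y + ennreal (C / 2^m)" for m
  proof -
    let ?e = "1 / 2^l / 2^m :: real"
    have e: "0 < ?e" "?e \<le> 1" by (auto simp: field_simps power_add[symmetric])
    have "P l c f y \<le> (K c ?e ^^ (2^m)) f y" unfolding P_def by (rule INF_lower) simp
    also have "\<dots> \<le> f y + ennreal (real (2^m) * (C * ?e\<^sup>2))" by (rule pow[OF e])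
    also have "\<dots> \<le> f y + ennreal (C / 2^m)"
    proof (intro add_left_mono ennreal_leI)
      have "real (2^m) * (C * ?e\<^sup>2) = C * (1 / 2^l)\<^sup>2 / 2^m" by (simp add: power2_eq_square)
      also have "\<dots> \<le> C * 1 / 2^m" using C by (intro divide_right_mono mult_left_mono power_le_one) auto
      finally show "real (2^m) * (C * ?e\<^sup>2) \<le> C / 2^m" by simp
    qed
    finally show ?thesis .
  qed
  have "(\<lambda>m. f y + ennreal (C * (1/2)^m)) \<longlonglongrightarrow> f y + ennreal (C * 0)"
    by (intro tendsto_intros tendsto_ennrealI LIMSEQ_power_zero) auto
  then have "(\<lambda>m. f y + ennreal (C / 2^m)) \<longlonglongrightarrow> f y" by (simp add: power_divide)
  then show ?thesis by (rule LIMSEQ_le_const) (use b in auto)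
qed

text \<open>The barrier is a steep concave parabola \<open>Q\<close> capped at \<open>B\<close>. With ruin monitored on a grid the
  surplus overshoots 0, so \<open>Q\<close> is shifted by \<open>\<kappa> > 0\<close>: it is then nonnegative beyond 0, and a step of
  length \<open>e\<close> costs only \<open>O(e ^ 2)\<close>.\<close>

lemma V_linear_bound: assumes ne: "S \<noteq> {}" shows "\<exists>A\<ge>0. \<forall>c. \<forall>y\<ge>0. V c y \<le> A * y"
proof -
  define B where "B = Max S / q"
  have B: "0 \<le> B" unfolding B_def by (rule bound_nonneg[OF ne])
  have MS: "0 \<le> Max S" using S_nonneg[OF Max_in[OF S_finite ne]] .
  define m0 where "m0 = \<bar>\<mu>\<bar> + Max S"
  have m0: "0 \<le> m0" using MS by (simp add: m0_def)
  \<comment> \<open>Makes \<sigma>^2/2 * D exceed A times the drift bound \<open>m0\<close> by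
    \<open>A\<close>, a margin that absorbs the reward rate.\<close>
  define k0 where "k0 = 2 * (m0 + 1) / \<sigma>\<^sup>2"
  have k0: "0 < k0" "\<sigma>\<^sup>2 / 2 * k0 = m0 + 1" using m0 sigma_pos by (auto simp: k0_def)
  \<comment> \<open>The apex of \<open>Q\<close> is at 1/k0 with value A / (2 * k0). This choice
    lifts it to at least B + 1, which leaves room 1 for stepping past the apex, and A \<ge> Max S
    pays the reward.\<close>
  define A where "A = 2 * k0 * (B + 1) + Max S"
  have "0 < 2 * k0 * (B + 1)" using k0 B by (intro mult_pos_pos) auto
  then have A: "0 < A" "Max S \<le> A" using MS unfolding A_def by linarith+
  define D where "D = k0 * A"
  have D: "0 < D" using k0 A by (simp add: D_def)
  define Q where "Q u = A * u - D / 2 * u\<^sup>2" for u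
  have Q1: "B + 1 \<le> Q (1 / k0)"
  proof -
    have "Q (1 / k0) = A / (2 * k0)" using k0 by (simp add: Q_def D_def power2_eq_square field_simps)
    also have "\<dots> \<ge> (2 * k0 * (B + 1)) / (2 * k0)" using MS k0 by (intro divide_right_mono) (auto simp: A_def)
    finally show ?thesis using k0 by simp
  qed
  have Qexp: "Q (u + d) = Q u + (A - D * u) * d + (- D) / 2 * d\<^sup>2" for u d
    by (simp add: Q_def power2_eq_square algebra_simps)
  have Qpos: "0 \<le> Q u" if "0 \<le> u" "u \<le> 2 / k0" for u
  proof -
    have "Q u = A * u * (1 - k0 * u / 2)" by (simp add: Q_def D_def power2_eq_square algebra_simps)
    moreover have "k0 * u / 2 \<le> 1" using that k0 by (simp add: field_simps)
    ultimately show ?thesis using A that by simp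
  qed
  have wk: "w l N c y \<le> ennreal (A * (y + \<kappa>))" if kap: "0 < \<kappa>" and y: "0 \<le> y" for \<kappa> l N c y
  proof -
    define \<Phi> where "\<Phi> y = (if y < 0 then 0 else if y + \<kappa> < 1 / k0 then min B (Q (y + \<kappa>)) else B)" for y
    have \<Phi>m: "\<Phi> \<in> borel_measurable borel" unfolding \<Phi>_def Q_def by measurable
    have \<Phi>B: "\<Phi> y \<le> B" for y using B by (simp add: \<Phi>_def)
    have half: "1 / k0 \<le> 2 / k0" using k0 by (simp add: divide_right_mono)
    have \<Phi>0: "0 \<le> \<Phi> y" for y using B Qpos[of "y + \<kappa>"] kap half by (auto simp: \<Phi>_def)
    \<comment> \<open>r \<le> \<kappa> keeps the shifted argument nonnegative when the surplus steps
      below 0, r \<le> 1/k0 keeps it below the second zero 2/k0 of \<open>Q\<close>, and the bounds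
      1 and 1 / (D + 1) make \<open>Q\<close> fall by at most 1 beyond its apex.\<close>
    define r where "r = min (min \<kappa> 1) (min (1 / k0) (1 / (D + 1)))"
    have r: "0 < r" "r \<le> \<kappa>" "r \<le> 1" "r \<le> 1 / k0" "r \<le> 1 / (D + 1)" using kap k0 D by (auto simp: r_def)
    have Dr: "D / 2 * r\<^sup>2 \<le> 1"
    proof -
      have "D * r \<le> D * (1 / (D + 1))" using r D by (intro mult_left_mono) auto
      also have "\<dots> \<le> 1" using D by simp
      finally have "D * r * r \<le> 1 * 1" using r D by (intro mult_mono) auto
      then show ?thesis by (simp add: power2_eq_square)
    qed
    define R where "R = B + A + D"
    have Kc: "K c e (\<lambda>y. ennreal (\<Phi> y)) y \<le> ennreal (\<Phi> y) + ennreal (\<bar>Kconst c B R r\<bar> * e\<^sup>2)"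
      if c: "c \<in> S" and e: "0 < e" "e \<le> 1" for c e y
    \<comment> \<open>Where the cap is active the constant bound \<open>K_le_bound\<close> does the
      work, so the expansion is needed only on the parabola.\<close>
    proof (cases "y < 0 \<or> \<Phi> y = B")
      case True
      then show ?thesis
      proof
        assume "y < 0" then show ?thesis by (simp add: K_def)
      next
        assume y: "\<Phi> y = B"
        have "K c e (\<lambda>y. ennreal (\<Phi> y)) y \<le> ennreal B"
          by (rule K_le_bound[OF e(1) _ S_nonneg[OF c]]) (use \<Phi>B c_le_bound[OF c] in \<open>auto simp: B_def intro!: ennreal_leI\<close>)
        then show ?thesis using y by (simp add: add_increasing2)
      qed
    next
      case False
      then have y: "0 \<le> y" "y + \<kappa> < 1 / k0" and a: "\<Phi> y = Q (y + \<kappa>)" "Q (y + \<kappa>) \<le> B"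
        by (auto simp: \<Phi>_def min_def split: if_splits)
      define p where "p = A - D * (y + \<kappa>)"
      have p: "0 \<le> p" "p \<le> A"
      proof -
        have "D * (y + \<kappa>) \<le> D * (1 / k0)" using y D by (intro mult_left_mono) auto
        then show "0 \<le> p" using k0 by (simp add: p_def D_def)
        show "p \<le> A" using D y kap by (simp add: p_def)
      qed
      have "K c e (\<lambda>y. ennreal (\<Phi> y)) y \<le> ennreal (\<Phi> y + e * (c - q * \<Phi> y + p * (\<mu> - c) + \<sigma>\<^sup>2 / 2 * (- D)) + Kconst c B R r * e\<^sup>2)"
      proof (rule K_upper[OF e S_nonneg[OF c] r(1) \<Phi>m \<Phi>0 \<Phi>B])
        show "\<bar>\<Phi> y\<bar> \<le> R" "\<bar>p\<bar> \<le> R" "\<bar>- D\<bar> \<le> R" using \<Phi>0[of y] \<Phi>B[of y] p A D B by (auto simp: R_def)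
        fix d assume d: "\<bar>d\<bar> < r"
        have "\<Phi> (y + d) \<le> Q (y + \<kappa> + d)"
        proof -
          have u: "0 \<le> y + \<kappa> + d" "y + \<kappa> + d \<le> 2 / k0" using d r y by (auto simp: field_simps)
          consider "y + d < 0" | "0 \<le> y + d" "y + d + \<kappa> < 1 / k0" | "0 \<le> y + d" "1 / k0 \<le> y + d + \<kappa>" by linarith
          then show ?thesis
          proof cases
            case 1 then show ?thesis using Qpos[OF u] by (simp add: \<Phi>_def)
          next
            case 2 then show ?thesis by (simp add: \<Phi>_def add.commute add.left_commute)
          next
            case 3
            define t where "t = y + \<kappa> + d - 1 / k0"
            have t: "0 \<le> t" "t \<le> r" using 3 y d by (auto simp: t_def)
            have "Q (y + \<kappa> + d) = Q (1 / k0) + (A - D * (1 / k0)) * t + (- D) / 2 * t\<^sup>2"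
            proof -
              have "y + \<kappa> + d = 1 / k0 + t" by (simp add: t_def)
              then show ?thesis by (simp only: Qexp)
            qed
            also have "A - D * (1 / k0) = 0" using k0 by (simp add: D_def)
            finally have "Q (y + \<kappa> + d) = Q (1 / k0) - D / 2 * t\<^sup>2" by simp
            moreover have "D / 2 * t\<^sup>2 \<le> D / 2 * r\<^sup>2" using t D by (intro mult_left_mono power_mono) auto
            ultimately have "B \<le> Q (y + \<kappa> + d)" using Q1 Dr by linarith
            then show ?thesis using \<Phi>B[of "y + d"] by linarith
          qed
        qed
        then show "\<Phi> (y + d) \<le> \<Phi> y + p * d + (- D) / 2 * d\<^sup>2" unfolding a Qexp p_def .
      qed (rule y(1))
      also have "\<dots> \<le> ennreal (\<Phi> y + \<bar>Kconst c B R r\<bar> * e\<^sup>2)"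
      proof (rule ennreal_leI)
        have cS: "0 \<le> c" "c \<le> Max S" using S_nonneg[OF c] S_le_Max[OF c] by auto
        have "p * (\<mu> - c) \<le> A * m0"
        proof -
          have "p * (\<mu> - c) \<le> p * m0" using p cS by (intro mult_left_mono) (auto simp: m0_def)
          also have "\<dots> \<le> A * m0" using p m0 by (intro mult_right_mono) auto
          finally show ?thesis .
        qed
        moreover have "\<sigma>\<^sup>2 / 2 * (- D) = - (A * m0 + A)"
        proof -
          have "\<sigma>\<^sup>2 / 2 * (- D) = - ((\<sigma>\<^sup>2 / 2 * k0) * A)" by (simp add: D_def)
          then show ?thesis unfolding k0(2) by (simp add: algebra_simps)
        qed
        moreover have "0 \<le> q * \<Phi> y" using q_pos \<Phi>0[of y] by simp
        ultimately have "c - q * \<Phi> y + p * (\<mu> - c) + \<sigma>\<^sup>2 / 2 * (- D) \<le> 0" using cS A by linarith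
        then have "e * (c - q * \<Phi> y + p * (\<mu> - c) + \<sigma>\<^sup>2 / 2 * (- D)) \<le> 0" using e by (simp add: mult_nonneg_nonpos)
        moreover have "Kconst c B R r * e\<^sup>2 \<le> \<bar>Kconst c B R r\<bar> * e\<^sup>2" by (intro mult_right_mono) auto
        ultimately show "\<Phi> y + e * (c - q * \<Phi> y + p * (\<mu> - c) + \<sigma>\<^sup>2 / 2 * (- D)) + Kconst c B R r * e\<^sup>2 \<le> \<Phi> y + \<bar>Kconst c B R r\<bar> * e\<^sup>2"
          by linarith
      qed
      also have "\<dots> = ennreal (\<Phi> y) + ennreal (\<bar>Kconst c B R r\<bar> * e\<^sup>2)" using \<Phi>0 by (simp add: ennreal_plus)
      finally show ?thesis .
    qed
    have PL: "P l c (\<lambda>y. ennreal (\<Phi> y)) y \<le> ennreal (\<Phi> y)" if "c \<in> S" for l c y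
      by (rule P_le_of_K_le[where C = "\<bar>Kconst c B R r\<bar>"]) (use \<Phi>m Kc[OF that] in auto)
    have "w l N c y \<le> ennreal (\<Phi> y)" for N c y
    proof (induction N arbitrary: c y)
      case (Suc N)
      have "P l c' (w l N c') y \<le> ennreal (\<Phi> y)" if "c' \<in> S" for c'
        by (rule order_trans[OF P_mono[OF Suc] PL[OF that]])
      then show ?case by (auto intro!: SUP_least)
    qed simp
    also have "ennreal (\<Phi> y) \<le> ennreal (A * (y + \<kappa>))"
    proof (rule ennreal_leI)
      show "\<Phi> y \<le> A * (y + \<kappa>)"
      proof (cases "y + \<kappa> < 1 / k0")
        case True
        have "\<Phi> y \<le> Q (y + \<kappa>)" using y True by (simp add: \<Phi>_def)
        also have "\<dots> \<le> A * (y + \<kappa>)" using D by (simp add: Q_def)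
        finally show ?thesis .
      next
        case False
        have "B \<le> Q (1 / k0)" using Q1 by simp
        also have "\<dots> \<le> A * (1 / k0)" using D by (simp add: Q_def)
        also have "\<dots> \<le> A * (y + \<kappa>)" using False A by (intro mult_left_mono) auto
        finally show ?thesis using \<Phi>B[of y] by linarith
      qed
    qed
    finally show ?thesis .
  qed
  have "V c y \<le> A * y" if y: "0 \<le> y" for c y
  proof (rule field_le_epsilon)
    fix e :: real assume e: "0 < e"
    have "VV c y \<le> ennreal (A * (y + e / A))"
      unfolding VV_def v_def using e A y by (intro SUP_least wk) auto
    then have "V c y \<le> A * (y + e / A)" unfolding VV_V using V_nonneg e A y by simp
    then show "V c y \<le> A * y + e" using A by (simp add: algebra_simps)
  qed
  then show ?thesis using A by (intro exI[of _ A]) auto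
qed

lemma V_zero: assumes "S \<noteq> {}" shows "V c 0 = 0"
  using V_linear_bound[OF assms] V_nonneg[of c 0] by (metis antisym mult_zero_right order_refl)

text \<open>Only an approximating sequence \<open>zs\<close> has to touch the jet in the limit, so the lemma applies to
  infima of \<open>V c - h\<close> before \<open>V c\<close> is known to be continuous.\<close>

lemma V_super_jet:
  assumes c: "c \<in> S" and r: "0 < r" "r \<le> z"
    and near: "\<And>y. \<bar>y - z\<bar> < r \<Longrightarrow> a + p * (y - z) + A / 2 * (y - z)\<^sup>2 \<le> V c y"
    and zs: "zs \<longlonglongrightarrow> z" and lim: "(\<lambda>k. V c (zs k)) \<longlonglongrightarrow> a"
  shows "\<sigma>\<^sup>2 / 2 * A + (\<mu> - c) * p - q * a + c \<le> 0"
proof -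
  have ne: "S \<noteq> {}" using c by auto
  define R where "R = \<bar>a\<bar> + \<bar>p\<bar> + \<bar>A\<bar> + 1"
  \<comment> \<open>\<open>P_lower\<close> needs the jet centred at the point where it is applied:
    \<open>ak k\<close> and \<open>pk k\<close> are value and slope of the parabola at
    \<open>zs k\<close>.\<close>
  define ak where "ak k = a + p * (zs k - z) + A / 2 * (zs k - z)\<^sup>2" for k
  define pk where "pk k = p + A * (zs k - z)" for k
  have akl: "ak \<longlonglongrightarrow> a"
  proof -
    have "ak \<longlonglongrightarrow> a + p * (z - z) + A / 2 * (z - z)\<^sup>2" unfolding ak_def by (intro tendsto_intros zs)
    then show ?thesis by simp
  qed
  have pkl: "pk \<longlonglongrightarrow> p"
  proof -
    have "pk \<longlonglongrightarrow> p + A * (z - z)" unfolding pk_def by (intro tendsto_intros zs)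
    then show ?thesis by simp
  qed
  define L where "L = c - q * a + p * (\<mu> - c) + \<sigma>\<^sup>2 / 2 * A"
  define Cc where "Cc = Lconst c R (r / 2)"
  \<comment> \<open>For a fixed period length k tends to infinity first, when
    \<open>V c (zs k)\<close> and the value of the jet both tend to \<open>a\<close> and cancel.
    Only then is the step length divided out and sent to 0.\<close>
  have step: "L \<le> Cc * (1 / 2^l)" if l: "\<bar>\<mu> - c\<bar> * (1 / 2^l) < r / 2 / 2" for l
  proof -
    let ?e = "1 / 2^l :: real"
    have ev: "eventually (\<lambda>k. ak k + ?e * (c - q * ak k + pk k * (\<mu> - c) + \<sigma>\<^sup>2 / 2 * A) - Cc * ?e\<^sup>2 \<le> V c (zs k)) sequentially"
    proof -
      have e1: "eventually (\<lambda>k. \<bar>zs k - z\<bar> < r / 2) sequentially"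
        using tendstoD[OF zs, of "r / 2"] r by (simp add: dist_real_def)
      have e2: "eventually (\<lambda>k. \<bar>ak k - a\<bar> < 1) sequentially" using tendstoD[OF akl, of 1] by (simp add: dist_real_def)
      have e3: "eventually (\<lambda>k. \<bar>pk k - p\<bar> < 1) sequentially" using tendstoD[OF pkl, of 1] by (simp add: dist_real_def)
      show ?thesis using e1 e2 e3
      proof eventually_elim
        case (elim k)
        have "ennreal (ak k + ?e * (c - q * ak k + pk k * (\<mu> - c) + \<sigma>\<^sup>2 / 2 * A) - Cc * ?e\<^sup>2) \<le> P l c (\<lambda>y. ennreal (V c y)) (zs k)"
          unfolding Cc_def
        proof (rule P_lower[OF S_nonneg[OF c] _ _ l V_measurable V_nonneg V_le[OF ne] V_neg])
          show "0 < r / 2" using r by simp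
          show "r / 2 \<le> zs k" using r elim(1) by linarith
          show "\<bar>ak k\<bar> \<le> R" "\<bar>pk k\<bar> \<le> R" "\<bar>A\<bar> \<le> R" using elim by (auto simp: R_def)
          fix d :: real assume d: "\<bar>d\<bar> < r / 2"
          have "a + p * (zs k + d - z) + A / 2 * (zs k + d - z)\<^sup>2 \<le> V c (zs k + d)"
          proof (rule near)
            show "\<bar>zs k + d - z\<bar> < r" using d elim(1) by linarith
          qed
          then show "ak k + pk k * d + A / 2 * d\<^sup>2 \<le> V c (zs k + d)"
            unfolding ak_def pk_def by (simp add: power2_eq_square algebra_simps add_divide_distrib diff_divide_distrib)
        qed
        also have "\<dots> \<le> ennreal (V c (zs k))" using VV_super[OF c, of l "zs k"] unfolding VV_V[abs_def] .
        finally show ?case using V_nonneg by (simp add: ennreal_le_iff)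
      qed
    qed
    have "(\<lambda>k. ak k + ?e * (c - q * ak k + pk k * (\<mu> - c) + \<sigma>\<^sup>2 / 2 * A) - Cc * ?e\<^sup>2) \<longlonglongrightarrow> a + ?e * (c - q * a + p * (\<mu> - c) + \<sigma>\<^sup>2 / 2 * A) - Cc * ?e\<^sup>2"
      by (intro tendsto_intros akl pkl)
    then have "a + ?e * L - Cc * ?e\<^sup>2 \<le> a" unfolding L_def using ev lim by (intro tendsto_le[OF sequentially_bot])
    then have "?e * L \<le> ?e * (Cc * ?e)" by (simp add: power2_eq_square algebra_simps)
    then show ?thesis by (rule mult_left_le_imp_le) simp
  qed
  have p2: "(\<lambda>l. K * (1 / 2^l)) \<longlonglongrightarrow> 0" for K :: real
  proof -
    have "(\<lambda>l. K * (1/2)^l) \<longlonglongrightarrow> K * 0" by (intro tendsto_intros LIMSEQ_power_zero) auto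
    then show ?thesis by (simp add: power_divide)
  qed
  have "eventually (\<lambda>l. \<bar>\<mu> - c\<bar> * (1 / 2^l) < r / 2 / 2) sequentially"
    using r by (intro order_tendstoD(2)[OF p2]) simp
  then have "eventually (\<lambda>l. L \<le> Cc * (1 / 2^l)) sequentially" by eventually_elim (rule step)
  then have "L \<le> 0" by (intro tendsto_lowerbound[OF p2[of Cc]]) auto
  then show ?thesis by (simp add: L_def algebra_simps)
qed

text \<open>Raising the curvature by \<open>e0\<close> makes the contact at \<open>x0\<close>
  strict, so near-maximisers are forced to converge to \<open>x0\<close>. Strict inequality with the
  obstacle persists there, which leaves only the kernel branch of \<open>v_sub\<close>.\<close>

lemma V_sub_jet:
  assumes c: "c \<in> S" and next_S: "\<And>c'. c' \<in> S \<Longrightarrow> c < c' \<Longrightarrow> c1 \<le> c'"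
    and r0: "0 < r0" "r0 \<le> x0" and cont: "isCont (V c1) x0" and less: "V c1 x0 < V c x0"
    and near: "\<And>y. \<bar>y - x0\<bar> < r0 \<Longrightarrow> V c y \<le> V c x0 + p * (y - x0) + A / 2 * (y - x0)\<^sup>2"
  shows "0 \<le> \<sigma>\<^sup>2 / 2 * A + (\<mu> - c) * p - q * V c x0 + c"
proof -
  have ne: "S \<noteq> {}" using c by auto
  have main: "0 \<le> \<sigma>\<^sup>2 / 2 * (A + e0) + (\<mu> - c) * p - q * V c x0 + c" if e0: "0 < e0" for e0
  proof -
    define A' where "A' = A + e0"
    define \<psi> where "\<psi> y = V c x0 + p * (y - x0) + A' / 2 * (y - x0)\<^sup>2" for y
    \<comment> \<open>A third of the gap: one part for the variation of the obstacle, one for that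
      of \<psi>, one for the deficit \<theta> of the near-maximiser.\<close>
    define \<eta> where "\<eta> = (V c x0 - V c1 x0) / 3"
    have \<eta>: "0 < \<eta>" using less by (simp add: \<eta>_def)
    obtain r1 where r1: "r1 > 0" "\<And>y. \<bar>y - x0\<bar> < r1 \<Longrightarrow> \<bar>V c1 y - V c1 x0\<bar> < \<eta>"
      using isCont_ball[OF cont \<eta>] by blast
    have c\<psi>: "isCont \<psi> x0" unfolding \<psi>_def by (intro continuous_intros)
    obtain r2 where r2: "r2 > 0" "\<And>y. \<bar>y - x0\<bar> < r2 \<Longrightarrow> \<bar>\<psi> y - \<psi> x0\<bar> < \<eta>"
      using isCont_ball[OF c\<psi> \<eta>] by blast
    define r where "r = min r0 (min r1 r2)"
    have r: "0 < r" "r \<le> r0" "r \<le> r1" "r \<le> r2" using r0 r1 r2 by (auto simp: r_def)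
    have \<psi>x: "\<psi> x0 = V c x0" by (simp add: \<psi>_def)
    have below: "vr l c y - \<psi> y \<le> - (e0 / 2 * (y - x0)\<^sup>2)" if "\<bar>y - x0\<bar> < r" for l y
    proof -
      have "A' / 2 * (y - x0)\<^sup>2 = A / 2 * (y - x0)\<^sup>2 + e0 / 2 * (y - x0)\<^sup>2" by (simp add: A'_def field_simps)
      moreover have "vr l c y \<le> V c x0 + p * (y - x0) + A / 2 * (y - x0)\<^sup>2"
        using vr_le_V[of l c y] near[of y] that r by linarith
      ultimately show ?thesis unfolding \<psi>_def by linarith
    qed
    define e where "e l = (1 / 2^l :: real)" for l :: nat
    have e: "0 < e l" "e l \<le> 1" for l by (auto simp: e_def)
    have el: "e \<longlonglongrightarrow> 0"
    proof -
      have "(\<lambda>l. (1/2::real)^l) \<longlonglongrightarrow> 0" by (rule LIMSEQ_power_zero) simp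
      then show ?thesis by (simp add: e_def[abs_def] power_divide)
    qed
    \<comment> \<open>The tolerance (e l)^2 has the order of the error in \<open>K_upper\<close> and
      is negligible against the step length.\<close>
    have "\<exists>z. \<bar>z - x0\<bar> < r \<and> (\<forall>y. \<bar>y - x0\<bar> < r \<longrightarrow> vr l c y - \<psi> y \<le> vr l c z - \<psi> z + (e l)\<^sup>2)" for l
    proof -
      have "0 < (e l)\<^sup>2" using e[of l] by simp
      moreover have "vr l c y - \<psi> y \<le> 0" if "y \<in> {y. \<bar>y - x0\<bar> < r}" for y
      proof -
        have "0 \<le> e0 / 2 * (y - x0)\<^sup>2" using e0 by simp
        then show ?thesis using below[of y l] that by simp
      qed
      moreover have "{y. \<bar>y - x0\<bar> < r} \<noteq> {}" using r by (auto intro!: exI[of _ x0])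
      ultimately obtain z where "z \<in> {y. \<bar>y - x0\<bar> < r}" "\<And>y. y \<in> {y. \<bar>y - x0\<bar> < r} \<Longrightarrow> vr l c y - \<psi> y \<le> vr l c z - \<psi> z + (e l)\<^sup>2"
        using near_max[of "{y. \<bar>y - x0\<bar> < r}" "\<lambda>y. vr l c y - \<psi> y" 0 "(e l)\<^sup>2"] by metis
      then show ?thesis by auto
    qed
    then obtain z where z: "\<And>l. \<bar>z l - x0\<bar> < r" "\<And>l y. \<bar>y - x0\<bar> < r \<Longrightarrow> vr l c y - \<psi> y \<le> vr l c (z l) - \<psi> (z l) + (e l)\<^sup>2"
      by metis
    \<comment> \<open>Bounds how far the near-maximiser can lie below contact, by comparison with
      the point \<open>x0\<close>; it tends to 0 because \<open>vr l c x0\<close> converges.\<close>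
    define \<theta> where "\<theta> l = V c x0 - vr l c x0 + (e l)\<^sup>2" for l
    have \<theta>l: "\<theta> \<longlonglongrightarrow> 0"
    proof -
      have "\<theta> \<longlonglongrightarrow> V c x0 - V c x0 + 0\<^sup>2" unfolding \<theta>_def by (intro tendsto_intros vr_tendsto[OF c] el)
      then show ?thesis by simp
    qed
    have zlow: "- \<theta> l \<le> vr l c (z l) - \<psi> (z l)" for l
      using z(2)[of x0 l] r \<psi>x by (simp add: \<theta>_def)
    have zsq: "(z l - x0)\<^sup>2 \<le> 2 / e0 * \<theta> l" for l
      using zlow[of l] below[OF z(1), of l l] e0 by (simp add: field_simps)
    have "(\<lambda>l. (z l - x0)\<^sup>2) \<longlonglongrightarrow> 0"
    proof (rule tendsto_sandwich[of "\<lambda>_. 0" _ _ "\<lambda>l. 2 / e0 * \<theta> l"])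
      have "(\<lambda>l. 2 / e0 * \<theta> l) \<longlonglongrightarrow> 2 / e0 * 0" by (intro tendsto_intros \<theta>l)
      then show "(\<lambda>l. 2 / e0 * \<theta> l) \<longlonglongrightarrow> 0" by simp
    qed (use zsq in auto)
    then have "(\<lambda>l. sqrt ((z l - x0)\<^sup>2)) \<longlonglongrightarrow> sqrt 0" by (intro tendsto_intros)
    then have "(\<lambda>l. \<bar>z l - x0\<bar>) \<longlonglongrightarrow> 0" by simp
    then have zl: "z \<longlonglongrightarrow> x0" by (simp add: tendsto_rabs_zero_iff LIM_zero_iff)
    define pl where "pl l = p + A' * (z l - x0)" for l
    have pll: "pl \<longlonglongrightarrow> p"
    proof -
      have "pl \<longlonglongrightarrow> p + A' * (x0 - x0)" unfolding pl_def by (intro tendsto_intros zl)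
      then show ?thesis by simp
    qed
    define B where "B = Max S / q"
    have B: "0 \<le> B" unfolding B_def by (rule bound_nonneg[OF ne])
    define R where "R = B + 1 + \<bar>p\<bar> + 1 + \<bar>A'\<bar>"
    define Kc where "Kc = Kconst c B R (r / 2)"
    have vrB: "vr l c y \<le> B" for l y using vr_le_V[of l c y] V_le[OF ne, of c y] by (simp add: B_def)
    have ev1: "eventually (\<lambda>l. \<bar>z l - x0\<bar> < r / 2) sequentially"
      using tendstoD[OF zl, of "r / 2"] r by (simp add: dist_real_def)
    have ev2: "eventually (\<lambda>l. \<theta> l < \<eta>) sequentially" using \<eta> by (intro order_tendstoD(2)[OF \<theta>l])
    have ev3: "eventually (\<lambda>l. \<bar>pl l - p\<bar> < 1) sequentially" using tendstoD[OF pll, of 1] by (simp add: dist_real_def)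
    have ev: "eventually (\<lambda>l. 0 \<le> (1 + Kc) * e l + (c - q * (\<psi> (z l) - \<theta> l) + pl l * (\<mu> - c) + \<sigma>\<^sup>2 / 2 * A')) sequentially"
      using ev1 ev2 ev3
    proof eventually_elim
      case (elim l)
      let ?z = "z l" and ?u = "vr l c (z l)"
      \<comment> \<open>The jet must lie above \<open>vr l c\<close> around the near-maximiser,
        which holds only after lifting it by the tolerance.\<close>
      define a where "a = ?u + (e l)\<^sup>2"
      have big: "V c1 x0 + \<eta> < ?u"
      proof -
        have "\<psi> x0 - \<eta> < \<psi> ?z" using r2(2)[of ?z] z(1)[of l] r by (simp add: abs_less_iff)
        then have "V c x0 - 2 * \<eta> < ?u" using zlow[of l] elim(2) \<psi>x by linarith
        then show ?thesis unfolding \<eta>_def by (simp add: field_simps)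
      qed
      have up: "0 < ?u" using big V_nonneg[of c1 x0] \<eta> by linarith
      have "v l c1 ?z < v l c ?z"
      proof -
        have "vr l c1 ?z < ?u" using vr_le_V[of l c1 ?z] r1(2)[of ?z] z(1)[of l] r big by (auto simp: abs_less_iff)
        then show ?thesis unfolding v_vr using vr_nonneg by (simp add: ennreal_less_iff)
      qed
      then have "v l c ?z \<le> K c (e l) (v l c) ?z"
        using v_sub[OF c next_S, of l ?z] by (auto simp: e_def max_def split: if_splits)
      also have "\<dots> = K c (e l) (\<lambda>y. ennreal (vr l c y)) ?z" unfolding v_vr[abs_def] ..
      also have "\<dots> \<le> ennreal (a + e l * (c - q * a + pl l * (\<mu> - c) + \<sigma>\<^sup>2 / 2 * A') + Kc * (e l)\<^sup>2)"
        unfolding Kc_def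
      proof (rule K_upper[OF e S_nonneg[OF c] _ vr_measurable vr_nonneg vrB])
        show "0 < r / 2" using r by simp
        have "(e l)\<^sup>2 \<le> 1" using e[of l] by (intro power_le_one) auto
        then show "\<bar>a\<bar> \<le> R" using vrB[of l ?z] vr_nonneg[of l c ?z] by (simp add: a_def R_def)
        show "\<bar>pl l\<bar> \<le> R" "\<bar>A'\<bar> \<le> R" using elim(3) B by (auto simp: R_def)
        show "0 \<le> ?z" using z(1)[of l] r r0 by auto
        fix d assume d: "\<bar>d\<bar> < r / 2"
        have "vr l c (?z + d) - \<psi> (?z + d) \<le> ?u - \<psi> ?z + (e l)\<^sup>2" proof (rule z(2))
          show "\<bar>?z + d - x0\<bar> < r" using d elim(1) by linarith
        qed
        moreover have "\<psi> (?z + d) = \<psi> ?z + pl l * d + A' / 2 * d\<^sup>2"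
          unfolding \<psi>_def pl_def by (simp add: power2_eq_square algebra_simps add_divide_distrib diff_divide_distrib)
        ultimately show "vr l c (?z + d) \<le> a + pl l * d + A' / 2 * d\<^sup>2" unfolding a_def by linarith
      qed
      finally have "ennreal ?u \<le> ennreal (a + e l * (c - q * a + pl l * (\<mu> - c) + \<sigma>\<^sup>2 / 2 * A') + Kc * (e l)\<^sup>2)" unfolding v_vr .
      then have "?u \<le> a + e l * (c - q * a + pl l * (\<mu> - c) + \<sigma>\<^sup>2 / 2 * A') + Kc * (e l)\<^sup>2"
        using up by (simp add: ennreal_le_iff2)
      then have "0 \<le> e l * ((1 + Kc) * e l + (c - q * a + pl l * (\<mu> - c) + \<sigma>\<^sup>2 / 2 * A'))"
        unfolding a_def by (simp add: algebra_simps power2_eq_square)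
      then have "0 \<le> (1 + Kc) * e l + (c - q * a + pl l * (\<mu> - c) + \<sigma>\<^sup>2 / 2 * A')"
        using e[of l] by (simp add: zero_le_mult_iff)
      moreover have "q * (\<psi> ?z - \<theta> l) \<le> q * a"
      proof (rule mult_left_mono)
        have "0 \<le> (e l)\<^sup>2" by simp
        then show "\<psi> ?z - \<theta> l \<le> a" using zlow[of l] unfolding a_def by linarith
      qed (use q_pos in simp)
      ultimately show ?case by linarith
    qed
    have "(\<lambda>l. \<psi> (z l)) \<longlonglongrightarrow> \<psi> x0" by (rule isCont_tendsto_compose[OF c\<psi> zl])
    then have "(\<lambda>l. (1 + Kc) * e l + (c - q * (\<psi> (z l) - \<theta> l) + pl l * (\<mu> - c) + \<sigma>\<^sup>2 / 2 * A'))
      \<longlonglongrightarrow> (1 + Kc) * 0 + (c - q * (\<psi> x0 - 0) + p * (\<mu> - c) + \<sigma>\<^sup>2 / 2 * A')"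
      by (intro tendsto_intros el \<theta>l pll)
    then have "0 \<le> (1 + Kc) * 0 + (c - q * (\<psi> x0 - 0) + p * (\<mu> - c) + \<sigma>\<^sup>2 / 2 * A')"
      by (rule tendsto_lowerbound[OF _ ev]) simp
    then show ?thesis unfolding \<psi>x A'_def by (simp add: algebra_simps)
  qed
  show ?thesis
  proof (rule ccontr)
    assume n: "\<not> ?thesis"
    define s where "s = \<sigma>\<^sup>2 / 2 * A + (\<mu> - c) * p - q * V c x0 + c"
    have s: "s < 0" using n by (simp add: s_def)
    define e0 where "e0 = - s / \<sigma>\<^sup>2"
    have "0 < e0" using s sigma_pos unfolding e0_def by (intro divide_pos_pos) auto
    from main[OF this] have "0 \<le> s + \<sigma>\<^sup>2 / 2 * e0" by (simp add: s_def algebra_simps add_divide_distrib)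
    also have "\<dots> = s / 2" using sigma_pos by (simp add: e0_def)
    finally show False using s by simp
  qed
qed


text \<open>Continuity of \<open>V c\<close> at the right end point \<open>y\<close> excludes that the infimum of \<open>V c - h\<close> on
  \<open>{0..y}\<close> is approached only at \<open>y\<close>; a monotone function has such points \<open>y\<close> in every interval.\<close>

lemma V_lipschitz_at_continuity_point:
  assumes c: "c \<in> S" and A0: "0 \<le> A0" "\<And>y. 0 \<le> y \<Longrightarrow> V c y \<le> A0 * y"
    and y: "0 < y" "y \<le> b" and cont: "isCont (V c) y" and t: "0 \<le> t" "t \<le> y"
  defines "\<kappa> \<equiv> 2 * (\<bar>\<mu> - c\<bar> + 1) / \<sigma>\<^sup>2"
  shows "V c y - V c t \<le> exp (\<kappa> * b) * (A0 + Max S + 1) * (y - t)"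
proof -
  have ne: "S \<noteq> {}" using c by auto
  define G0 where "G0 = A0 + Max S + 1"
  have MS: "0 \<le> Max S" using S_nonneg[OF Max_in[OF S_finite ne]] .
  have G0: "0 < G0" "A0 \<le> G0" "Max S + 1 \<le> G0" using A0 MS by (auto simp: G0_def)
  \<comment> \<open>The factor exp(\<kappa> * b) keeps the slope of \<open>h\<close> at least
    \<open>G0\<close> on all of {0..y}.\<close>
  define A where "A = exp (\<kappa> * b) * G0"
  have A: "0 < A" using G0 by (simp add: A_def)
  have \<kappa>: "0 < \<kappa>" "\<sigma>\<^sup>2 / 2 * \<kappa> = \<bar>\<mu> - c\<bar> + 1"
    using sigma_pos unfolding \<kappa>_def by (auto intro!: divide_pos_pos add_nonneg_pos)
  \<comment> \<open>A convex exponential through (y, V c y) with h'' = \<kappa> * h'. By the choice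
    of \<kappa> the second-order term dominates the drift and leaves a full h', which exceeds Max S,
    an upper bound for q * h on {0..y}. So \<open>h\<close> cannot touch \<open>V c\<close> from
    below inside.\<close>
  define h where "h s = V c y - A / \<kappa> * (1 - exp (- \<kappa> * (y - s)))" for s
  define h' where "h' s = A * exp (- \<kappa> * (y - s))" for s
  define h2 where "h2 s = A * \<kappa> * exp (- \<kappa> * (y - s))" for s
  have d1: "(h has_real_derivative h' s) (at s)" for s
    unfolding h_def h'_def using \<kappa> by (auto intro!: derivative_eq_intros)
  have d2: "(h' has_real_derivative h2 s) (at s)" for s
    unfolding h2_def h'_def by (auto intro!: derivative_eq_intros)
  have d3: "isCont h2 s" for s unfolding h2_def by (intro continuous_intros)
  have ch: "isCont h s" for s using d1 by (rule DERIV_isCont)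
  have Ge: "G0 \<le> A * exp (- \<kappa> * (y - s))" if "0 \<le> s" for s
  proof -
    have "\<kappa> * (y - s) \<le> \<kappa> * b" using \<kappa> y that by (intro mult_left_mono) auto
    then have "exp 0 \<le> exp (\<kappa> * b) * exp (- \<kappa> * (y - s))" unfolding exp_add[symmetric] by simp
    then have "G0 * exp 0 \<le> G0 * (exp (\<kappa> * b) * exp (- \<kappa> * (y - s)))" using G0 by (intro mult_left_mono) auto
    then show ?thesis by (simp add: A_def algebra_simps)
  qed
  \<comment> \<open>The linear growth of \<open>V c\<close> enters here: \<open>h\<close> starts at
    or below 0, so a negative infimum is not approached at 0.\<close>
  have h0: "h 0 \<le> 0"
  proof -
    have "y \<le> (exp (\<kappa> * y) - 1) / \<kappa>" using exp_ge_add_one_self[of "\<kappa> * y"] \<kappa> by (simp add: field_simps)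
    then have "G0 * y \<le> A * exp (- \<kappa> * y) * ((exp (\<kappa> * y) - 1) / \<kappa>)"
      using Ge[of 0] G0 y A by (intro mult_mono) auto
    also have "\<dots> = A / \<kappa> * (1 - exp (- \<kappa> * y))"
      by (simp add: exp_minus field_simps)
    finally have "G0 * y \<le> A / \<kappa> * (1 - exp (- \<kappa> * y))" .
    moreover have "V c y \<le> G0 * y"
      using A0(2)[of y] mult_right_mono[OF G0(2), of y] y by linarith
    ultimately show ?thesis by (simp add: h_def)
  qed
  have hle: "h s \<le> V c y" if "s \<le> y" for s
    using A \<kappa> that by (simp add: h_def)
  have hV: "h t \<le> V c t"
  proof (rule ccontr)
    assume n: "\<not> h t \<le> V c t"
    define f where "f s = V c s - h s" for s
    have bdd: "bdd_below (f ` {0..y})"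
    proof (rule bdd_belowI2)
      fix s assume "s \<in> {0..y}"
      then show "- V c y \<le> f s" using hle[of s] V_nonneg[of c s] by (simp add: f_def)
    qed
    define m0 where "m0 = Inf (f ` {0..y})"
    have m0f: "m0 \<le> f s" if "s \<in> {0..y}" for s unfolding m0_def using that by (intro cInf_lower bdd) auto
    have m0: "m0 < 0" using m0f[of t] t n by (simp add: f_def)
    have "\<exists>s\<in>{0..y}. f s < m0 + 1 / real (Suc k)" for k
    proof -
      have "m0 < m0 + 1 / real (Suc k)" by simp
      then show ?thesis unfolding m0_def using cInf_lessD[of "f ` {0..y}"] y by force
    qed
    then obtain zs where zs: "\<And>k. zs k \<in> {0..y}" "\<And>k. f (zs k) < m0 + 1 / real (Suc k)" by metis
    have fl: "(\<lambda>k. f (zs k)) \<longlonglongrightarrow> m0"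
    proof (rule tendsto_sandwich[of "\<lambda>_. m0" _ _ "\<lambda>k. m0 + 1 / real (Suc k)"])
      have "(\<lambda>k. m0 + 1 / real (Suc k)) \<longlonglongrightarrow> m0 + 0"
        by (intro tendsto_intros LIMSEQ_inverse_real_of_nat[unfolded inverse_eq_divide])
      then show "(\<lambda>k. m0 + 1 / real (Suc k)) \<longlonglongrightarrow> m0" by simp
    qed (use m0f zs in \<open>auto intro!: always_eventually less_imp_le simp del: of_nat_Suc\<close>)
    obtain z \<rho> where z: "z \<in> {0..y}" and \<rho>: "strict_mono (\<rho> :: nat \<Rightarrow> nat)" and lim: "(zs \<circ> \<rho>) \<longlonglongrightarrow> z"
      using compact_Icc[of 0 y] zs(1) unfolding compact_def by blast
    define zr where "zr k = zs (\<rho> k)" for k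
    have zr: "zr \<longlonglongrightarrow> z" "\<And>k. zr k \<in> {0..y}" using lim zs by (auto simp: zr_def[abs_def] o_def)
    have flr: "(\<lambda>k. f (zr k)) \<longlonglongrightarrow> m0"
      using LIMSEQ_subseq_LIMSEQ[OF fl \<rho>] by (simp add: zr_def o_def)
    have hl: "(\<lambda>k. h (zr k)) \<longlonglongrightarrow> h z" by (rule isCont_tendsto_compose[OF ch zr(1)])
    have Vl: "(\<lambda>k. V c (zr k)) \<longlonglongrightarrow> m0 + h z"
      using tendsto_add[OF flr hl] by (simp add: f_def)
    have z0: "z \<noteq> 0"
    proof
      assume "z = 0"
      then have "0 \<le> m0 + h 0" using Vl V_nonneg by (intro tendsto_lowerbound[OF Vl[unfolded \<open>z = 0\<close>]]) auto
      then show False using m0 h0 by linarith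
    qed
    have zy: "z \<noteq> y"
    proof
      assume "z = y"
      then have "(\<lambda>k. V c (zr k)) \<longlonglongrightarrow> V c y" using isCont_tendsto_compose[OF cont] zr by simp
      then have "V c y = m0 + h y" using Vl \<open>z = y\<close> LIMSEQ_unique by blast
      then show False using m0 by (simp add: h_def)
    qed
    have zz: "0 < z" "z < y" using z z0 zy by auto
    \<comment> \<open>The Taylor error then costs 1/2, half of the spare 1 in Max S + 1.\<close>
    define e where "e = 1 / \<sigma>\<^sup>2"
    have e: "0 < e" using sigma_pos by (simp add: e_def)
    obtain r where r: "r > 0" "\<And>s. \<bar>s - z\<bar> < r \<Longrightarrow> \<bar>h s - (h z + h' z * (s - z) + h2 z / 2 * (s - z)\<^sup>2)\<bar> \<le> e / 2 * (s - z)\<^sup>2"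
      using taylor2[OF d1 d2 d3 e, of z] by blast
    define r' where "r' = min r (min z (y - z))"
    have "\<sigma>\<^sup>2 / 2 * (h2 z - e) + (\<mu> - c) * h' z - q * (m0 + h z) + c \<le> 0"
    proof (rule V_super_jet[OF c _ _ _ zr(1) Vl])
      show "0 < r'" "r' \<le> z" using r zz by (auto simp: r'_def)
      fix s assume s: "\<bar>s - z\<bar> < r'"
      then have sr: "\<bar>s - z\<bar> < r" and "s \<in> {0..y}" by (auto simp: r'_def)
      then have "m0 + h s \<le> V c s" using m0f[of s] by (simp add: f_def)
      moreover have "(h2 z - e) / 2 * (s - z)\<^sup>2 = h2 z / 2 * (s - z)\<^sup>2 - e / 2 * (s - z)\<^sup>2" by (simp add: field_simps)
      ultimately show "m0 + h z + h' z * (s - z) + (h2 z - e) / 2 * (s - z)\<^sup>2 \<le> V c s"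
        using r(2)[OF sr] unfolding abs_le_iff by linarith
    qed
    moreover have "\<sigma>\<^sup>2 / 2 * e = 1 / 2" using sigma_pos by (simp add: e_def)
    moreover have "\<sigma>\<^sup>2 / 2 * (h2 z - e) = \<sigma>\<^sup>2 / 2 * h2 z - \<sigma>\<^sup>2 / 2 * e" by (rule right_diff_distrib)
    moreover have "\<sigma>\<^sup>2 / 2 * h2 z + (\<mu> - c) * h' z \<ge> h' z"
    proof -
      have "\<sigma>\<^sup>2 / 2 * h2 z = (\<sigma>\<^sup>2 / 2 * \<kappa>) * h' z" by (simp add: h2_def h'_def)
      also have "\<dots> = \<bar>\<mu> - c\<bar> * h' z + h' z" unfolding \<kappa>(2) by (simp add: algebra_simps)
      finally have "\<sigma>\<^sup>2 / 2 * h2 z = \<bar>\<mu> - c\<bar> * h' z + h' z" .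
      moreover have "- (\<bar>\<mu> - c\<bar> * h' z) \<le> (\<mu> - c) * h' z"
      proof -
        have "0 \<le> (\<bar>\<mu> - c\<bar> + (\<mu> - c)) * h' z" using A by (intro mult_nonneg_nonneg) (auto simp: h'_def)
        then show ?thesis by (simp add: algebra_simps)
      qed
      ultimately show ?thesis by linarith
    qed
    moreover have "Max S + 1 \<le> h' z" using Ge[of z] G0 zz by (simp add: h'_def)
    moreover have "q * (m0 + h z) \<le> Max S"
    proof -
      have "m0 + h z \<le> Max S / q" using hle[of z] zz m0 V_le[OF ne, of c y] by simp
      then have "q * (m0 + h z) \<le> q * (Max S / q)" using q_pos by (intro mult_left_mono) auto
      then show ?thesis using q_pos by simp
    qed
    ultimately show False using S_nonneg[OF c] by linarith
  qed
  have "V c y - V c t \<le> A / \<kappa> * (1 - exp (- \<kappa> * (y - t)))" using hV by (simp add: h_def)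
  also have "\<dots> \<le> A / \<kappa> * (\<kappa> * (y - t))"
    using exp_ge_add_one_self[of "- \<kappa> * (y - t)"] A \<kappa> by (intro mult_left_mono) auto
  also have "\<dots> = A * (y - t)" using \<kappa> by simp
  finally show ?thesis by (simp add: A_def G0_def)
qed

text \<open>Continuity points of the monotone \<open>V c\<close> are dense, so the estimate is taken
  from one slightly to the right of \<open>y\<close>; the constant is formed with b + 1 to make room
  for it.\<close>

lemma V_lipschitz: assumes c: "c \<in> S" shows "loc_lipschitz0 (V c)"
  unfolding loc_lipschitz0_def
proof (intro allI impI)
  fix b :: real assume b: "0 \<le> b"
  have ne: "S \<noteq> {}" using c by auto
  obtain A0 where A0: "0 \<le> A0" "\<And>y. 0 \<le> y \<Longrightarrow> V c y \<le> A0 * y" using V_linear_bound[OF ne] by blast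
  define L where "L = exp (2 * (\<bar>\<mu> - c\<bar> + 1) / \<sigma>\<^sup>2 * (b + 1)) * (A0 + Max S + 1)"
  have MS: "0 \<le> Max S" using S_nonneg[OF Max_in[OF S_finite ne]] .
  have L: "0 \<le> L" using A0 MS by (simp add: L_def)
  have lip: "V c y - V c t \<le> L * (y - t)" if "0 \<le> t" "t \<le> y" "y \<le> b" for t y
  proof (rule field_le_epsilon)
    fix e :: real assume e: "0 < e"
    define d where "d = min 1 (e / (L + 1))"
    have d: "0 < d" "d \<le> 1" "d \<le> e / (L + 1)" using e L by (auto simp: d_def)
    have "mono (V c)" by (rule monoI) (rule V_mono)
    then have "countable {a. \<not> isCont (V c) a}" by (rule mono_ctble_discont)
    then have "\<not> {y<..<y+d} \<subseteq> {a. \<not> isCont (V c) a}"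
      using uncountable_open_interval[of y "y + d"] d countable_subset by auto
    then obtain y' where y': "y < y'" "y' < y + d" "isCont (V c) y'" by auto
    have "V c y - V c t \<le> V c y' - V c t" using V_mono[of y y' c] y' by simp
    also have "\<dots> \<le> L * (y' - t)"
      unfolding L_def using that y' d by (intro V_lipschitz_at_continuity_point[OF c A0]) auto
    also have "\<dots> \<le> L * (y - t) + L * d" using y' L mult_left_mono[of "y' - t" "y - t + d" L] by (simp add: algebra_simps)
    also have "L * d \<le> e"
    proof -
      have "L * d \<le> (L + 1) * (e / (L + 1))" using d L by (intro mult_mono) auto
      then show ?thesis using L by simp
    qed
    finally show "V c y - V c t \<le> L * (y - t) + e" by simp
  qed
  have "L-lipschitz_on {0..b} (V c)"
  proof (rule lipschitz_onI[OF _ L])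
    fix s t assume st: "s \<in> {0..b}" "t \<in> {0..b}"
    show "dist (V c s) (V c t) \<le> L * dist s t"
    proof (cases "s \<le> t")
      case True
      then show ?thesis using lip[of s t] V_mono[of s t c] st by (simp add: dist_real_def)
    next
      case False
      then show ?thesis using lip[of t s] V_mono[of t s c] st by (simp add: dist_real_def)
    qed
  qed
  then show "\<exists>L. L-lipschitz_on {0..b} (V c)" by blast
qed

lemma V_continuous: "c \<in> S \<Longrightarrow> continuous_on {0..} (V c)"
  by (rule loc_lipschitz0_continuous[OF V_lipschitz])

lemma V_isCont: assumes "c \<in> S" "0 < y" shows "isCont (V c) y"
  using assms by (intro continuous_on_interior[OF V_continuous]) auto

text \<open>Touching \<open>V (Max S)\<close> from below by the flat parabolas \<open>- e * (s - R) ^ 2\<close> with \<open>e * R ^ 2\<close> constant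
  and \<open>R\<close> large gives points where \<open>V\<close> is almost \<open>Max S / q\<close>.\<close>

lemma V_limit: assumes c: "c \<in> S" shows "(V c \<longlongrightarrow> Max S / q) at_top"
proof -
  have ne: "S \<noteq> {}" using c by auto
  define k where "k = Max S"
  have kS: "k \<in> S" unfolding k_def by (rule Max_in[OF S_finite ne])
  define B where "B = Max S / q"
  have B: "0 \<le> B" unfolding B_def by (rule bound_nonneg[OF ne])
  have low: "\<exists>z\<ge>0. B - d \<le> V k z" if d: "0 < d" for d
  proof -
    define N where "N = (2 * B + 1) * (\<sigma>\<^sup>2 + 2 * \<bar>\<mu> - k\<bar>)"
    have N: "0 \<le> N" using B by (simp add: N_def)
    \<comment> \<open>Large enough that the first- and second-order terms of the parabola at the
      contact point, together at most N / R, do not exceed q*d.\<close>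
    define R where "R = 1 + N / (q * d)"
    have R: "1 \<le> R" using N q_pos d by (simp add: R_def)
    define e where "e = (2 * B + 1) / R\<^sup>2"
    have e: "0 < e" "e * R\<^sup>2 = 2 * B + 1" using B R by (auto simp: e_def)
    have "continuous_on {0..2*R} (\<lambda>s. V k s + e * (s - R)\<^sup>2)"
      by (intro continuous_intros continuous_on_subset[OF V_continuous[OF kS]]) auto
    then obtain z where z: "z \<in> {0..2*R}" "\<And>s. s \<in> {0..2*R} \<Longrightarrow> V k z + e * (z - R)\<^sup>2 \<le> V k s + e * (s - R)\<^sup>2"
      using continuous_attains_inf[OF compact_Icc, of 0 "2*R"] R by force
    have "e * (z - R)\<^sup>2 \<le> B" using z(2)[of R] R V_le[OF ne, of k R] V_nonneg[of k z] by (simp add: B_def)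
    then have "e * (z - R)\<^sup>2 < e * R\<^sup>2" using e B by simp
    then have "(z - R)\<^sup>2 < R\<^sup>2" using e(1) mult_less_cancel_left_pos by blast
    then have zr: "\<bar>z - R\<bar> < R" using R by (metis abs_of_pos power2_less_imp_less power2_abs less_imp_le zero_less_one order_less_le_trans)
    have "\<sigma>\<^sup>2 / 2 * (- 2 * e) + (\<mu> - k) * (- 2 * e * (z - R)) - q * V k z + k \<le> 0"
    proof (rule V_super_jet[OF kS, where zs = "\<lambda>_. z" and r = "R - \<bar>z - R\<bar>"])
      show "0 < R - \<bar>z - R\<bar>" using zr by simp
      show "R - \<bar>z - R\<bar> \<le> z" using z by auto
      fix s assume "\<bar>s - z\<bar> < R - \<bar>z - R\<bar>"
      then have "s \<in> {0..2*R}" by auto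
      from z(2)[OF this] show "V k z + - 2 * e * (z - R) * (s - z) + - 2 * e / 2 * (s - z)\<^sup>2 \<le> V k s"
        by (simp add: algebra_simps power2_eq_square)
    qed auto
    moreover have "\<bar>(\<mu> - k) * (- 2 * e * (z - R))\<bar> \<le> \<bar>\<mu> - k\<bar> * (2 * e * R)"
      unfolding abs_mult using zr e by (intro mult_mono) auto
    ultimately have "k - q * V k z \<le> \<sigma>\<^sup>2 * e + \<bar>\<mu> - k\<bar> * (2 * e * R)" by (simp add: abs_le_iff)
    also have "\<dots> \<le> N / R"
    proof -
      have eR: "e * R = (2 * B + 1) / R" using R by (simp add: e_def power2_eq_square)
      have "e \<le> e * R" using e R by simp
      then have "\<sigma>\<^sup>2 * e \<le> \<sigma>\<^sup>2 * (e * R)" by (intro mult_left_mono) auto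
      then have "\<sigma>\<^sup>2 * e + \<bar>\<mu> - k\<bar> * (2 * e * R) \<le> (e * R) * (\<sigma>\<^sup>2 + 2 * \<bar>\<mu> - k\<bar>)" by (simp add: algebra_simps)
      also have "\<dots> = N / R" unfolding eR N_def by simp
      finally show ?thesis .
    qed
    also have "\<dots> \<le> q * d"
    proof -
      have "N \<le> q * d * R" using q_pos d N by (simp add: R_def field_simps)
      then show ?thesis using R by (simp add: field_simps)
    qed
    finally have "k / q - V k z \<le> d" using q_pos by (simp add: field_simps)
    then show ?thesis using z by (intro exI[of _ z]) (auto simp: B_def k_def)
  qed
  show ?thesis
  proof (rule tendstoI)
    fix d :: real assume d: "0 < d"
    obtain z where z: "0 \<le> z" "B - d / 2 \<le> V k z" using low[of "d / 2"] d by auto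
    have "dist (V c y) (Max S / q) < d" if "z \<le> y" for y
    proof -
      have "V k z \<le> V k y" by (rule V_mono[OF that])
      also have "\<dots> \<le> V c y" by (rule V_anti) (use S_le_Max[OF c] in \<open>simp add: k_def\<close>)
      finally show ?thesis using z V_le[OF ne, of c y] d by (simp add: dist_real_def B_def)
    qed
    then show "eventually (\<lambda>y. dist (V c y) (Max S / q) < d) at_top"
      by (auto simp: eventually_at_top_linorder)
  qed
qed

section \<open>Identification with the value function and the viscosity property\<close>

lemma V_eq_VS: assumes "c \<in> S" shows "VS M W \<mu> \<sigma> q S y c = V c y"
  unfolding VS_def Let_def V_def VV_def v_def
  by (simp add: div_model.SUP_Jfun[OF div_model_axioms assms])

text \<open>A test function enters only through its 2-jet at \<open>z\<close>: the Taylor remainder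
  is absorbed in a curvature perturbation e', which costs e in the operator and is then sent to
  0.\<close>

lemma V_visc_solution:
  assumes c: "c \<in> S" and c1: "c1 \<in> S" "c < c1" and next_S: "\<And>c'. c' \<in> S \<Longrightarrow> c < c' \<Longrightarrow> c1 \<le> c'"
  shows "visc_solution \<mu> \<sigma> q c (V c1) (V c)"
  unfolding visc_solution_def
proof (intro allI impI conjI)
  fix z :: real assume z: "0 < z"
  have jet: "\<exists>f' f2 r. Lop \<mu> \<sigma> q c f z = \<sigma>\<^sup>2 / 2 * f2 + (\<mu> - c) * f' - q * f z + c \<and> 0 < r \<and> r \<le> z
     \<and> (\<forall>y. \<bar>y - z\<bar> < r \<longrightarrow> \<bar>f y - (f z + f' * (y - z) + f2 / 2 * (y - z)\<^sup>2)\<bar> \<le> e / 2 * (y - z)\<^sup>2)"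
    if C2f: "C2 f" and e0: "0 < e" for f e
  proof -
    obtain f' f2 where f: "\<And>y. (f has_real_derivative f' y) (at y)" "\<And>y. (f' has_real_derivative f2 y) (at y)" "continuous_on UNIV f2"
      using C2f unfolding C2_def by blast
    have "isCont f2 z" using f(3) by (simp add: continuous_on_eq_continuous_at)
    then obtain r where r: "r > 0" "\<And>y. \<bar>y - z\<bar> < r \<Longrightarrow> \<bar>f y - (f z + f' z * (y - z) + f2 z / 2 * (y - z)\<^sup>2)\<bar> \<le> e / 2 * (y - z)\<^sup>2"
      using taylor2[OF f(1,2) _ e0] by blast
    show ?thesis
      by (rule exI[of _ "f' z"], rule exI[of _ "f2 z"], rule exI[of _ "min r z"])
        (use r z Lop_eq[OF f(1) f(2)] in auto)
  qed
  show "visc_super \<mu> \<sigma> q c (V c1) (V c) z"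
    unfolding visc_super_def
  proof (intro conjI allI impI V_lipschitz[OF c])
    fix f assume f: "C2 f \<and> f z = V c z \<and> (\<forall>y\<ge>0. V c z - f z \<le> V c y - f y)"
    have "Lop \<mu> \<sigma> q c f z \<le> 0 + e" if "0 < e" for e
    proof -
      define e' where "e' = 2 * e / \<sigma>\<^sup>2"
      have e': "0 < e'" using that sigma_pos by (simp add: e'_def)
      obtain f' f2 r where L: "Lop \<mu> \<sigma> q c f z = \<sigma>\<^sup>2 / 2 * f2 + (\<mu> - c) * f' - q * f z + c" and r: "0 < r" "r \<le> z"
        and T: "\<And>y. \<bar>y - z\<bar> < r \<Longrightarrow> \<bar>f y - (f z + f' * (y - z) + f2 / 2 * (y - z)\<^sup>2)\<bar> \<le> e' / 2 * (y - z)\<^sup>2"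
        using jet[OF conjunct1[OF f] e'] by blast
      have "\<sigma>\<^sup>2 / 2 * (f2 - e') + (\<mu> - c) * f' - q * V c z + c \<le> 0"
      proof (rule V_super_jet[OF c r, where zs = "\<lambda>_. z"])
        fix y assume y: "\<bar>y - z\<bar> < r"
        then have "0 \<le> y" using r by auto
        then have "f y \<le> V c y" using f by auto
        moreover have "(f2 - e') / 2 * (y - z)\<^sup>2 = f2 / 2 * (y - z)\<^sup>2 - e' / 2 * (y - z)\<^sup>2" by (simp add: field_simps)
        ultimately show "V c z + f' * (y - z) + (f2 - e') / 2 * (y - z)\<^sup>2 \<le> V c y"
          using T[OF y] f unfolding abs_le_iff by linarith
      qed auto
      moreover have "\<sigma>\<^sup>2 / 2 * (f2 - e') = \<sigma>\<^sup>2 / 2 * f2 - e" using sigma_pos by (simp add: e'_def algebra_simps diff_divide_distrib)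
      ultimately show ?thesis unfolding L conjunct1[OF conjunct2[OF f]] by linarith
    qed
    then have "Lop \<mu> \<sigma> q c f z \<le> 0" by (rule field_le_epsilon)
    moreover have "V c1 z \<le> V c z" using c1 by (intro V_anti) simp
    ultimately show "max (Lop \<mu> \<sigma> q c f z) (V c1 z - f z) \<le> 0" using f by simp
  qed
  show "visc_sub \<mu> \<sigma> q c (V c1) (V c) z"
    unfolding visc_sub_def
  proof (intro allI impI)
    fix f assume f: "C2 f \<and> f z = V c z \<and> (\<forall>y\<ge>0. V c y - f y \<le> V c z - f z)"
    show "max (Lop \<mu> \<sigma> q c f z) (V c1 z - f z) \<ge> 0"
    proof (cases "V c1 z < V c z")
      case False then show ?thesis using f by simp
    next
      case True
      have "0 \<le> Lop \<mu> \<sigma> q c f z + e" if "0 < e" for e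
      proof -
        define e' where "e' = 2 * e / \<sigma>\<^sup>2"
        have e': "0 < e'" using that sigma_pos by (simp add: e'_def)
        obtain f' f2 r where L: "Lop \<mu> \<sigma> q c f z = \<sigma>\<^sup>2 / 2 * f2 + (\<mu> - c) * f' - q * f z + c" and r: "0 < r" "r \<le> z"
          and T: "\<And>y. \<bar>y - z\<bar> < r \<Longrightarrow> \<bar>f y - (f z + f' * (y - z) + f2 / 2 * (y - z)\<^sup>2)\<bar> \<le> e' / 2 * (y - z)\<^sup>2"
          using jet[OF conjunct1[OF f] e'] by blast
        have "0 \<le> \<sigma>\<^sup>2 / 2 * (f2 + e') + (\<mu> - c) * f' - q * V c z + c"
        proof (rule V_sub_jet[OF c next_S r V_isCont[OF c1(1) z] True])
          fix y assume y: "\<bar>y - z\<bar> < r"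
          then have "0 \<le> y" using r by auto
          then have "V c y \<le> f y" using f by auto
          moreover have "(f2 + e') / 2 * (y - z)\<^sup>2 = f2 / 2 * (y - z)\<^sup>2 + e' / 2 * (y - z)\<^sup>2" by (simp add: field_simps)
          ultimately show "V c y \<le> V c z + f' * (y - z) + (f2 + e') / 2 * (y - z)\<^sup>2"
            using T[OF y] f unfolding abs_le_iff by linarith
        qed auto
        moreover have "\<sigma>\<^sup>2 / 2 * (f2 + e') = \<sigma>\<^sup>2 / 2 * f2 + e" using sigma_pos by (simp add: e'_def algebra_simps add_divide_distrib)
        ultimately show ?thesis unfolding L conjunct1[OF conjunct2[OF f]] by linarith
      qed
      then have "0 \<le> Lop \<mu> \<sigma> q c f z" by (rule field_le_epsilon)
      then show ?thesis by simp
    qed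
  qed
qed

end

theorem mainTheorem8:
  fixes M :: "'a measure" and W :: "real \<Rightarrow> 'a \<Rightarrow> real"
    and \<mu> \<sigma> q :: real and n :: nat and cs :: "nat \<Rightarrow> real" and i :: nat
  assumes "std_BM M W" and "\<mu> > 0" and "\<sigma> > 0" and "q > 0"
    and "0 \<le> cs 1" and "\<forall>j. 1 \<le> j \<and> j < n \<longrightarrow> cs j < cs (Suc j)"
    and "1 \<le> i" and "i < n"
  shows "let S = cs ` {1..n}; cbar = cs n; V = (\<lambda>j x. VS M W \<mu> \<sigma> q S x (cs j)) in
     visc_solution \<mu> \<sigma> q (cs i) (V (Suc i)) (V i) \<and> V i 0 = 0 \<and> (V i \<longlongrightarrow> cbar / q) at_top
     \<and> (\<forall>u. visc_solution \<mu> \<sigma> q (cs i) (V (Suc i)) u \<and> u 0 = 0 \<and> (u \<longlongrightarrow> cbar / q) at_top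
            \<longrightarrow> (\<forall>x\<ge>0. u x = V i x))"
proof -
  define S where "S = cs ` {1..n}"
  have step: "cs j < cs (Suc j)" if "1 \<le> j" "j < n" for j using assms(6) that by blast
  have less: "cs j < cs k" if "1 \<le> j" "j < k" "k \<le> n" for j k
    using that(2,3)
  proof (induction k)
    case (Suc k)
    then show ?case using step[of k] \<open>1 \<le> j\<close> by (cases "j = k") fastforce+
  qed simp
  have le: "cs j \<le> cs k" if "1 \<le> j" "j \<le> k" "k \<le> n" for j k
    using less[of j k] that by (cases "j = k") auto
  have "finite S" by (simp add: S_def)
  moreover have "0 \<le> c" if "c \<in> S" for c
    using that le[of 1] assms(5) unfolding S_def by force
  \<comment> \<open>One interpretation serves all starting points, since \<open>V_eq_VS\<close>
    holds for every \<open>y\<close>.\<close>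
  ultimately interpret div_model M W \<mu> \<sigma> q 0 S
    by unfold_locales (use assms in auto)
  have MaxS: "Max S = cs n"
    by (rule Max_eqI) (use assms le in \<open>auto simp: S_def\<close>)
  have iS: "cs i \<in> S" and i1S: "cs (Suc i) \<in> S" and lt: "cs i < cs (Suc i)" using assms by (auto simp: S_def)
  have next_S: "cs (Suc i) \<le> c'" if c': "c' \<in> S" "cs i < c'" for c'
  proof -
    obtain k where k: "1 \<le> k" "k \<le> n" "c' = cs k" using c'(1) by (auto simp: S_def)
    have "\<not> k \<le> i" using le[of k i] k c'(2) assms(8) by auto
    then show ?thesis using le[of "Suc i" k] k by simp
  qed
  have V: "VS M W \<mu> \<sigma> q S y c = V c y" if "c \<in> S" for c y by (rule V_eq_VS[OF that])
  have ne: "S \<noteq> {}" using iS by auto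
  have sol: "visc_solution \<mu> \<sigma> q (cs i) (V (cs (Suc i))) (V (cs i))"
    by (rule V_visc_solution[OF iS i1S lt next_S])
  have lim: "(V (cs i) \<longlongrightarrow> cs n / q) at_top" using V_limit[OF iS] unfolding MaxS .
  have "u y = V (cs i) y" if "visc_solution \<mu> \<sigma> q (cs i) (V (cs (Suc i))) u" "u 0 = 0" "(u \<longlongrightarrow> cs n / q) at_top" "0 \<le> y" for u y
    by (rule visc_solution_unique[OF assms(3,4) that(1) sol V_continuous[OF i1S] _ that(3) lim that(4)])
      (simp add: that(2) V_zero[OF ne])
  then have "\<forall>u. visc_solution \<mu> \<sigma> q (cs i) (V (cs (Suc i))) u \<and> u 0 = 0 \<and> (u \<longlongrightarrow> cs n / q) at_top
      \<longrightarrow> (\<forall>y\<ge>0. u y = V (cs i) y)" by blast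
  with sol V_zero[OF ne, of "cs i"] lim show ?thesis
    unfolding Let_def S_def[symmetric] V[OF iS] V[OF i1S] by (intro conjI)
qed

end
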